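(* The ring $H^*(G/P)$ is isomorphic to the subring of $S(\mathfrak{t}^* )/I$ spanned (over $\mathbb{C}$) by $\{\mathfrak{S}_w: w \in W^J\}$, where each $\mathfrak{S}_w$ is the image \[\mathfrak{S}_w = \kappa(p_{w^{-1}}) = \frac{1}{|W|}\sum_{v \in W} p_{w^{-1}}(v).\] For $w \in W^J$ the Grassmannian Schubert polynomial $\mathfrak{S}_w$ is 1. a homogeneous polynomial of degree $\ell_P([w])$; 2. positive in the simple roots $\alpha_i$ (when written as a polynomial in $\alpha_1,\dots,\alpha_n$, all its coefficients are nonnegative); 3. and gives the structure constants $c_{uv}^w$ of the Schubert classes in $H^*(G/P)$ up to the ideal $I$, via the expression \[ \mathfrak{S}_u \mathfrak{S}_v = \sum_{w \in W^J} c_{uv}^w\, \mathfrak{S}_w \mod I \qquad (u,v\in W^J).\]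
   Context: $G$ is a complex semisimple linear algebraic group, $T \subseteq B \subseteq P \subseteq G$ with $T$ a maximal torus, $B$ a Borel subgroup, $P$ a parabolic subgroup; $\mathfrak{t} = \mathrm{Lie}(T)$. $W=N(T)/T$ is the Weyl group, $\Delta^+$ the positive roots (those of $B$), $\alpha_1,\dots,\alpha_n$ the simple roots, $s_1,\dots,s_n$ the simple reflections, $s_\alpha$ the reflection in $\alpha$. $J \subseteq \{1,\dots,n\}$ is the subset corresponding to $P$ (so $i\in J$ iff $\mathfrak{g}_{-\alpha_i} \subseteq \mathrm{Lie}(P)$), $W_J = \langle s_i : i \in J\rangle$, $[w]=wW_J \in W/W_J$, $W^J\subseteq W$ is the set of unique minimal-length representatives of the cosets in $W/W_J$, $\ell_P([w])$ is the length in $W$ of the minimal-length representative of $[w]$, and $\le_P$ is the Bruhat order on $W/W_J$, i.e. the Bruhat order of $W$ on minimal-length representatives. $S(\mathfrak{t}^* )$ is the symmetric algebra over $\mathbb{C}$ with its natural $W$-action, and $I \subseteq S(\mathfrak{t}^* )$ is the ideal generated by the $W$-invariant $f$ with $f(0)=0$. Cohomology has complex coefficients, and $H^*_T(G/P)$ is given in its GKM presentation: it is the ring (coordinatewise operations) of functions $p : W/W_J \to S(\mathfrak{t}^* )$ such that $p([s_\alpha w]) - p([w]) \in (\alpha)$ for all $w \in W$, $\alpha\in\Delta^+$ with $[s_\alpha w] \neq [w]$. The ordinary cohomology ring is $H^*(G/P) = H^*_T(G/P)/(\alpha_1,\dots,\alpha_n)H^*_T(G/P)$. Moment graph of $G/P$: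 vertices $W/W_J$; for $\alpha \in \Delta^+$ there is an edge labeled $\alpha$ between $[w]$ and $[s_\alpha w]$ whenever $[s_\alpha w]\neq [w]$, directed $[w] \mapsto [s_\alpha w]$ if $w^{-1}(\alpha)<0$ and $[s_\alpha w]\mapsto [w]$ otherwise. The flow-up (equivariant Schubert) class $p_{[w]} \in H^*_T(G/P)$ is the homogeneous class supported exactly on the $[v]$ with $[v] \ge_P [w]$ and with $p_{[w]}([w])$ equal to the product of the labels of all edges directed out of $[w]$; its image in $H^*(G/P)$ is the Schubert class, and these form a $\mathbb{C}$-basis. The structure constants $c_{uv}^w$ ($u,v,w\in W^J$) are defined by $p_{[u]}p_{[v]} = \sum_{w \in W^J} c_{uv}^w p_{[w]}$ in $H^*(G/P)$. The case $P=B$, $J=\emptyset$ gives $H^*_T(G/B)$ with flow-up classes $p_w$, $w\in W$. For $p \in H^*_T(G/B)$, $\kappa(p) = \frac{1}{|W|}\sum_{v\in W} p(v)$, regarded as a polynomial in $S(\mathfrak{t}^* )$ or as its class in $S(\mathfrak{t}^* )/I$. *)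

theory Defs
  imports
    "HOL-Library.Poly_Mapping"
    "HOL-Library.Nonpos_Ints"
    "HOL-Algebra.Algebra"
begin

section \<open>Root data\<close>

text \<open>
  The type \<open>'v\<close>, with scalar multiplication \<open>rscale\<close>, is the complex vector space
  \<open>t\<^sup>*\<close>. The number \<open>coroot R \<alpha> v\<close> is the value of \<open>v\<close> at the coroot of \<open>\<alpha>\<close>; on the roots it
  is determined by the other fields.
\<close>

record 'v root_datum =
  rscale :: "complex \<Rightarrow> 'v \<Rightarrow> 'v"
  roots :: "'v set"
  coroot :: "'v \<Rightarrow> 'v \<Rightarrow> complex"
  rank :: nat
  simple_root :: "nat \<Rightarrow> 'v"

definition reflection :: "'v::ab_group_add root_datum \<Rightarrow> 'v \<Rightarrow> 'v \<Rightarrow> 'v" where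
  "reflection R \<alpha> v = v - rscale R (coroot R \<alpha> v) \<alpha>"

definition pos_roots :: "'v::ab_group_add root_datum \<Rightarrow> 'v set" where
  "pos_roots R = {\<beta> \<in> roots R. \<exists>c::nat \<Rightarrow> nat.
     \<beta> = (\<Sum>i\<in>{1..rank R}. rscale R (of_nat (c i)) (simple_root R i))}"

text \<open>
  A reduced crystallographic root system (in the sense of Bourbaki, over the field of complex
  numbers) with a base. These are exactly the root systems of complex semisimple groups \<open>G\<close> with
  respect to a maximal torus \<open>T\<close>, and the bases correspond to the Borel subgroups containing \<open>T\<close>.
\<close>

locale based_root_system = vector_space "rscale R"
  for R :: "'v::ab_group_add root_datum" +
  assumes finite_roots: "finite (roots R)"
    and zero_notin_roots: "0 \<notin> roots R"
    and span_roots: "span (roots R) = UNIV"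
    and linear_coroot: "\<alpha> \<in> roots R \<Longrightarrow> Vector_Spaces.linear (rscale R) (*) (coroot R \<alpha>)"
    and coroot_self: "\<alpha> \<in> roots R \<Longrightarrow> coroot R \<alpha> \<alpha> = 2"
    and coroot_Ints: "\<alpha> \<in> roots R \<Longrightarrow> \<beta> \<in> roots R \<Longrightarrow> coroot R \<alpha> \<beta> \<in> \<int>"
    and reflection_roots: "\<alpha> \<in> roots R \<Longrightarrow> \<beta> \<in> roots R \<Longrightarrow> reflection R \<alpha> \<beta> \<in> roots R"
    and reduced: "\<alpha> \<in> roots R \<Longrightarrow> rscale R c \<alpha> \<in> roots R \<Longrightarrow> c = 1 \<or> c = - 1"
    and simple_roots: "simple_root R ` {1..rank R} \<subseteq> roots R"
    and inj_simple_root: "inj_on (simple_root R) {1..rank R}"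
    and independent_simple_roots: "independent (simple_root R ` {1..rank R})"
    and pos_or_neg: "\<beta> \<in> roots R \<Longrightarrow> \<beta> \<in> pos_roots R \<or> - \<beta> \<in> pos_roots R"

section \<open>The Weyl group and its parabolic cosets\<close>

definition weyl :: "'v::ab_group_add root_datum \<Rightarrow> ('v \<Rightarrow> 'v) monoid" where
  "weyl R = subgroup_generated (BijGroup UNIV) (reflection R ` roots R)"

definition simple_reflection :: "'v::ab_group_add root_datum \<Rightarrow> nat \<Rightarrow> 'v \<Rightarrow> 'v" where
  "simple_reflection R i = reflection R (simple_root R i)"

definition parabolic :: "'v::ab_group_add root_datum \<Rightarrow> nat set \<Rightarrow> ('v \<Rightarrow> 'v) set" where
  "parabolic R J = generate (weyl R) (simple_reflection R ` J)"

definition wcoset :: "'v::ab_group_add root_datum \<Rightarrow> nat set \<Rightarrow> ('v \<Rightarrow> 'v) \<Rightarrow> ('v \<Rightarrow> 'v) set" where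
  "wcoset R J w = w <#\<^bsub>weyl R\<^esub> parabolic R J"

definition wcosets :: "'v::ab_group_add root_datum \<Rightarrow> nat set \<Rightarrow> ('v \<Rightarrow> 'v) set set" where
  "wcosets R J = wcoset R J ` carrier (weyl R)"

definition weyl_length :: "'v::ab_group_add root_datum \<Rightarrow> ('v \<Rightarrow> 'v) \<Rightarrow> nat" where
  "weyl_length R w = (LEAST k. \<exists>is. length is = k \<and> set is \<subseteq> {1..rank R} \<and>
     w = foldr (\<lambda>i v. simple_reflection R i \<otimes>\<^bsub>weyl R\<^esub> v) is \<one>\<^bsub>weyl R\<^esub>)"

definition bruhat_le :: "'v::ab_group_add root_datum \<Rightarrow> ('v \<Rightarrow> 'v) \<Rightarrow> ('v \<Rightarrow> 'v) \<Rightarrow> bool" where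
  "bruhat_le R u w \<longleftrightarrow> (u, w) \<in> {(x, y). \<exists>\<alpha>\<in>pos_roots R. x \<in> carrier (weyl R) \<and>
     y = reflection R \<alpha> \<otimes>\<^bsub>weyl R\<^esub> x \<and> weyl_length R x < weyl_length R y}\<^sup>*"

definition min_reps :: "'v::ab_group_add root_datum \<Rightarrow> nat set \<Rightarrow> ('v \<Rightarrow> 'v) set" where
  "min_reps R J = {w \<in> carrier (weyl R).
     \<forall>v \<in> wcoset R J w. v \<noteq> w \<longrightarrow> weyl_length R w < weyl_length R v}"

definition min_rep :: "'v::ab_group_add root_datum \<Rightarrow> ('v \<Rightarrow> 'v) set \<Rightarrow> 'v \<Rightarrow> 'v" where
  "min_rep R C = arg_min (weyl_length R) (\<lambda>v. v \<in> C)"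

definition coset_length :: "'v::ab_group_add root_datum \<Rightarrow> ('v \<Rightarrow> 'v) set \<Rightarrow> nat" where
  "coset_length R C = weyl_length R (min_rep R C)"

definition coset_le :: "'v::ab_group_add root_datum \<Rightarrow> ('v \<Rightarrow> 'v) set \<Rightarrow> ('v \<Rightarrow> 'v) set \<Rightarrow> bool" where
  "coset_le R C D \<longleftrightarrow> bruhat_le R (min_rep R C) (min_rep R D)"

section \<open>The symmetric algebra\<close>

text \<open>
  The simple roots are a basis of \<open>t\<^sup>*\<close>, so \<open>S(t\<^sup>*)\<close> is the polynomial ring in
  \<open>\<alpha>\<^sub>1, \<dots>, \<alpha>\<^sub>n\<close>. The \<open>i\<close>-th variable stands for \<open>\<alpha>\<^sub>i\<close>, a monomial is its finitely supported
  exponent function, and \<open>lin_form\<close> is the inclusion of \<open>t\<^sup>*\<close> as the polynomials of degree one.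
\<close>

type_synonym cpoly = "(nat \<Rightarrow>\<^sub>0 nat) \<Rightarrow>\<^sub>0 complex"

definition const_poly :: "complex \<Rightarrow> cpoly" where
  "const_poly c = Poly_Mapping.single 0 c"

definition var_poly :: "nat \<Rightarrow> cpoly" where
  "var_poly i = Poly_Mapping.single (Poly_Mapping.single i 1) 1"

definition sym_alg :: "'v root_datum \<Rightarrow> cpoly ring" where
  "sym_alg R = \<lparr>carrier = {f. \<forall>m \<in> Poly_Mapping.keys f. Poly_Mapping.keys m \<subseteq> {1..rank R}},
     monoid.mult = (*), one = 1, ring.zero = 0, add = (+)\<rparr>"

definition homogeneous :: "nat \<Rightarrow> cpoly \<Rightarrow> bool" where
  "homogeneous d f \<longleftrightarrow>
     (\<forall>m \<in> Poly_Mapping.keys f. (\<Sum>i \<in> Poly_Mapping.keys m. Poly_Mapping.lookup m i) = d)"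

definition lin_form :: "'v::ab_group_add root_datum \<Rightarrow> 'v \<Rightarrow> cpoly" where
  "lin_form R v = (\<Sum>i\<in>{1..rank R}.
     const_poly (module.representation (rscale R) (simple_root R ` {1..rank R}) v (simple_root R i))
       * var_poly i)"

text \<open>The algebra endomorphism of \<open>S(t\<^sup>*)\<close> that extends \<open>w\<close>.\<close>

definition weyl_act :: "'v::ab_group_add root_datum \<Rightarrow> ('v \<Rightarrow> 'v) \<Rightarrow> cpoly \<Rightarrow> cpoly" where
  "weyl_act R w f = (\<Sum>m \<in> Poly_Mapping.keys f. const_poly (Poly_Mapping.lookup f m) *
     (\<Prod>i \<in> Poly_Mapping.keys m. lin_form R (w (simple_root R i)) ^ Poly_Mapping.lookup m i))"

definition coinv_ideal :: "'v::ab_group_add root_datum \<Rightarrow> cpoly set" where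
  "coinv_ideal R = Idl\<^bsub>sym_alg R\<^esub> {f \<in> carrier (sym_alg R).
     (\<forall>w \<in> carrier (weyl R). weyl_act R w f = f) \<and> Poly_Mapping.lookup f 0 = 0}"

definition coinv_ring :: "'v::ab_group_add root_datum \<Rightarrow> cpoly set ring" where
  "coinv_ring R = sym_alg R Quot coinv_ideal R"

definition coinv_class :: "'v::ab_group_add root_datum \<Rightarrow> cpoly \<Rightarrow> cpoly set" where
  "coinv_class R f = coinv_ideal R +>\<^bsub>sym_alg R\<^esub> f"

definition coinv_scale :: "'v::ab_group_add root_datum \<Rightarrow> complex \<Rightarrow> cpoly set \<Rightarrow> cpoly set" where
  "coinv_scale R c x = coinv_class R (const_poly c) \<otimes>\<^bsub>coinv_ring R\<^esub> x"

section \<open>Equivariant and ordinary cohomology\<close>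

type_synonym 'v gkm = "('v \<Rightarrow> 'v) set \<Rightarrow> cpoly"

definition HT :: "'v::ab_group_add root_datum \<Rightarrow> nat set \<Rightarrow> 'v gkm ring" where
  "HT R J = \<lparr>carrier = {p \<in> wcosets R J \<rightarrow>\<^sub>E carrier (sym_alg R).
       \<forall>w \<in> carrier (weyl R). \<forall>\<alpha> \<in> pos_roots R.
         wcoset R J (reflection R \<alpha> \<otimes>\<^bsub>weyl R\<^esub> w) \<noteq> wcoset R J w \<longrightarrow>
         p (wcoset R J (reflection R \<alpha> \<otimes>\<^bsub>weyl R\<^esub> w)) - p (wcoset R J w)
           \<in> PIdl\<^bsub>sym_alg R\<^esub> (lin_form R \<alpha>)},
     monoid.mult = (\<lambda>p q. \<lambda>C\<in>wcosets R J. p C * q C),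
     one = (\<lambda>C\<in>wcosets R J. 1),
     ring.zero = (\<lambda>C\<in>wcosets R J. 0),
     add = (\<lambda>p q. \<lambda>C\<in>wcosets R J. p C + q C)\<rparr>"

text \<open>The structure map of \<open>H\<^sub>T\<^sup>*(G/P)\<close> as an \<open>S(t\<^sup>*)\<close>-algebra.\<close>

definition HT_const :: "'v::ab_group_add root_datum \<Rightarrow> nat set \<Rightarrow> cpoly \<Rightarrow> 'v gkm" where
  "HT_const R J f = (\<lambda>C\<in>wcosets R J. f)"

definition simple_root_ideal :: "'v::ab_group_add root_datum \<Rightarrow> nat set \<Rightarrow> 'v gkm set" where
  "simple_root_ideal R J =
     Idl\<^bsub>HT R J\<^esub> ((\<lambda>i. HT_const R J (lin_form R (simple_root R i))) ` {1..rank R})"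

definition cohom :: "'v::ab_group_add root_datum \<Rightarrow> nat set \<Rightarrow> 'v gkm set ring" where
  "cohom R J = HT R J Quot simple_root_ideal R J"

definition cohom_class :: "'v::ab_group_add root_datum \<Rightarrow> nat set \<Rightarrow> 'v gkm \<Rightarrow> 'v gkm set" where
  "cohom_class R J p = simple_root_ideal R J +>\<^bsub>HT R J\<^esub> p"

definition cohom_scale ::
    "'v::ab_group_add root_datum \<Rightarrow> nat set \<Rightarrow> complex \<Rightarrow> 'v gkm set \<Rightarrow> 'v gkm set" where
  "cohom_scale R J c x = cohom_class R J (HT_const R J (const_poly c)) \<otimes>\<^bsub>cohom R J\<^esub> x"

section \<open>Flow-up classes and structure constants\<close>

text \<open>
  Edges are triples (source, label, target). Their direction does not depend on the chosen
  representative \<open>w\<close>, because \<open>W\<^sub>J\<close> permutes the positive roots outside the span of the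
  \<open>\<alpha>\<^sub>j\<close> with \<open>j \<in> J\<close>.
\<close>

definition moment_edges ::
    "'v::ab_group_add root_datum \<Rightarrow> nat set \<Rightarrow> (('v \<Rightarrow> 'v) set \<times> 'v \<times> ('v \<Rightarrow> 'v) set) set" where
  "moment_edges R J = {(C, \<alpha>, D). \<alpha> \<in> pos_roots R \<and> (\<exists>w \<in> carrier (weyl R).
     wcoset R J (reflection R \<alpha> \<otimes>\<^bsub>weyl R\<^esub> w) \<noteq> wcoset R J w \<and>
     (if - ((inv\<^bsub>weyl R\<^esub> w) \<alpha>) \<in> pos_roots R
      then C = wcoset R J w \<and> D = wcoset R J (reflection R \<alpha> \<otimes>\<^bsub>weyl R\<^esub> w)
      else C = wcoset R J (reflection R \<alpha> \<otimes>\<^bsub>weyl R\<^esub> w) \<and> D = wcoset R J w))}"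

definition is_flow_up ::
    "'v::ab_group_add root_datum \<Rightarrow> nat set \<Rightarrow> ('v \<Rightarrow> 'v) \<Rightarrow> 'v gkm \<Rightarrow> bool" where
  "is_flow_up R J w p \<longleftrightarrow> p \<in> carrier (HT R J) \<and>
     (\<exists>d. \<forall>C \<in> wcosets R J. homogeneous d (p C)) \<and>
     (\<forall>C \<in> wcosets R J. p C \<noteq> 0 \<longleftrightarrow> coset_le R (wcoset R J w) C) \<and>
     p (wcoset R J w) =
       (\<Prod>(C, \<alpha>, D) \<in> {e \<in> moment_edges R J. fst e = wcoset R J w}. lin_form R \<alpha>)"

definition flow_up :: "'v::ab_group_add root_datum \<Rightarrow> nat set \<Rightarrow> ('v \<Rightarrow> 'v) \<Rightarrow> 'v gkm" where
  "flow_up R J w = (THE p. is_flow_up R J w p)"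

definition schubert_class ::
    "'v::ab_group_add root_datum \<Rightarrow> nat set \<Rightarrow> ('v \<Rightarrow> 'v) \<Rightarrow> 'v gkm set" where
  "schubert_class R J w = cohom_class R J (flow_up R J w)"

definition struct_const :: "'v::ab_group_add root_datum \<Rightarrow> nat set \<Rightarrow>
    ('v \<Rightarrow> 'v) \<Rightarrow> ('v \<Rightarrow> 'v) \<Rightarrow> ('v \<Rightarrow> 'v) \<Rightarrow> complex" where
  "struct_const R J u v = (THE c. (\<forall>w. w \<notin> min_reps R J \<longrightarrow> c w = 0) \<and>
     schubert_class R J u \<otimes>\<^bsub>cohom R J\<^esub> schubert_class R J v =
       (\<Oplus>\<^bsub>cohom R J\<^esub> w \<in> min_reps R J. cohom_scale R J (c w) (schubert_class R J w)))"

section \<open>Grassmannian Schubert polynomials\<close>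

text \<open>For \<open>P = B\<close>, that is \<open>J = {}\<close>, the vertex of \<open>v \<in> W\<close> is the coset \<open>wcoset R {} v = {v}\<close>.\<close>

definition kappa :: "'v::ab_group_add root_datum \<Rightarrow> 'v gkm \<Rightarrow> cpoly" where
  "kappa R p = const_poly (1 / of_nat (card (carrier (weyl R)))) *
     (\<Sum>v \<in> carrier (weyl R). p (wcoset R {} v))"

definition schubert_poly :: "'v::ab_group_add root_datum \<Rightarrow> ('v \<Rightarrow> 'v) \<Rightarrow> cpoly" where
  "schubert_poly R w = kappa R (flow_up R {} (inv\<^bsub>weyl R\<^esub> w))"

definition schubert_span :: "'v::ab_group_add root_datum \<Rightarrow> nat set \<Rightarrow> cpoly set set" where
  "schubert_span R J =
     {coinv_class R (\<Sum>w \<in> min_reps R J. const_poly (c w) * schubert_poly R w) |c. True}"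

end

theory Submission
  imports Defs
begin

text \<open>
  Pulled back along \<open>G/B \<rightarrow> G/P\<close>, a class of \<open>G/P\<close> is a function \<open>q\<close> on the Weyl group that satisfies
  the GKM conditions and is right invariant under \<open>W\<^sub>J\<close>. Right divided differences send \<open>p\<^sub>w\<close> to
  \<open>p\<^bsub>w s\<^esub>\<close> or to \<open>0\<close>, left ones send it to \<open>p\<^bsub>s w\<^esub>\<close> or to \<open>0\<close>. The averaging map \<open>\<kappa>\<close> turns the left ones
  into the divided differences of \<open>S(t\<^sup>*)\<close>, which therefore send \<open>\<SS>\<^sub>w\<close> to \<open>\<SS>\<^bsub>w s\<^esub>\<close> or to \<open>0\<close>.

  A GKM function is a unique combination of the \<open>p\<^sub>w\<close> with polynomial coefficients, and its class in
  ordinary cohomology consists of the constant terms of these coefficients. The characteristic map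
  sends a polynomial \<open>f\<close> to the GKM function \<open>v \<mapsto> (- v) f\<close>. It is multiplicative and turns the divided
  differences of \<open>S(t\<^sup>*)\<close> into the right ones, so that \<open>\<SS>\<^sub>w\<close> has the same constant terms as \<open>p\<^sub>w\<close>. All
  constant terms of \<open>f\<close> vanish if and only if \<open>f \<in> I\<close>; hence \<open>p\<^sub>w \<mapsto> \<SS>\<^sub>w\<close> is multiplicative modulo \<open>I\<close>, and
  injective.
\<close>

text \<open>The inverse in \<open>Sch\<close> exchanges the sides: averaging over \<open>W\<close>
  absorbs left translations only, and a left divided difference changes \<open>P (inv' w)\<close>
  the way right multiplication changes \<open>w\<close>. The obstacle is that \<open>I\<close> is
  given by generators, while injectivity needs a test for membership. The test comes from a
  triangular argument instead of a count of dimensions: the coefficients of top length of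
  \<open>char_map f\<close> are themselves invariant polynomials, so, once their constant terms
  vanish, they can be removed by subtracting elements of \<open>I\<close>. The classes on
  \<open>W\<close> are constructed without geometry. The product of all positive roots, placed at a
  single vertex, starts the construction. Their support is found only afterwards, from the
  nonnegativity of all values: such polynomials cannot cancel, so the support obeys the same
  recursion as the Bruhat order. Division by roots uses no theory of factorization: a root divides a
  polynomial if and only if a certain ring endomorphism kills it, which makes the root
  prime.\<close>

abbreviation lookup where "lookup \<equiv> Poly_Mapping.lookup"
abbreviation keys where "keys \<equiv> Poly_Mapping.keys"

section \<open>Polynomials\<close>

definition mon_subst :: "(nat \<Rightarrow> cpoly) \<Rightarrow> (nat \<Rightarrow>\<^sub>0 nat) \<Rightarrow> cpoly" where
  "mon_subst g m = (\<Prod>i\<in>keys m. g i ^ lookup m i)"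

text \<open>The Weyl group action, the characteristic map, evaluation at the origin, the scaling of
  degrees and the projection along a root are all instances of this one endomorphism.\<close>

definition subst :: "(nat \<Rightarrow> cpoly) \<Rightarrow> cpoly \<Rightarrow> cpoly" where
  "subst g f = (\<Sum>m\<in>keys f. const_poly (lookup f m) * mon_subst g m)"

lemma const_poly_simps [simp]:
  "const_poly 0 = 0" "const_poly 1 = 1"
  by (auto simp: const_poly_def)

lemma const_poly_add: "const_poly (a + b) = const_poly a + const_poly b"
  and const_poly_mult: "const_poly (a * b) = const_poly a * const_poly b"
  and const_poly_uminus: "const_poly (- a) = - const_poly a"
  by (auto simp: const_poly_def single_add mult_single single_uminus)

lemma const_poly_diff: "const_poly (a - b) = const_poly a - const_poly b"
  by (simp add: const_poly_def single_diff)

lemma lookup_const_mult [simp]: "lookup (const_poly c * f) m = c * lookup f m"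
proof -
  have "const_poly c * f = Poly_Mapping.map ((*) c) f"
    by (simp add: const_poly_def mult_map_scale_conv_mult)
  then show ?thesis
    by (simp add: Poly_Mapping.map.rep_eq when_def)
qed

lemma lookup_const_poly: "lookup (const_poly c) m = (if m = 0 then c else 0)"
  by (simp add: const_poly_def lookup_single when_def)

lemma const_poly_eq_iff [simp]: "const_poly a = const_poly b \<longleftrightarrow> a = b"
  unfolding const_poly_def by (rule inj_eq[OF inj_single])

lemma const_poly_eq_0_iff [simp]: "const_poly a = 0 \<longleftrightarrow> a = 0"
  using const_poly_eq_iff[of a 0] by (simp del: const_poly_eq_iff)

lemma single_eq_const_mult: "Poly_Mapping.single m c = const_poly c * Poly_Mapping.single m 1"
  by (simp add: const_poly_def mult_single)

lemma cpoly_sum_monomials: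
  fixes f :: cpoly
  shows "f = (\<Sum>m\<in>keys f. Poly_Mapping.single m (lookup f m))"
proof (rule poly_mapping_eqI)
  fix k
  show "lookup f k = lookup (\<Sum>m\<in>keys f. Poly_Mapping.single m (lookup f m)) k"
    by (auto simp: lookup_sum lookup_single when_def in_keys_iff)
qed

lemma subst_superset:
  assumes "finite A" "keys f \<subseteq> A"
  shows "subst g f = (\<Sum>m\<in>A. const_poly (lookup f m) * mon_subst g m)"
  unfolding subst_def using assms
  by (intro sum.mono_neutral_left) (auto simp: in_keys_iff)

lemma subst_0 [simp]: "subst g 0 = 0"
  by (simp add: subst_def)

lemma subst_add: "subst g (f + f') = subst g f + subst g f'"
proof -
  have *: "finite (keys f \<union> keys f')" by simp
  show ?thesis
    using subst_superset[OF *, of f g] subst_superset[OF *, of f' g]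
      subst_superset[OF *, of "f + f'" g] Poly_Mapping.keys_add[of f f']
    by (simp add: lookup_add const_poly_add distrib_right sum.distrib)
qed

lemma subst_sum: "subst g (sum f A) = (\<Sum>x\<in>A. subst g (f x))"
  by (induction A rule: infinite_finite_induct) (auto simp: subst_add)

lemma subst_single: "subst g (Poly_Mapping.single m c) = const_poly c * mon_subst g m"
  by (cases "c = 0") (auto simp: subst_def)

lemma mon_subst_0 [simp]: "mon_subst g 0 = 1"
  by (simp add: mon_subst_def)

lemma mon_subst_superset:
  assumes "finite A" "keys m \<subseteq> A"
  shows "mon_subst g m = (\<Prod>i\<in>A. g i ^ lookup m i)"
  unfolding mon_subst_def using assms
  by (intro prod.mono_neutral_left) (auto simp: in_keys_iff)

lemma mon_subst_add: "mon_subst g (m + m') = mon_subst g m * mon_subst g m'"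
proof -
  have *: "finite (keys m \<union> keys m')" by simp
  show ?thesis
    using mon_subst_superset[OF *, of m g] mon_subst_superset[OF *, of m' g]
      mon_subst_superset[OF *, of "m + m'" g] Poly_Mapping.keys_add[of m m']
    by (simp add: lookup_add power_add prod.distrib)
qed

lemma subst_mult: "subst g (f * f') = subst g f * subst g f'"
proof -
  have "subst g (f * f') = subst g ((\<Sum>m\<in>keys f. Poly_Mapping.single m (lookup f m)) *
      (\<Sum>m\<in>keys f'. Poly_Mapping.single m (lookup f' m)))"
    using cpoly_sum_monomials[of f] cpoly_sum_monomials[of f'] by simp
  also have "\<dots> = (\<Sum>m\<in>keys f. \<Sum>m'\<in>keys f'.
      subst g (Poly_Mapping.single m (lookup f m)) * subst g (Poly_Mapping.single m' (lookup f' m')))"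
    by (simp add: sum_product subst_sum mult_single subst_single mon_subst_add const_poly_mult mult_ac)
  also have "\<dots> = (\<Sum>m\<in>keys f. subst g (Poly_Mapping.single m (lookup f m))) *
      (\<Sum>m'\<in>keys f'. subst g (Poly_Mapping.single m' (lookup f' m')))"
    by (simp add: sum_product)
  also have "\<dots> = subst g f * subst g f'"
    using cpoly_sum_monomials[of f] cpoly_sum_monomials[of f'] by (metis subst_sum)
  finally show ?thesis .
qed

lemma subst_const [simp]: "subst g (const_poly c) = const_poly c"
  using subst_single[of g 0 c] by (simp add: const_poly_def)

lemma subst_1 [simp]: "subst g 1 = 1"
  using subst_const[of g 1] by simp

lemma subst_var [simp]: "subst g (var_poly i) = g i"
  using subst_single[of g "Poly_Mapping.single i 1" 1]
  by (simp add: var_poly_def mon_subst_def)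

lemma subst_uminus: "subst g (- f) = - subst g f"
  using subst_add[of g f "- f"] by (simp add: eq_neg_iff_add_eq_0 add.commute)

lemma subst_diff: "subst g (f - f') = subst g f - subst g f'"
  using subst_add[of g f "- f'"] by (simp add: subst_uminus)

lemma subst_prod: "subst g (prod f A) = (\<Prod>x\<in>A. subst g (f x))"
  by (induction A rule: infinite_finite_induct) (auto simp: subst_mult)

section \<open>Polynomials in a given set of variables\<close>

definition polys_in :: "nat set \<Rightarrow> cpoly set" where
  "polys_in V = {f. \<forall>m\<in>keys f. keys m \<subseteq> V}"

lemma carrier_sym_alg: "carrier (sym_alg R) = polys_in {1..rank R}"
  by (simp add: sym_alg_def polys_in_def)

lemma polys_in_const [simp, intro]: "const_poly c \<in> polys_in V"
  by (auto simp: polys_in_def const_poly_def)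

lemma polys_in_0 [simp, intro]: "0 \<in> polys_in V" and polys_in_1 [simp, intro]: "1 \<in> polys_in V"
  using polys_in_const[of 0 V] polys_in_const[of 1 V] by simp_all

lemma polys_in_var: "i \<in> V \<Longrightarrow> var_poly i \<in> polys_in V"
  by (auto simp: polys_in_def var_poly_def)

lemma polys_in_add: "f \<in> polys_in V \<Longrightarrow> g \<in> polys_in V \<Longrightarrow> f + g \<in> polys_in V"
  using Poly_Mapping.keys_add[of f g] by (fastforce simp: polys_in_def)

lemma polys_in_mult:
  assumes "f \<in> polys_in V" "g \<in> polys_in V" shows "f * g \<in> polys_in V"
proof -
  have "keys m \<subseteq> V" if m: "m \<in> keys (f * g)" for m
  proof -
    obtain a b where "m = a + b" "a \<in> keys f" "b \<in> keys g"
      using keys_mult[of f g] m by blast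
    then show ?thesis
      using assms Poly_Mapping.keys_add[of a b] by (fastforce simp: polys_in_def)
  qed
  then show ?thesis by (simp add: polys_in_def)
qed

lemma polys_in_uminus: "f \<in> polys_in V \<Longrightarrow> - f \<in> polys_in V"
  by (simp add: polys_in_def)

lemma polys_in_diff: "f \<in> polys_in V \<Longrightarrow> g \<in> polys_in V \<Longrightarrow> f - g \<in> polys_in V"
  using polys_in_add[of f V "- g"] polys_in_uminus[of g V] by simp

lemma polys_in_sum: "(\<And>x. x \<in> A \<Longrightarrow> f x \<in> polys_in V) \<Longrightarrow> sum f A \<in> polys_in V"
  by (induction A rule: infinite_finite_induct) (auto simp: polys_in_add)

lemma polys_in_prod: "(\<And>x. x \<in> A \<Longrightarrow> f x \<in> polys_in V) \<Longrightarrow> prod f A \<in> polys_in V"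
  by (induction A rule: infinite_finite_induct) (auto simp: polys_in_mult)

lemma single_eq_mon_subst: "Poly_Mapping.single m 1 = mon_subst var_poly m"
proof -
  have power: "var_poly i ^ n = Poly_Mapping.single (Poly_Mapping.single i n) 1" for i n
    by (induction n) (auto simp: var_poly_def mult_single single_add[symmetric])
  have "finite A \<Longrightarrow> (\<Prod>i\<in>A. var_poly i ^ lookup m i)
      = Poly_Mapping.single (\<Sum>i\<in>A. Poly_Mapping.single i (lookup m i)) 1" for A
    by (induction A rule: finite_induct) (auto simp: power mult_single)
  moreover have "m = (\<Sum>i\<in>keys m. Poly_Mapping.single i (lookup m i))"
    by (rule poly_mapping_eqI) (auto simp: lookup_sum lookup_single when_def in_keys_iff)
  ultimately show ?thesis
    by (simp add: mon_subst_def)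
qed

text \<open>Constants and variables generate the ring, so an identity between homomorphisms or a
  closure property has to be checked on them only. The induction hypotheses retain membership in
  \<open>polys_in V\<close>.\<close>

lemma polys_in_induct [consumes 1, case_names const var add mult]:
  assumes "f \<in> polys_in V"
    and const: "\<And>c. P (const_poly c)"
    and var: "\<And>i. i \<in> V \<Longrightarrow> P (var_poly i)"
    and add: "\<And>f g. f \<in> polys_in V \<Longrightarrow> g \<in> polys_in V \<Longrightarrow> P f \<Longrightarrow> P g \<Longrightarrow> P (f + g)"
    and mult: "\<And>f g. f \<in> polys_in V \<Longrightarrow> g \<in> polys_in V \<Longrightarrow> P f \<Longrightarrow> P g \<Longrightarrow> P (f * g)"
  shows "P f"
proof -
  have P0: "P 0" and P1: "P 1" using const[of 0] const[of 1] by auto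
  have power: "f ^ n \<in> polys_in V \<and> P (f ^ n)" if "P f" "f \<in> polys_in V" for f n
    using that by (induction n) (auto simp: P1 mult polys_in_mult)
  have prod: "finite A \<Longrightarrow> A \<subseteq> V \<Longrightarrow>
      (\<Prod>i\<in>A. var_poly i ^ e i) \<in> polys_in V \<and> P (\<Prod>i\<in>A. var_poly i ^ e i)" for A e
    by (induction A rule: finite_induct) (auto simp: P1 mult power var polys_in_var polys_in_mult)
  have single: "Poly_Mapping.single m c \<in> polys_in V \<and> P (Poly_Mapping.single m c)"
    if "keys m \<subseteq> V" for m c
    using prod[OF finite_keys that, of "lookup m"] mult[OF _ _ const[of c]]
    unfolding single_eq_const_mult[of m c] single_eq_mon_subst mon_subst_def
    by (auto intro: polys_in_mult)
  have "(\<Sum>m\<in>A. Poly_Mapping.single m (lookup f m)) \<in> polys_in V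
      \<and> P (\<Sum>m\<in>A. Poly_Mapping.single m (lookup f m))" if "finite A" "A \<subseteq> keys f" for A
    using that
  proof (induction A rule: finite_induct)
    case (insert m A)
    have "keys m \<subseteq> V"
      using insert.prems assms(1) by (simp add: polys_in_def)
    then show ?case
      using single[of m "lookup f m"] insert polys_in_add add by simp
  qed (simp add: P0)
  from this[OF finite_keys subset_refl] show ?thesis
    using cpoly_sum_monomials[of f] by simp
qed

lemma subst_cong:
  assumes "f \<in> polys_in V" "\<And>i. i \<in> V \<Longrightarrow> g i = h i"
  shows "subst g f = subst h f"
  using assms by (induction rule: polys_in_induct) (auto simp: subst_add subst_mult)

lemma subst_id: "subst var_poly f = f"
proof -
  have "f \<in> polys_in UNIV" by (simp add: polys_in_def)
  then show ?thesis
    by (induction rule: polys_in_induct) (auto simp: subst_add subst_mult)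
qed

lemma subst_subst: "subst g (subst h f) = subst (\<lambda>i. subst g (h i)) f"
proof -
  have "f \<in> polys_in UNIV" by (simp add: polys_in_def)
  then show ?thesis
    by (induction rule: polys_in_induct) (auto simp: subst_add subst_mult)
qed

lemma subst_in:
  assumes "f \<in> polys_in U" "\<And>i. i \<in> U \<Longrightarrow> g i \<in> polys_in V"
  shows "subst g f \<in> polys_in V"
  using assms
  by (induction rule: polys_in_induct) (auto simp: subst_add subst_mult polys_in_add polys_in_mult)

text \<open>Modulo \<open>l\<close> both substitutions agree on the generators; the product step is
  \<open>x y - x' y' = (x - x') y + x' (y - y')\<close>. The GKM condition of the characteristic map
  and the divisibility of \<open>f - act (s \<beta>) f\<close> by \<beta> both come from
  here.\<close>

lemma dvd_subst_diff:
  assumes "f \<in> polys_in V" "\<And>i. i \<in> V \<Longrightarrow> l dvd g i - h i"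
  shows "l dvd subst g f - subst h f"
  using assms
proof (induction rule: polys_in_induct)
  case (add f f')
  then have "l dvd (subst g f - subst h f) + (subst g f' - subst h f')" by (intro dvd_add) auto
  then show ?case by (simp add: subst_add algebra_simps)
next
  case (mult f f')
  then have "l dvd (subst g f - subst h f) * subst g f' + subst h f * (subst g f' - subst h f')"
    by (intro dvd_add) auto
  then show ?case by (simp add: subst_mult algebra_simps)
qed auto

text \<open>Setting all variables outside \<open>V\<close> to 0 fixes \<open>l\<close> and
  \<open>l * k\<close>, hence fixes \<open>k\<close> after cancellation. This keeps quotients by
  roots inside \<open>S\<close>, although the ambient ring has infinitely many variables.\<close>

lemma polys_in_cofactor:
  assumes "l \<in> polys_in V" "l \<noteq> 0" "l * k \<in> polys_in V"
  shows "k \<in> polys_in V"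
proof -
  define g where "g i = (if i \<in> V then var_poly i else 0)" for i
  have fix_g: "subst g f = f" if "f \<in> polys_in V" for f
    using subst_cong[OF that, of g var_poly] by (simp add: g_def subst_id)
  have "l * subst g k = l * k"
    using fix_g[OF assms(3)] fix_g[OF assms(1)] by (simp add: subst_mult)
  then have "k = subst g k" using assms(2) by simp
  moreover have "subst g k \<in> polys_in V"
    by (rule subst_in[of _ UNIV]) (auto simp: polys_in_def[of UNIV] g_def polys_in_var)
  ultimately show ?thesis by simp
qed

lemma polys_in_dvdE:
  assumes "l dvd f" "l \<in> polys_in V" "l \<noteq> 0" "f \<in> polys_in V"
  obtains k where "k \<in> polys_in V" "f = l * k"
  using assms polys_in_cofactor by (metis dvdE)

section \<open>The constant term\<close>

definition eval0 :: "cpoly \<Rightarrow> complex" where "eval0 f = lookup f 0"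

text \<open>Evaluation at the origin is a substitution, and substitutions are already known to be
  multiplicative; the constant term thereby becomes a ring homomorphism.\<close>

lemma eval0_subst: "const_poly (eval0 f) = subst (\<lambda>_. 0) f"
proof -
  have mon: "mon_subst (\<lambda>_. 0) m = (if m = 0 then 1 else 0)" for m
  proof (cases "m = 0")
    case False
    then obtain i where "i \<in> keys m" by (metis keys_eq_empty ex_in_conv keys_zero poly_mapping_eqI lookup_zero not_in_keys_iff_lookup_eq_zero)
    then show ?thesis
      using False by (auto simp: mon_subst_def in_keys_iff power_0_left intro!: prod_zero)
  qed auto
  show ?thesis
    by (auto simp: subst_def mon eval0_def in_keys_iff sum.delta' if_distrib[of "(*) _"] cong: if_cong)
qed

lemma eval0_mult: "eval0 (f * g) = eval0 f * eval0 g"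
proof -
  have "const_poly (eval0 (f * g)) = const_poly (eval0 f * eval0 g)"
    by (simp only: eval0_subst subst_mult const_poly_mult)
  then show ?thesis by simp
qed

lemma eval0_add: "eval0 (f + g) = eval0 f + eval0 g"
  and eval0_diff: "eval0 (f - g) = eval0 f - eval0 g"
  and eval0_const [simp]: "eval0 (const_poly c) = c"
  and eval0_0 [simp]: "eval0 0 = 0"
  and eval0_1 [simp]: "eval0 1 = 1"
  by (auto simp: eval0_def lookup_add lookup_minus lookup_const_poly)

lemma eval0_var [simp]: "eval0 (var_poly i) = 0"
proof -
  have "Poly_Mapping.single i (1::nat) \<noteq> 0"
    by (metis lookup_single_eq lookup_zero zero_neq_one)
  then show ?thesis by (simp add: eval0_def var_poly_def lookup_single_not_eq)
qed

lemma eval0_sum: "eval0 (sum f A) = (\<Sum>x\<in>A. eval0 (f x))"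
  by (induction A rule: infinite_finite_induct) (auto simp: eval0_add)

lemma eval0_subst_fixed:
  assumes "f \<in> polys_in V" "\<And>i. i \<in> V \<Longrightarrow> eval0 (g i) = 0"
  shows "eval0 (subst g f) = eval0 f"
  using assms by (induction rule: polys_in_induct) (auto simp: subst_add subst_mult eval0_add eval0_mult)

subsection \<open>Homogeneous polynomials\<close>

text \<open>The part of degree \<open>d\<close> is multiplied by \<open>2 ^ d\<close>. The factor 2
  is chosen because its powers are pairwise distinct complex numbers, so that eigenvalues separate
  degrees.\<close>

definition dbl :: "cpoly \<Rightarrow> cpoly" where
  "dbl = subst (\<lambda>i. const_poly 2 * var_poly i)"

abbreviation mdeg :: "(nat \<Rightarrow>\<^sub>0 nat) \<Rightarrow> nat" where
  "mdeg m \<equiv> (\<Sum>i\<in>keys m. lookup m i)"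

lemma lookup_dbl: "lookup (dbl f) m = 2 ^ mdeg m * lookup f m"
proof -
  have mon: "mon_subst (\<lambda>i. const_poly 2 * var_poly i) m = const_poly (2 ^ mdeg m) * Poly_Mapping.single m 1" for m
  proof -
    have *: "const_poly 2 ^ n = const_poly (2 ^ n)" for n
      by (induction n) (auto simp: const_poly_mult)
    have **: "(\<Prod>i\<in>A. const_poly (2 ^ e i)) = const_poly (2 ^ sum e A)" if "finite A" for A :: "nat set" and e
      using that by (induction A rule: finite_induct) (auto simp: const_poly_mult power_add)
    show ?thesis
      by (simp add: mon_subst_def single_eq_mon_subst power_mult_distrib prod.distrib * **)
  qed
  have "lookup (dbl f) m = (\<Sum>m'\<in>keys f. lookup f m' * (2 ^ mdeg m' * lookup (Poly_Mapping.single m' 1) m))"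
    by (simp add: dbl_def subst_def lookup_sum mon)
  also have "\<dots> = (\<Sum>m'\<in>keys f. if m' = m then lookup f m' * 2 ^ mdeg m' else 0)"
    by (intro sum.cong) (auto simp: lookup_single when_def)
  also have "\<dots> = 2 ^ mdeg m * lookup f m"
    by (auto simp: in_keys_iff)
  finally show ?thesis .
qed

text \<open>Being homogeneous is an eigenvalue equation for a ring endomorphism, so that it passes to
  products and to quotients at once.\<close>

lemma homogeneous_iff_dbl: "homogeneous d f \<longleftrightarrow> dbl f = const_poly (2 ^ d) * f"
proof
  assume h: "homogeneous d f"
  show "dbl f = const_poly (2 ^ d) * f"
  proof (rule poly_mapping_eqI)
    fix m show "lookup (dbl f) m = lookup (const_poly (2 ^ d) * f) m"
      using h by (cases "m \<in> keys f") (auto simp: lookup_dbl homogeneous_def in_keys_iff)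
  qed
next
  assume h: "dbl f = const_poly (2 ^ d) * f"
  have "mdeg m = d" if "m \<in> keys f" for m
  proof -
    have "(2::complex) ^ mdeg m * lookup f m = 2 ^ d * lookup f m"
      using arg_cong[OF h, of "\<lambda>f. lookup f m"] by (simp add: lookup_dbl)
    then have "(2::complex) ^ mdeg m = 2 ^ d"
      using that by (simp add: in_keys_iff)
    then have "(of_nat (2 ^ mdeg m) :: complex) = of_nat (2 ^ d)" by simp
    then show ?thesis by (simp only: of_nat_eq_iff) simp
  qed
  then show "homogeneous d f" by (simp add: homogeneous_def)
qed

lemma homogeneous_0 [simp]: "homogeneous d 0"
  by (simp add: homogeneous_def)

lemma homogeneous_const [simp]: "homogeneous 0 (const_poly c)"
  by (simp add: homogeneous_iff_dbl dbl_def)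

lemma homogeneous_1 [simp]: "homogeneous 0 1"
  using homogeneous_const[of 1] by simp

lemma homogeneous_var: "homogeneous 1 (var_poly i)"
  by (simp add: homogeneous_iff_dbl dbl_def)

lemma homogeneous_add: "homogeneous d f \<Longrightarrow> homogeneous d g \<Longrightarrow> homogeneous d (f + g)"
  by (simp add: homogeneous_iff_dbl dbl_def subst_add distrib_left)

lemma homogeneous_diff: "homogeneous d f \<Longrightarrow> homogeneous d g \<Longrightarrow> homogeneous d (f - g)"
  by (simp add: homogeneous_iff_dbl dbl_def subst_diff right_diff_distrib)

lemma homogeneous_mult:
  "homogeneous d f \<Longrightarrow> homogeneous e g \<Longrightarrow> homogeneous (d + e) (f * g)"
  by (simp add: homogeneous_iff_dbl dbl_def subst_mult power_add const_poly_mult mult_ac)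

lemma homogeneous_sum: "(\<And>x. x \<in> A \<Longrightarrow> homogeneous d (f x)) \<Longrightarrow> homogeneous d (sum f A)"
  by (induction A rule: infinite_finite_induct) (auto simp: homogeneous_add)

lemma homogeneous_prod:
  "finite A \<Longrightarrow> (\<And>x. x \<in> A \<Longrightarrow> homogeneous 1 (f x)) \<Longrightarrow> homogeneous (card A) (prod f A)"
proof (induction A rule: finite_induct)
  case (insert x A)
  then have "homogeneous (1 + card A) (f x * prod f A)"
    by (intro homogeneous_mult) auto
  then show ?case using insert by simp
qed simp

lemma homogeneous_unique:
  assumes "homogeneous d f" "homogeneous e f" "f \<noteq> 0" shows "d = e"
proof -
  have "const_poly (2 ^ d) = const_poly (2 ^ e)"
    using assms by (simp add: homogeneous_iff_dbl)
  then have "(of_nat (2 ^ d) :: complex) = of_nat (2 ^ e)" by simp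
  then show ?thesis by (simp only: of_nat_eq_iff) simp
qed

lemma homogeneous_cofactor:
  assumes "homogeneous d (l * k)" "homogeneous e l" "l \<noteq> 0" "e \<le> d"
  shows "homogeneous (d - e) k"
proof -
  have "const_poly (2 ^ e) * l * dbl k = const_poly (2 ^ e) * l * (const_poly (2 ^ (d - e)) * k)"
  proof -
    have "const_poly (2 ^ e) * l * dbl k = dbl (l * k)"
      using assms(2) by (simp add: homogeneous_iff_dbl dbl_def subst_mult)
    also have "\<dots> = const_poly (2 ^ (e + (d - e))) * (l * k)"
      using assms(1,4) by (simp add: homogeneous_iff_dbl)
    finally show ?thesis by (simp only: power_add const_poly_mult mult_ac)
  qed
  then show ?thesis using assms(3) by (simp add: homogeneous_iff_dbl)
qed

text \<open>Complements \<open>homogeneous_cofactor\<close> for \<open>d < e\<close>: a monomial of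
  \<open>k\<close> would have the eigenvalue of the negative degree \<open>d - e\<close>. This is
  what forces GKM functions of small degree to vanish.\<close>

lemma homogeneous_dvd_zero:
  assumes "homogeneous d (l * k)" "homogeneous e l" "l \<noteq> 0" "d < e"
  shows "k = 0"
proof (rule ccontr)
  assume "k \<noteq> 0"
  then obtain m where m: "lookup k m \<noteq> 0" by (metis lookup_zero poly_mapping_eqI)
  have "l * (const_poly (2 ^ e) * dbl k) = l * (const_poly (2 ^ d) * k)"
    using assms(1,2) by (simp add: homogeneous_iff_dbl dbl_def subst_mult mult_ac)
  then have "const_poly (2 ^ e) * dbl k = const_poly (2 ^ d) * k"
    using assms(3) by simp
  from arg_cong[OF this, of "\<lambda>f. lookup f m"]
  have "(2::complex) ^ (e + mdeg m) = 2 ^ d"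
    using m by (simp add: lookup_dbl power_add)
  then have "(of_nat (2 ^ (e + mdeg m)) :: complex) = of_nat (2 ^ d)" by simp
  then have "e + mdeg m = d" by (simp only: of_nat_eq_iff) simp
  then show False using assms(4) by simp
qed

lemma homogeneous_eval0: "homogeneous d f \<Longrightarrow> d > 0 \<Longrightarrow> eval0 f = 0"
  unfolding homogeneous_def eval0_def by (cases "0 \<in> keys f") (force simp: in_keys_iff)+

subsection \<open>Polynomials with nonnegative coefficients\<close>

definition nonneg_poly :: "cpoly \<Rightarrow> bool" where
  "nonneg_poly f \<longleftrightarrow> (\<forall>m. lookup f m \<in> \<real>\<^sub>\<ge>\<^sub>0)"

lemma nonneg_poly_add: "nonneg_poly f \<Longrightarrow> nonneg_poly g \<Longrightarrow> nonneg_poly (f + g)"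
  by (simp add: nonneg_poly_def lookup_add nonneg_Reals_add_I)

lemma nonneg_poly_const: "c \<in> \<real>\<^sub>\<ge>\<^sub>0 \<Longrightarrow> nonneg_poly (const_poly c)"
  by (simp add: nonneg_poly_def lookup_const_poly)

lemma nonneg_poly_0: "nonneg_poly 0" and nonneg_poly_1: "nonneg_poly 1"
  by (auto simp: nonneg_poly_def lookup_one when_def)

lemma nonneg_poly_var: "nonneg_poly (var_poly i)"
  by (simp add: nonneg_poly_def var_poly_def lookup_single when_def)

lemma nonneg_poly_sum: "(\<And>x. x \<in> A \<Longrightarrow> nonneg_poly (f x)) \<Longrightarrow> nonneg_poly (sum f A)"
  by (induction A rule: infinite_finite_induct) (auto simp: nonneg_poly_add nonneg_poly_0)

lemma nonneg_poly_mult: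
  assumes "nonneg_poly f" "nonneg_poly g" shows "nonneg_poly (f * g)"
proof -
  have "f * g = (\<Sum>m\<in>keys f. \<Sum>m'\<in>keys g. Poly_Mapping.single (m + m') (lookup f m * lookup g m'))"
    by (subst cpoly_sum_monomials[of f], subst cpoly_sum_monomials[of g])
      (simp add: sum_product mult_single)
  moreover have "nonneg_poly (Poly_Mapping.single (m + m') (lookup f m * lookup g m'))" for m m'
    using assms by (auto simp: nonneg_poly_def lookup_single when_def intro!: nonneg_Reals_mult_I)
  ultimately show ?thesis by (simp add: nonneg_poly_sum)
qed

text \<open>The absence of cancellation is what turns the recursion for the values of a Schubert
  class into a recursion for its support.\<close>

lemma nonneg_poly_add_eq_0_iff:
  assumes "nonneg_poly f" "nonneg_poly g"
  shows "f + g = 0 \<longleftrightarrow> f = 0 \<and> g = 0"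
proof
  assume eq: "f + g = 0"
  have "lookup f m = 0 \<and> lookup g m = 0" for m
  proof -
    have sum0: "lookup f m + lookup g m = 0"
      using arg_cong[OF eq, of "\<lambda>f. lookup f m"] by (simp add: lookup_add)
    obtain x y where "lookup f m = of_real x" "lookup g m = of_real y" "0 \<le> x" "0 \<le> y"
      using assms by (metis nonneg_poly_def nonneg_Reals_cases)
    moreover from this sum0 have "x + y = 0" by (metis of_real_add of_real_eq_0_iff)
    ultimately show ?thesis by (simp add: add_nonneg_eq_0_iff)
  qed
  then show "f = 0 \<and> g = 0" by (metis lookup_zero poly_mapping_eqI)
qed auto

lemma nonneg_poly_sum_eq_0_iff:
  assumes "finite A" "\<And>x. x \<in> A \<Longrightarrow> nonneg_poly (f x)"
  shows "sum f A = 0 \<longleftrightarrow> (\<forall>x\<in>A. f x = 0)"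
  using assms
  by (induction A rule: finite_induct) (auto simp: nonneg_poly_add_eq_0_iff nonneg_poly_sum)

definition quot :: "cpoly \<Rightarrow> cpoly \<Rightarrow> cpoly" where
  "quot f l = (THE k. f = l * k)"

lemma quot_eq: "l \<noteq> 0 \<Longrightarrow> f = l * k \<Longrightarrow> quot f l = k"
  by (auto simp: quot_def)

lemma mult_quot: "l \<noteq> 0 \<Longrightarrow> l dvd f \<Longrightarrow> l * quot f l = f"
  by (auto elim!: dvdE simp: quot_eq)

section \<open>The Weyl group of a based root system\<close>

context based_root_system
begin

abbreviation s :: "'v \<Rightarrow> 'v \<Rightarrow> 'v" where "s \<equiv> reflection R"
abbreviation a :: "nat \<Rightarrow> 'v" where "a \<equiv> simple_root R"
abbreviation sm :: "complex \<Rightarrow> 'v \<Rightarrow> 'v" (infixr \<open>\<cdot>\<close> 75) where "c \<cdot> x \<equiv> rscale R c x"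
abbreviation pos :: "'v set" where "pos \<equiv> pos_roots R"
abbreviation W :: "('v \<Rightarrow> 'v) set" where "W \<equiv> carrier (weyl R)"

definition Ix :: "nat set" where "Ix = {1..rank R}"

lemma finite_Ix [simp]: "finite Ix"
  by (simp add: Ix_def)

lemmas inj_simple_Ix = inj_simple_root[folded Ix_def]
lemmas independent_simple_Ix = independent_simple_roots[folded Ix_def]

lemma pos_roots_Ix:
  "pos = {\<beta> \<in> roots R. \<exists>c::nat \<Rightarrow> nat. \<beta> = (\<Sum>i\<in>Ix. of_nat (c i) \<cdot> a i)}"
  by (simp add: pos_roots_def Ix_def)

section \<open>Linear maps, coroots and reflections\<close>

definition lmap :: "('v \<Rightarrow> 'v) \<Rightarrow> bool" where
  "lmap A \<longleftrightarrow> (\<forall>x y. A (x + y) = A x + A y) \<and> (\<forall>c x. A (c \<cdot> x) = c \<cdot> A x)"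

lemma lmap_add: "lmap A \<Longrightarrow> A (x + y) = A x + A y"
  and lmap_scale: "lmap A \<Longrightarrow> A (c \<cdot> x) = c \<cdot> A x"
  by (auto simp: lmap_def)

lemma lmap_0: "lmap A \<Longrightarrow> A 0 = 0"
  using lmap_scale[of A 0 0] by simp

lemma lmap_uminus: "lmap A \<Longrightarrow> A (- x) = - A x"
  using lmap_scale[of A "-1" x] by simp

lemma lmap_diff: "lmap A \<Longrightarrow> A (x - y) = A x - A y"
  using lmap_add[of A x "- y"] lmap_uminus[of A y] by simp

lemma lmap_sum: "lmap A \<Longrightarrow> A (sum f Z) = (\<Sum>x\<in>Z. A (f x))"
  by (induction Z rule: infinite_finite_induct) (auto simp: lmap_0 lmap_add)

lemma lmap_comp: "lmap A \<Longrightarrow> lmap B \<Longrightarrow> lmap (A \<circ> B)"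
  by (simp add: lmap_def)

lemma lmap_id: "lmap id"
  by (simp add: lmap_def)

lemma lmap_eqI:
  assumes "lmap A" "lmap B" "\<And>x. x \<in> roots R \<Longrightarrow> A x = B x"
  shows "A = B"
proof
  fix x
  have "x \<in> span (roots R)" by (simp add: span_roots)
  then show "A x = B x"
    by (induction rule: span_induct_alt) (use assms in \<open>auto simp: lmap_0 lmap_add lmap_scale\<close>)
qed

lemma coroot_add: "\<alpha> \<in> roots R \<Longrightarrow> coroot R \<alpha> (x + y) = coroot R \<alpha> x + coroot R \<alpha> y"
  and coroot_scale: "\<alpha> \<in> roots R \<Longrightarrow> coroot R \<alpha> (c \<cdot> x) = c * coroot R \<alpha> x"
  using linear_coroot[of \<alpha>]
  by (auto simp: Vector_Spaces.linear_def module_hom_def module_hom_axioms_def)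

lemma coroot_0: "\<alpha> \<in> roots R \<Longrightarrow> coroot R \<alpha> 0 = 0"
  using coroot_scale[of \<alpha> 0 0] by simp

lemma coroot_uminus: "\<alpha> \<in> roots R \<Longrightarrow> coroot R \<alpha> (- x) = - coroot R \<alpha> x"
  using coroot_scale[of \<alpha> "-1" x] by simp

lemma coroot_diff: "\<alpha> \<in> roots R \<Longrightarrow> coroot R \<alpha> (x - y) = coroot R \<alpha> x - coroot R \<alpha> y"
  using coroot_add[of \<alpha> x "- y"] coroot_uminus[of \<alpha> y] by simp

lemma lmap_s: "\<alpha> \<in> roots R \<Longrightarrow> lmap (s \<alpha>)"
  by (simp add: lmap_def reflection_def coroot_add coroot_scale scale_left_distrib
      scale_right_diff_distrib)

lemma s_self: "\<alpha> \<in> roots R \<Longrightarrow> s \<alpha> \<alpha> = - \<alpha>"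
proof -
  assume "\<alpha> \<in> roots R"
  then have "s \<alpha> \<alpha> = 1 \<cdot> \<alpha> - 2 \<cdot> \<alpha>" by (simp add: reflection_def coroot_self)
  also have "\<dots> = (1 - 2) \<cdot> \<alpha>" by (simp only: scale_left_diff_distrib)
  finally show ?thesis by simp
qed

lemma s_invol: "\<alpha> \<in> roots R \<Longrightarrow> s \<alpha> (s \<alpha> x) = x"
  unfolding reflection_def[of R \<alpha> x]
  by (simp only: lmap_diff[OF lmap_s] lmap_scale[OF lmap_s] s_self)
    (simp add: reflection_def)

lemma s_comp_s: "\<alpha> \<in> roots R \<Longrightarrow> s \<alpha> \<circ> s \<alpha> = id"
  by (auto simp: s_invol)

lemma bij_s: "\<alpha> \<in> roots R \<Longrightarrow> bij (s \<alpha>)"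
  by (rule o_bij[of "s \<alpha>"]) (auto simp: s_comp_s)

lemma uminus_roots: "\<alpha> \<in> roots R \<Longrightarrow> - \<alpha> \<in> roots R"
  using reflection_roots[of \<alpha> \<alpha>] by (simp add: s_self)

lemma pos_roots_subset: "\<alpha> \<in> pos \<Longrightarrow> \<alpha> \<in> roots R"
  by (simp add: pos_roots_def)

lemma a_root: "i \<in> Ix \<Longrightarrow> a i \<in> roots R"
  using simple_roots by (auto simp: Ix_def)

text \<open>Two reflections in the same root differ by a unipotent map, which has infinite order on a
  root unless it ws trivial.\<close>

lemma coroot_eqI:
  assumes "\<alpha> \<in> roots R" "\<And>x y. f (x + y) = f x + f y" "\<And>c x. f (c \<cdot> x) = c * f x"
    and "f \<alpha> = 2" "\<And>\<beta>. \<beta> \<in> roots R \<Longrightarrow> \<beta> - f \<beta> \<cdot> \<alpha> \<in> roots R"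
  shows "f x = coroot R \<alpha> x"
proof -
  have f0: "f 0 = 0" using assms(3)[of 0 0] by simp
  have fdiff: "f (x - y) = f x - f y" for x y
    using assms(2)[of x "- y"] assms(3)[of "-1" y] by simp
  have root: "f \<beta> = coroot R \<alpha> \<beta>" if \<beta>: "\<beta> \<in> roots R" for \<beta>
  proof (rule ccontr)
    assume ne: "f \<beta> \<noteq> coroot R \<alpha> \<beta>"
    define h where "h x = coroot R \<alpha> x - f x" for x
    have "\<beta> + (of_nat n * h \<beta>) \<cdot> \<alpha> \<in> roots R" for n
    proof (induction n)
      case (Suc n)
      let ?x = "\<beta> + (of_nat n * h \<beta>) \<cdot> \<alpha>"
      have hx: "h ?x = h \<beta>"
        using assms(1) by (simp add: h_def coroot_add coroot_scale coroot_self assms(2,3,4))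
      have "s \<alpha> ?x - f (s \<alpha> ?x) \<cdot> \<alpha> = ?x + h ?x \<cdot> \<alpha>"
        by (simp add: reflection_def fdiff assms(3,4) h_def scale_left_diff_distrib algebra_simps
            flip: scale_left_distrib)
      also have "\<dots> = \<beta> + (of_nat (Suc n) * h \<beta>) \<cdot> \<alpha>"
        unfolding hx by (simp add: scale_left_distrib algebra_simps)
      finally show ?case
        using assms(5)[OF reflection_roots[OF assms(1) Suc]] by simp
    qed (use \<beta> in simp)
    then have "range (\<lambda>n. \<beta> + (of_nat n * h \<beta>) \<cdot> \<alpha>) \<subseteq> roots R" by auto
    moreover have "inj (\<lambda>n. \<beta> + (of_nat n * h \<beta>) \<cdot> \<alpha>)"
      using ne zero_notin_roots assms(1) by (auto simp: inj_def h_def scale_cancel_right)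
    ultimately show False
      using finite_roots finite_subset infinite_UNIV_nat finite_imageD by metis
  qed
  have "x \<in> span (roots R)" by (simp add: span_roots)
  then show ?thesis
    by (induction rule: span_induct_alt)
      (use assms root in \<open>auto simp: f0 coroot_0 coroot_add coroot_scale\<close>)
qed

text \<open>The transported functional satisfies the criterion of \<open>coroot_eqI\<close> for the
  root \<open>w \<alpha>\<close>. So coroots are equivariant because they are unique, and conjugates
  of reflections are reflections.\<close>

lemma coroot_conj:
  assumes w: "lmap w" "\<And>x. x \<in> roots R \<Longrightarrow> w x \<in> roots R"
    and v: "lmap v" "\<And>x. x \<in> roots R \<Longrightarrow> v x \<in> roots R"
    and inverse: "\<And>x. v (w x) = x" "\<And>x. w (v x) = x" and \<alpha>: "\<alpha> \<in> roots R"
  shows "coroot R (w \<alpha>) x = coroot R \<alpha> (v x)"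
proof (rule coroot_eqI[symmetric])
  fix \<beta> assume \<beta>: "\<beta> \<in> roots R"
  have "w (s \<alpha> (v \<beta>)) \<in> roots R"
    by (intro w(2) reflection_roots v(2) \<alpha> \<beta>)
  then show "\<beta> - coroot R \<alpha> (v \<beta>) \<cdot> w \<alpha> \<in> roots R"
    using w by (simp add: reflection_def lmap_diff lmap_scale inverse)
qed (use assms in \<open>auto simp: lmap_add lmap_scale coroot_add coroot_scale coroot_self\<close>)

lemma s_conj:
  assumes "lmap w" "\<And>x. x \<in> roots R \<Longrightarrow> w x \<in> roots R"
    and "lmap v" "\<And>x. x \<in> roots R \<Longrightarrow> v x \<in> roots R"
    and "\<And>x. v (w x) = x" "\<And>x. w (v x) = x" and "\<alpha> \<in> roots R"
  shows "s (w \<alpha>) (w x) = w (s \<alpha> x)"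
  using coroot_conj[OF assms] assms by (simp add: reflection_def lmap_diff lmap_scale)

subsection \<open>Coordinates with respect to the simple roots\<close>

definition coef :: "nat \<Rightarrow> 'v \<Rightarrow> complex" where
  "coef i v = representation (a ` Ix) v (a i)"

lemma span_simple: "span (a ` Ix) = UNIV"
proof -
  have "roots R \<subseteq> span (a ` Ix)"
  proof
    fix \<beta> assume "\<beta> \<in> roots R"
    have "\<gamma> \<in> span (a ` Ix)" if "\<gamma> \<in> pos" for \<gamma>
      using that by (auto simp: pos_roots_Ix intro!: span_sum intro: span_scale span_base)
    then show "\<beta> \<in> span (a ` Ix)"
      using pos_or_neg[OF \<open>\<beta> \<in> roots R\<close>] span_neg[of "- \<beta>" "a ` Ix"] by auto
  qed
  then show ?thesis using span_minimal[OF _ subspace_span] span_roots by blast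
qed

lemma in_span_simple: "v \<in> span (a ` Ix)"
  by (simp add: span_simple)

lemma coef_add: "coef i (x + y) = coef i x + coef i y"
  and coef_scale: "coef i (c \<cdot> x) = c * coef i x"
  and coef_uminus: "coef i (- x) = - coef i x"
  and coef_diff: "coef i (x - y) = coef i x - coef i y"
  and coef_0: "coef i 0 = 0"
  by (auto simp: coef_def representation_add representation_scale representation_neg
      representation_diff representation_zero independent_simple_Ix in_span_simple)

lemma coef_sum: "coef i (sum f Z) = (\<Sum>x\<in>Z. coef i (f x))"
  by (induction Z rule: infinite_finite_induct) (auto simp: coef_0 coef_add)

lemma coef_simple: "i \<in> Ix \<Longrightarrow> j \<in> Ix \<Longrightarrow> coef i (a j) = (if i = j then 1 else 0)"
  using inj_simple_Ix
  by (auto simp: coef_def representation_basis independent_simple_Ix inj_on_eq_iff)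

lemma sum_coef: "(\<Sum>i\<in>Ix. coef i v \<cdot> a i) = v"
proof -
  have "(\<Sum>b\<in>a ` Ix. representation (a ` Ix) v b \<cdot> b) = v"
    by (rule sum_representation_eq) (auto simp: independent_simple_Ix in_span_simple)
  then show ?thesis
    by (simp add: sum.reindex[OF inj_simple_Ix] coef_def)
qed

lemma coef_eqI: "(\<And>i. i \<in> Ix \<Longrightarrow> coef i x = coef i y) \<Longrightarrow> x = y"
  using sum_coef[of x] sum_coef[of y] by (metis (no_types, lifting) sum.cong)

lemma coef_sum_simple: "i \<in> Ix \<Longrightarrow> coef i (\<Sum>j\<in>Ix. c j \<cdot> a j) = c i"
  by (simp add: coef_sum coef_scale coef_simple if_distrib[of "(*) _"] cong: if_cong)

lemma pos_iff: "\<beta> \<in> pos \<longleftrightarrow> \<beta> \<in> roots R \<and> (\<forall>i\<in>Ix. coef i \<beta> \<in> \<nat>)"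
proof
  assume "\<beta> \<in> pos"
  then show "\<beta> \<in> roots R \<and> (\<forall>i\<in>Ix. coef i \<beta> \<in> \<nat>)"
    by (auto simp: pos_roots_Ix coef_sum_simple)
next
  assume \<beta>: "\<beta> \<in> roots R \<and> (\<forall>i\<in>Ix. coef i \<beta> \<in> \<nat>)"
  then have "\<forall>i\<in>Ix. \<exists>n::nat. coef i \<beta> = of_nat n" by (auto simp: Nats_def)
  then obtain c :: "nat \<Rightarrow> nat" where "\<And>i. i \<in> Ix \<Longrightarrow> coef i \<beta> = of_nat (c i)" by metis
  then have "\<beta> = (\<Sum>i\<in>Ix. of_nat (c i) \<cdot> a i)"
    using sum_coef[of \<beta>] by (metis (no_types, lifting) sum.cong)
  then show "\<beta> \<in> pos" using \<beta> by (auto simp: pos_roots_Ix)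
qed

lemma Nats_Re: "z \<in> \<nat> \<Longrightarrow> Re z \<ge> 0 \<and> z = of_real (Re z)"
  by (auto simp: Nats_def)

lemma root_ge_0_imp_pos:
  assumes "\<beta> \<in> roots R" "\<And>i. i \<in> Ix \<Longrightarrow> Re (coef i \<beta>) \<ge> 0"
  shows "\<beta> \<in> pos"
proof (rule ccontr)
  assume "\<beta> \<notin> pos"
  then have "- \<beta> \<in> pos" using pos_or_neg assms by blast
  then have *: "coef i (- \<beta>) \<in> \<nat>" if "i \<in> Ix" for i using that by (simp add: pos_iff)
  have "coef i \<beta> = coef i 0" if "i \<in> Ix" for i
    using Nats_Re[OF *[OF that]] assms(2)[OF that] by (auto simp: coef_uminus coef_0 complex_eq_iff)
  then have "\<beta> = 0" by (rule coef_eqI)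
  then show False using assms zero_notin_roots by simp
qed

lemma uminus_notin_pos: "\<beta> \<in> pos \<Longrightarrow> - \<beta> \<notin> pos"
proof
  assume b: "\<beta> \<in> pos" "- \<beta> \<in> pos"
  have "coef i \<beta> = coef i 0" if "i \<in> Ix" for i
    using Nats_Re[of "coef i \<beta>"] Nats_Re[of "coef i (- \<beta>)"] b that
    by (auto simp: pos_iff coef_uminus coef_0 complex_eq_iff)
  then have "\<beta> = 0" by (rule coef_eqI)
  then show False using b(1) zero_notin_roots pos_roots_subset by auto
qed

lemma neg_pos: "\<beta> \<in> roots R \<Longrightarrow> - \<beta> \<in> pos \<longleftrightarrow> \<beta> \<notin> pos"
  using uminus_notin_pos[of \<beta>] pos_or_neg by auto

lemma a_pos: "i \<in> Ix \<Longrightarrow> a i \<in> pos"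
  by (auto simp: pos_iff a_root coef_simple)

lemma coef_s_simple:
  assumes "i \<in> Ix" "j \<in> Ix"
  shows "coef j (s (a i) x) = coef j x - (if i = j then coroot R (a i) x else 0)"
  using assms by (auto simp: reflection_def coef_diff coef_scale coef_simple)

text \<open>As the root system is reduced, \<beta> has a positive coordinate at some
  \<open>j \<noteq> i\<close>. The reflection changes only the coordinate at \<open>i\<close>, and
  one positive coordinate decides the sign of a root.\<close>

lemma simple_permutes_pos:
  assumes i: "i \<in> Ix" and \<beta>: "\<beta> \<in> pos" "\<beta> \<noteq> a i"
  shows "s (a i) \<beta> \<in> pos"
proof -
  have r: "\<beta> \<in> roots R" using \<beta> pos_roots_subset by simp
  obtain j where j: "j \<in> Ix" "j \<noteq> i" "coef j \<beta> \<noteq> 0"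
  proof (rule ccontr)
    assume "\<not> thesis"
    then have z: "\<And>j. j \<in> Ix \<Longrightarrow> j \<noteq> i \<Longrightarrow> coef j \<beta> = 0" using that by blast
    have eq: "\<beta> = coef i \<beta> \<cdot> a i"
      by (rule coef_eqI) (use z i in \<open>auto simp: coef_scale coef_simple\<close>)
    then have "coef i \<beta> = 1 \<or> coef i \<beta> = -1"
      using reduced[OF a_root[OF i], of "coef i \<beta>"] r by simp
    then have "\<beta> = - a i" using eq \<beta>(2) by auto
    then show False using \<beta> uminus_notin_pos[OF a_pos[OF i]] by simp
  qed
  have "coef j (s (a i) \<beta>) = coef j \<beta>"
    using j i by (simp add: coef_s_simple)
  then have jj: "Re (coef j (s (a i) \<beta>)) > 0"
    using j \<beta>(1) Nats_Re[of "coef j \<beta>"] by (auto simp: pos_iff complex_eq_iff)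
  have "s (a i) \<beta> \<in> roots R" using reflection_roots a_root i r by blast
  moreover have "- s (a i) \<beta> \<notin> pos"
    using jj j(1) Nats_Re[of "coef j (- s (a i) \<beta>)"] by (auto simp: pos_iff coef_uminus)
  ultimately show ?thesis using pos_or_neg by blast
qed

subsection \<open>Words in the simple reflections\<close>

definition word :: "nat list \<Rightarrow> 'v \<Rightarrow> 'v" where
  "word ws = foldr (\<lambda>i v. s (a i) \<circ> v) ws id"

lemma word_Nil [simp]: "word [] = id"
  and word_Cons: "word (i # ws) = s (a i) \<circ> word ws"
  by (simp_all add: word_def)

lemma word_append: "word (ws @ js) = word ws \<circ> word js"
  by (induction ws) (auto simp: word_Cons)

lemma lmap_word: "set ws \<subseteq> Ix \<Longrightarrow> lmap (word ws)"
  by (induction ws) (auto simp: word_Cons lmap_id intro!: lmap_comp lmap_s a_root)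

lemma word_roots: "set ws \<subseteq> Ix \<Longrightarrow> x \<in> roots R \<Longrightarrow> word ws x \<in> roots R"
  by (induction ws) (auto simp: word_Cons intro!: reflection_roots a_root)

lemma word_rev: "set ws \<subseteq> Ix \<Longrightarrow> word (rev ws) (word ws x) = x"
  by (induction ws arbitrary: x) (auto simp: word_append word_Cons s_invol a_root)

lemma word_rev': "set ws \<subseteq> Ix \<Longrightarrow> word ws (word (rev ws) x) = x"
  using word_rev[of "rev ws" x] by simp

lemma s_word:
  assumes "set ws \<subseteq> Ix" "\<alpha> \<in> roots R"
  shows "s (word ws \<alpha>) = word ws \<circ> s \<alpha> \<circ> word (rev ws)"
proof
  fix x
  have "s (word ws \<alpha>) (word ws (word (rev ws) x)) = word ws (s \<alpha> (word (rev ws) x))"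
    using assms by (intro s_conj[of _ "word (rev ws)"]) (auto simp: lmap_word word_roots word_rev word_rev')
  then show "s (word ws \<alpha>) x = (word ws \<circ> s \<alpha> \<circ> word (rev ws)) x"
    using assms by (simp add: word_rev')
qed

section \<open>An invariant form, and words for all reflections\<close>

definition form :: "'v \<Rightarrow> 'v \<Rightarrow> complex" where
  "form x y = (\<Sum>\<gamma>\<in>roots R. coroot R \<gamma> x * coroot R \<gamma> y)"

lemma form_add: "form x (y + z) = form x y + form x z"
  and form_scale: "form x (c \<cdot> y) = c * form x y"
  and form_uminus: "form (- x) y = - form x y"
  and form_sym: "form x y = form y x"
  by (auto simp: form_def coroot_add coroot_scale coroot_uminus sum.distrib distrib_left
      sum_distrib_left sum_negf mult_ac)

lemma form_0: "form x 0 = 0"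
  by (simp add: form_def coroot_0)

lemma form_sum: "form x (sum f Z) = (\<Sum>z\<in>Z. form x (f z))"
  by (induction Z rule: infinite_finite_induct) (auto simp: form_add form_0)

lemma coroot_s:
  assumes "\<alpha> \<in> roots R" "\<gamma> \<in> roots R"
  shows "coroot R (s \<alpha> \<gamma>) x = coroot R \<gamma> (s \<alpha> x)"
  using assms by (intro coroot_conj) (auto simp: lmap_s reflection_roots s_invol)

lemma form_s: "\<alpha> \<in> roots R \<Longrightarrow> form (s \<alpha> x) (s \<alpha> y) = form x y"
  unfolding form_def
  by (rule sum.reindex_bij_witness[of _ "s \<alpha>" "s \<alpha>"])
    (auto simp: s_invol reflection_roots coroot_s)

text \<open>Invariance of \<open>form\<close> under \<open>s \<alpha>\<close>, which negates
  \<alpha>, makes the coroot proportional to the pairing with \<alpha>.\<close>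

lemma coroot_form:
  assumes "\<alpha> \<in> roots R"
  shows "2 * form \<alpha> x = coroot R \<alpha> x * form \<alpha> \<alpha>"
proof -
  have "form \<alpha> x = form (- \<alpha>) (x + (- coroot R \<alpha> x) \<cdot> \<alpha>)"
    using form_s[OF assms, of \<alpha> x] unfolding s_self[OF assms] by (simp add: reflection_def)
  then show ?thesis by (simp only: form_uminus form_add form_scale) (simp add: algebra_simps)
qed

text \<open>Coroots are integral on roots, so each summand is the square of a real number, and
  \<gamma> = \<alpha> contributes 4. The complex bilinear \<open>form\<close> can thus stand in for
  an inner product on the roots.\<close>

lemma form_self_pos:
  assumes "\<alpha> \<in> roots R"
  shows "\<exists>r>0. form \<alpha> \<alpha> = of_real r"
proof (intro exI conjI)
  have real: "coroot R \<gamma> \<alpha> * coroot R \<gamma> \<alpha> = of_real ((Re (coroot R \<gamma> \<alpha>))\<^sup>2)" if "\<gamma> \<in> roots R" for \<gamma>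
    using coroot_Ints[OF that assms] by (auto simp: Ints_def power2_eq_square)
  then show "form \<alpha> \<alpha> = of_real (\<Sum>\<gamma>\<in>roots R. (Re (coroot R \<gamma> \<alpha>))\<^sup>2)"
    by (simp add: form_def)
  show "(\<Sum>\<gamma>\<in>roots R. (Re (coroot R \<gamma> \<alpha>))\<^sup>2) > 0"
    using assms by (intro sum_pos2[of _ \<alpha>]) (auto simp: finite_roots coroot_self)
qed

text \<open>Otherwise every \<open>form (a i) \<beta>\<close> is at most 0, and expanding one
  argument of \<open>form \<beta> \<beta>\<close> in simple roots with nonnegative coefficients
  contradicts its positivity.\<close>

lemma pos_root_simple_coroot_pos:
  assumes "\<beta> \<in> pos"
  obtains i where "i \<in> Ix" "Re (coroot R (a i) \<beta>) > 0"
proof (rule ccontr)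
  assume nt: "\<not> thesis"
  have le: "Re (coroot R (a i) \<beta>) \<le> 0" if "i \<in> Ix" for i
    using nt \<open>i \<in> Ix\<close> not_le by (metis (no_types) \<open>\<And>i. i \<in> Ix \<Longrightarrow> 0 < Re (coroot R (a i) \<beta>) \<Longrightarrow> thesis\<close>)
  have \<beta>: "\<beta> \<in> roots R" using assms pos_roots_subset by simp
  obtain r where r: "r > 0" "form \<beta> \<beta> = of_real r" using form_self_pos[OF \<beta>] by auto
  have "form \<beta> \<beta> = form \<beta> (\<Sum>i\<in>Ix. coef i \<beta> \<cdot> a i)"
    by (simp only: sum_coef)
  also have "\<dots> = (\<Sum>i\<in>Ix. coef i \<beta> * form (a i) \<beta>)"
    by (simp add: form_sum form_scale form_sym[of \<beta>])
  also have "Re \<dots> = (\<Sum>i\<in>Ix. Re (coef i \<beta> * form (a i) \<beta>))" by simp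
  also have "\<dots> \<le> 0"
  proof (rule sum_nonpos)
    fix i assume i: "i \<in> Ix"
    obtain q where q: "q > 0" "form (a i) (a i) = of_real q" using form_self_pos[OF a_root[OF i]] by auto
    obtain z :: int where z: "coroot R (a i) \<beta> = of_int z"
      using coroot_Ints[OF a_root[OF i] \<beta>] by (auto simp: Ints_def)
    define y where "y = of_int z * q / 2"
    have "form (a i) \<beta> = of_real y"
      using coroot_form[OF a_root[OF i], of \<beta>] by (simp add: q z y_def field_simps)
    moreover have "y \<le> 0"
      using le[OF i] q by (simp add: z y_def mult_nonpos_nonneg)
    moreover obtain n :: nat where "coef i \<beta> = of_nat n"
      using assms i by (auto simp: pos_iff Nats_def)
    ultimately show "Re (coef i \<beta> * form (a i) \<beta>) \<le> 0"
      by (simp add: mult_nonneg_nonpos)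
  qed
  finally show False using r by simp
qed

definition height :: "'v \<Rightarrow> nat" where
  "height \<beta> = nat \<lfloor>\<Sum>i\<in>Ix. Re (coef i \<beta>)\<rfloor>"

text \<open>A simple reflection with positive coroot value at \<beta> lowers the height, and
  \<open>s \<beta>\<close> is the conjugate of the reflection in the lower root.\<close>

lemma s_pos_word: "\<beta> \<in> pos \<Longrightarrow> \<exists>ws. set ws \<subseteq> Ix \<and> s \<beta> = word ws"
proof (induction "height \<beta>" arbitrary: \<beta> rule: less_induct)
  case less
  obtain i where i: "i \<in> Ix" "Re (coroot R (a i) \<beta>) > 0"
    using pos_root_simple_coroot_pos[OF less.prems] by blast
  have ai: "a i \<in> roots R" using i a_root by simp
  have \<beta>: "\<beta> \<in> roots R" using less.prems pos_roots_subset by simp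
  show ?case
  proof (cases "\<beta> = a i")
    case True
    then have "s \<beta> = word [i]" by (simp add: word_Cons)
    then show ?thesis using i by (metis empty_subsetI insert_subset list.set(1) list.simps(15))
  next
    case False
    let ?\<gamma> = "s (a i) \<beta>"
    have \<gamma>: "?\<gamma> \<in> pos" using simple_permutes_pos i less.prems False by blast
    obtain z :: int where z: "coroot R (a i) \<beta> = of_int z"
      using coroot_Ints[OF ai \<beta>] by (auto simp: Ints_def)
    have "z \<ge> 1" using i(2) z by simp
    have "(\<Sum>j\<in>Ix. Re (coef j ?\<gamma>)) = (\<Sum>j\<in>Ix. Re (coef j \<beta>)) - of_int z"
      using i by (simp add: coef_s_simple sum_subtractf z if_distrib[of Re] cong: if_cong)
    moreover have "(\<Sum>j\<in>Ix. Re (coef j ?\<gamma>)) \<ge> 0"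
      using \<gamma> by (intro sum_nonneg) (auto simp: pos_iff Nats_Re)
    \<comment> \<open>Integrality makes the drop at least 1, so it survives the floor; nonnegativity
      of the new sum keeps \<open>nat\<close> from hiding it.\<close>
    ultimately have "height ?\<gamma> < height \<beta>"
      using \<open>z \<ge> 1\<close> unfolding height_def by (auto simp: nat_less_iff)
    then obtain js where js: "set js \<subseteq> Ix" "s ?\<gamma> = word js"
      using less.hyps \<gamma> by blast
    have "s \<beta> = s (s (a i) ?\<gamma>)" using ai by (simp add: s_invol)
    also have "\<dots> = s (word [i] ?\<gamma>)" by (simp add: word_Cons)
    also have "\<dots> = word [i] \<circ> s ?\<gamma> \<circ> word (rev [i])"
      by (rule s_word) (use i \<gamma> pos_roots_subset in auto)
    also have "\<dots> = word ([i] @ js @ rev [i])" unfolding js(2) word_append by (simp add: o_assoc)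
    finally show ?thesis using i js by (intro exI[of _ "[i] @ js @ rev [i]"]) auto
  qed
qed

lemma s_uminus: "\<alpha> \<in> roots R \<Longrightarrow> s (- \<alpha>) = s \<alpha>"
proof
  fix x assume \<alpha>: "\<alpha> \<in> roots R"
  have "coroot R (- \<alpha>) x = - coroot R \<alpha> x"
    using coroot_s[OF \<alpha> \<alpha>, of x] unfolding s_self[OF \<alpha>]
    by (simp add: reflection_def coroot_diff coroot_scale coroot_self \<alpha>)
  then show "s (- \<alpha>) x = s \<alpha> x" by (simp add: reflection_def)
qed

lemma s_root_word: "\<beta> \<in> roots R \<Longrightarrow> \<exists>ws. set ws \<subseteq> Ix \<and> s \<beta> = word ws"
  using s_pos_word pos_or_neg s_uminus by metis

subsection \<open>The group operations\<close>

lemma mult_weyl: "x \<otimes>\<^bsub>weyl R\<^esub> y = x \<otimes>\<^bsub>BijGroup UNIV\<^esub> y" and one_weyl: "\<one>\<^bsub>weyl R\<^esub> = id"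
  by (auto simp: weyl_def subgroup_generated_def BijGroup_def)

lemma mult_bij: "bij x \<Longrightarrow> bij y \<Longrightarrow> x \<otimes>\<^bsub>weyl R\<^esub> y = x \<circ> y"
  by (auto simp: mult_weyl BijGroup_def Bij_def compose_def)

lemma carrier_BijGroup: "x \<in> carrier (BijGroup UNIV) \<longleftrightarrow> bij x"
  by (simp add: BijGroup_def Bij_def)

lemma inv_BijGroup_bij: "bij x \<Longrightarrow> inv\<^bsub>BijGroup UNIV\<^esub> x = inv' x"
  by (subst inv_BijGroup) (auto simp: Bij_def)

lemma word_bij: "set ws \<subseteq> Ix \<Longrightarrow> bij (word ws)"
  by (induction ws) (auto simp: word_Cons intro!: bij_comp bij_s a_root)

lemma inv_word: "set ws \<subseteq> Ix \<Longrightarrow> inv' (word ws) = word (rev ws)"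
  by (intro inv_equality) (auto simp: word_rev word_rev')

lemma group_weyl: "group (weyl R)"
  unfolding weyl_def by (rule group.group_subgroup_generated[OF group_BijGroup])

text \<open>The group is generated by the reflections in all roots, and by
  \<open>s_root_word\<close> each of these is already a word in the simple ones; inverses are
  reversed words.\<close>

lemma W_word: "w \<in> W \<longleftrightarrow> (\<exists>ws. set ws \<subseteq> Ix \<and> w = word ws)"
proof
  assume "w \<in> W"
  then have "w \<in> generate (BijGroup UNIV) (carrier (BijGroup UNIV) \<inter> s ` roots R)"
    by (simp add: weyl_def carrier_subgroup_generated)
  then show "\<exists>ws. set ws \<subseteq> Ix \<and> w = word ws"
  proof (induction rule: generate.induct)
    case one
    show ?case by (intro exI[of _ "[]"]) (auto simp: BijGroup_def)
  next
    case (incl h)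
    then show ?case using s_root_word by auto
  next
    case (inv h)
    then obtain ws where "set ws \<subseteq> Ix" "h = word ws" using s_root_word by auto
    then show ?case using inv inv_word
      by (intro exI[of _ "rev ws"]) (auto simp: carrier_BijGroup inv_BijGroup_bij)
  next
    case (eng h1 h2)
    then obtain ws js where "set ws \<subseteq> Ix" "h1 = word ws" "set js \<subseteq> Ix" "h2 = word js" by auto
    then show ?case using mult_bij[OF word_bij word_bij, of ws js]
      by (intro exI[of _ "ws @ js"]) (auto simp: mult_weyl word_append)
  qed
next
  assume "\<exists>ws. set ws \<subseteq> Ix \<and> w = word ws"
  then obtain ws where "set ws \<subseteq> Ix" "w = word ws" by auto
  then show "w \<in> W"
  proof (induction ws arbitrary: w)
    case Nil
    then show ?case using group.is_monoid[OF group_weyl] monoid.one_closed one_weyl by (metis word_Nil)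
  next
    case (Cons i ws)
    have "s (a i) \<in> W"
      using Cons.prems unfolding weyl_def carrier_subgroup_generated
      by (intro generate.incl) (auto simp: carrier_BijGroup bij_s a_root)
    moreover have "word ws \<in> W" using Cons by auto
    ultimately have "s (a i) \<otimes>\<^bsub>weyl R\<^esub> word ws \<in> W"
      by (rule monoid.m_closed[OF group.is_monoid[OF group_weyl]])
    moreover have "s (a i) \<otimes>\<^bsub>weyl R\<^esub> word ws = w"
      using Cons.prems by (subst mult_bij) (auto simp: word_Cons bij_s a_root word_bij)
    ultimately show ?case by simp
  qed
qed

lemma W_bij: "w \<in> W \<Longrightarrow> bij w" by (auto simp: W_word word_bij)
lemma W_lmap: "w \<in> W \<Longrightarrow> lmap w" by (auto simp: W_word lmap_word)
lemma W_roots: "w \<in> W \<Longrightarrow> x \<in> roots R \<Longrightarrow> w x \<in> roots R" by (auto simp: W_word word_roots)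
lemma W_id: "id \<in> W" by (metis W_word word_Nil empty_subsetI list.set(1))
lemma W_comp: "v \<in> W \<Longrightarrow> w \<in> W \<Longrightarrow> v \<circ> w \<in> W"
  by (metis W_word word_append set_append Un_subset_iff)
lemma W_inv: "w \<in> W \<Longrightarrow> inv' w \<in> W" by (metis W_word inv_word set_rev)
lemma W_s: "\<alpha> \<in> roots R \<Longrightarrow> s \<alpha> \<in> W" using s_root_word W_word by auto

lemma W_mult: "v \<in> W \<Longrightarrow> w \<in> W \<Longrightarrow> v \<otimes>\<^bsub>weyl R\<^esub> w = v \<circ> w"
  by (simp add: mult_bij W_bij)

lemma W_inv_inv: "w \<in> W \<Longrightarrow> inv' (inv' w) = w"
  by (simp add: W_bij inv_inv_eq)

lemma W_inv_left [simp]: "w \<in> W \<Longrightarrow> inv' w (w x) = x"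
  and W_inv_right [simp]: "w \<in> W \<Longrightarrow> w (inv' w x) = x"
  using W_bij by (auto simp: bij_is_inj bij_is_surj surj_f_inv_f)

lemma W_inv_comp: "v \<in> W \<Longrightarrow> w \<in> W \<Longrightarrow>
    inv' (v \<circ> w) = inv' w \<circ> inv' v"
  by (simp add: o_inv_distrib W_bij)

lemma inv_s: "\<alpha> \<in> roots R \<Longrightarrow> inv' (s \<alpha>) = s \<alpha>"
  by (intro inv_equality) (auto simp: s_invol)

lemma weyl_inv: "w \<in> W \<Longrightarrow> inv\<^bsub>weyl R\<^esub> w = inv' w"
proof -
  assume w: "w \<in> W"
  have "inv' w \<circ> w = id" using w by auto
  then show ?thesis
    using w W_inv by (intro group.inv_equality[OF group_weyl]) (auto simp: W_mult one_weyl)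
qed

lemma W_conj: "w \<in> W \<Longrightarrow> \<alpha> \<in> roots R \<Longrightarrow> s (w \<alpha>) \<circ> w = w \<circ> s \<alpha>"
proof
  fix x assume "w \<in> W" "\<alpha> \<in> roots R"
  then show "(s (w \<alpha>) \<circ> w) x = (w \<circ> s \<alpha>) x"
    using s_conj[of w "inv' w" \<alpha> x] by (simp add: W_lmap W_roots W_inv)
qed

text \<open>The roots span, so an element of \<open>W\<close> is determined by its restriction to
  them, a map from a finite set to itself.\<close>

lemma finite_W: "finite W"
proof (rule inj_on_finite)
  show "inj_on (\<lambda>w. restrict w (roots R)) W"
  proof
    fix v w assume vw: "v \<in> W" "w \<in> W" "restrict v (roots R) = restrict w (roots R)"
    have "v x = w x" if "x \<in> roots R" for x
      using fun_cong[OF vw(3), of x] that by simp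
    then show "v = w" using vw W_lmap lmap_eqI by blast
  qed
  show "(\<lambda>w. restrict w (roots R)) ` W \<subseteq> roots R \<rightarrow>\<^sub>E roots R"
    using W_roots by auto
  show "finite (roots R \<rightarrow>\<^sub>E roots R)" using finite_roots by (simp add: finite_PiE)
qed

subsection \<open>Inversions and length\<close>

lemma inv_s_comp: "w \<in> W \<Longrightarrow> \<alpha> \<in> roots R \<Longrightarrow> inv' (s \<alpha> \<circ> w) x = inv' w (s \<alpha> x)"
  and inv_comp_s: "w \<in> W \<Longrightarrow> \<alpha> \<in> roots R \<Longrightarrow> inv' (w \<circ> s \<alpha>) x = s \<alpha> (inv' w x)"
  by (simp_all only: W_inv_comp W_s inv_s o_apply)

lemma word_W: "set ws \<subseteq> Ix \<Longrightarrow> word ws \<in> W"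
  using W_word by blast

text \<open>Follow \<beta> through the letters of the word. It can turn negative only at a letter
  \<open>i\<close> where it has become \<open>a i\<close>, since \<open>s (a i)\<close> permutes the
  other positive roots; deleting this letter amounts to multiplying by \<open>s \<beta>\<close>. The
  letters stay in \<open>J\<close>, so that the lemma also serves parabolic subgroups.\<close>

lemma exchange:
  assumes "J \<subseteq> Ix" "set ws \<subseteq> J" "\<beta> \<in> pos" "inv' (word ws) \<beta> \<notin> pos"
  shows "\<exists>vs. set vs \<subseteq> J \<and> length vs < length ws \<and> s \<beta> \<circ> word ws = word vs"
  using assms(2-)
proof (induction ws arbitrary: \<beta>)
  case Nil
  then show ?case by (simp add: inv_id)
next
  case (Cons i ws)
  then have i: "i \<in> Ix" "i \<in> J" and ws: "set ws \<subseteq> J" "set ws \<subseteq> Ix" using assms(1) by auto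
  have ai: "a i \<in> roots R" using i a_root by simp
  have w: "word ws \<in> W" using ws W_word by auto
  show ?case
  proof (cases "\<beta> = a i")
    case True
    then have "s \<beta> \<circ> word (i # ws) = word ws"
      using s_invol[OF ai] by (simp add: word_Cons fun_eq_iff)
    then show ?thesis using ws by (metis length_Cons lessI)
  next
    case False
    let ?\<gamma> = "s (a i) \<beta>"
    have \<gamma>: "?\<gamma> \<in> pos" using simple_permutes_pos i Cons.prems False by blast
    have "inv' (word ws) ?\<gamma> \<notin> pos"
      using Cons.prems(3) unfolding word_Cons inv_s_comp[OF w ai] .
    then obtain vs where vs: "set vs \<subseteq> J" "length vs < length ws" "s ?\<gamma> \<circ> word ws = word vs"
      using Cons.IH[OF ws(1) \<gamma>] by blast
    have "s \<beta> \<circ> s (a i) = s (a i) \<circ> s ?\<gamma>"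
      using W_conj[OF W_s[OF ai], of ?\<gamma>] \<gamma> pos_roots_subset s_invol[OF ai] by simp
    then have "s \<beta> \<circ> word (i # ws) = s (a i) \<circ> (s ?\<gamma> \<circ> word ws)"
      by (simp only: word_Cons o_assoc)
    then have "s \<beta> \<circ> word (i # ws) = word (i # vs)" by (simp only: vs word_Cons)
    moreover have "set (i # vs) \<subseteq> J" "length (i # vs) < length (i # ws)" using vs i by auto
    ultimately show ?thesis by blast
  qed
qed

text \<open>The first letter of a shortest word over \<open>J\<close> is the witness. Otherwise the
  rest of the word would make its root negative, and \<open>exchange\<close> would give a shorter
  word for the same element.\<close>

lemma simple_left_descent:
  assumes "J \<subseteq> Ix" "set ws \<subseteq> J" "word ws \<noteq> id"
  shows "\<exists>i\<in>J. inv' (word ws) (a i) \<notin> pos"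
proof -
  define P where "P vs \<longleftrightarrow> set vs \<subseteq> J \<and> word vs = word ws" for vs
  obtain vs where "P vs" and min: "\<And>us. P us \<Longrightarrow> length vs \<le> length us"
    using ex_has_least_nat[of P ws length] assms by (auto simp: P_def)
  then obtain i us where vs: "vs = i # us" using assms(3) by (cases vs) (auto simp: P_def)
  have i: "i \<in> J" "i \<in> Ix" and us: "set us \<subseteq> J" "set us \<subseteq> Ix" and w: "word ws = s (a i) \<circ> word us"
    using \<open>P vs\<close> assms(1) by (auto simp: P_def vs word_Cons)
  have ai: "a i \<in> roots R" using i a_root by simp
  have uW: "word us \<in> W" using us W_word by auto
  have "inv' (word us) (a i) \<in> pos"
  proof (rule ccontr)
    assume "inv' (word us) (a i) \<notin> pos"
    then obtain ts where "set ts \<subseteq> J" "length ts < length us" "s (a i) \<circ> word us = word ts"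
      using exchange[OF assms(1) us(1) a_pos[OF i(2)]] by blast
    then show False using min[of ts] by (simp add: P_def vs w)
  qed
  then have "inv' (word ws) (a i) \<notin> pos"
    unfolding w inv_s_comp[OF uW ai] using uminus_notin_pos
    by (simp add: ai s_self lmap_uminus[OF W_lmap[OF W_inv[OF uW]]])
  then show ?thesis using i by blast
qed

text \<open>The inverse makes these the labels of the moment graph edges of \<open>G/B\<close> that
  leave \<open>w\<close>; \<open>moment_edges_source\<close> extends this to minimal
  representatives.\<close>

definition Inv :: "('v \<Rightarrow> 'v) \<Rightarrow> 'v set" where
  "Inv w = {\<beta> \<in> pos. inv' w \<beta> \<notin> pos}"

lemma finite_pos: "finite pos"
  by (rule finite_subset[OF _ finite_roots]) (auto simp: pos_roots_subset)

lemma finite_Inv [simp]: "finite (Inv w)"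
  using finite_pos by (simp add: Inv_def)

lemma Inv_id [simp]: "Inv id = {}"
  by (simp add: Inv_def inv_id)

lemma W_neg: "w \<in> W \<Longrightarrow> \<beta> \<in> roots R \<Longrightarrow> w (- \<beta>) \<in> pos \<longleftrightarrow> w \<beta> \<notin> pos"
  using neg_pos[of "w \<beta>"] W_roots by (simp add: lmap_uminus[OF W_lmap])

lemma Inv_left:
  assumes w: "w \<in> W" and i: "i \<in> Ix" and up: "inv' w (a i) \<in> pos"
  shows "Inv (s (a i) \<circ> w) = insert (a i) (s (a i) ` Inv w)" "a i \<notin> s (a i) ` Inv w"
proof -
  have ai: "a i \<in> roots R" "a i \<in> pos" using i a_root a_pos by auto
  have inv: "inv' (s (a i) \<circ> w) \<beta> = inv' w (s (a i) \<beta>)" for \<beta>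
    by (rule inv_s_comp[OF w ai(1)])
  have aw: "inv' w (- a i) \<notin> pos"
    using up W_neg[OF W_inv[OF w] ai(1)] by simp
  show "a i \<notin> s (a i) ` Inv w"
  proof
    assume "a i \<in> s (a i) ` Inv w"
    then obtain \<gamma> where "\<gamma> \<in> pos" "a i = s (a i) \<gamma>" by (auto simp: Inv_def)
    then have "\<gamma> = - a i" using s_invol[OF ai(1), of \<gamma>] s_self[OF ai(1)] by metis
    then show False using \<open>\<gamma> \<in> pos\<close> ai(2) uminus_notin_pos by simp
  qed
  show "Inv (s (a i) \<circ> w) = insert (a i) (s (a i) ` Inv w)"
  proof (intro equalityI subsetI)
    fix \<beta> assume "\<beta> \<in> Inv (s (a i) \<circ> w)"
    then have b: "\<beta> \<in> pos" "inv' w (s (a i) \<beta>) \<notin> pos" unfolding Inv_def inv by auto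
    show "\<beta> \<in> insert (a i) (s (a i) ` Inv w)"
    proof (cases "\<beta> = a i")
      case False
      then have "s (a i) \<beta> \<in> Inv w"
        using b simple_permutes_pos[OF i] by (simp add: Inv_def)
      moreover have "\<beta> = s (a i) (s (a i) \<beta>)" by (simp add: s_invol ai)
      ultimately show ?thesis by blast
    qed simp
  next
    fix \<beta> assume "\<beta> \<in> insert (a i) (s (a i) ` Inv w)"
    then show "\<beta> \<in> Inv (s (a i) \<circ> w)"
    proof
      assume "\<beta> = a i"
      then show ?thesis using ai aw unfolding Inv_def inv by (simp add: s_self)
    next
      assume "\<beta> \<in> s (a i) ` Inv w"
      then obtain \<gamma> where g: "\<gamma> \<in> pos" "inv' w \<gamma> \<notin> pos" "\<beta> = s (a i) \<gamma>" by (auto simp: Inv_def)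
      then have "\<gamma> \<noteq> a i" using up by auto
      then show ?thesis
        unfolding Inv_def inv using g simple_permutes_pos[OF i] by (simp add: s_invol ai)
    qed
  qed
qed

text \<open>In contrast with \<open>Inv_left\<close>, the old inversions stay where they are,
  because \<open>s (a i)\<close> acts after \<open>inv' w\<close> and changes the sign of plus or
  minus \<open>a i\<close> only. So \<open>inv_prod\<close> gains just one factor.\<close>

lemma Inv_right:
  assumes w: "w \<in> W" and i: "i \<in> Ix" and up: "w (a i) \<in> pos"
  shows "Inv (w \<circ> s (a i)) = insert (w (a i)) (Inv w)" "w (a i) \<notin> Inv w"
proof -
  have ai: "a i \<in> roots R" "a i \<in> pos" using i a_root a_pos by auto
  have inv: "inv' (w \<circ> s (a i)) \<beta> = s (a i) (inv' w \<beta>)" for \<beta>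
    by (rule inv_comp_s[OF w ai(1)])
  show "w (a i) \<notin> Inv w" using w ai by (simp add: Inv_def)
  have key: "s (a i) \<gamma> \<notin> pos \<longleftrightarrow> \<gamma> = a i \<or> (\<gamma> \<notin> pos \<and> \<gamma> \<noteq> - a i)" if "\<gamma> \<in> roots R" for \<gamma>
  proof (cases "\<gamma> \<in> pos")
    case True
    then show ?thesis using simple_permutes_pos[OF i] uminus_notin_pos ai by (auto simp: s_self)
  next
    case False
    then have "- \<gamma> \<in> pos" using pos_or_neg that by blast
    then have "- \<gamma> \<noteq> a i \<Longrightarrow> s (a i) (- \<gamma>) \<in> pos" using simple_permutes_pos[OF i] by blast
    then have "\<gamma> \<noteq> - a i \<Longrightarrow> s (a i) \<gamma> \<notin> pos"
      using uminus_notin_pos[of "s (a i) (- \<gamma>)"] lmap_uminus[OF lmap_s[OF ai(1)], of \<gamma>]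
      by (metis add.inverse_inverse)
    moreover have "s (a i) (- a i) \<in> pos"
      using ai by (simp add: lmap_uminus[OF lmap_s] s_self)
    ultimately show ?thesis using False ai by auto
  qed
  have neg: "w (- a i) \<notin> pos" using W_neg w ai up by blast
  have "s (a i) (inv' w \<beta>) \<notin> pos \<longleftrightarrow> \<beta> = w (a i) \<or> inv' w \<beta> \<notin> pos" if "\<beta> \<in> pos" for \<beta>
  proof -
    have "inv' w \<beta> = a i \<longleftrightarrow> \<beta> = w (a i)" "inv' w \<beta> \<noteq> - a i"
      using W_inv_left[OF w] W_inv_right[OF w] neg that by metis+
    moreover have "inv' w \<beta> \<in> roots R" using that W_roots[OF W_inv[OF w]] pos_roots_subset by simp
    ultimately show ?thesis using key by blast
  qed
  then show "Inv (w \<circ> s (a i)) = insert (w (a i)) (Inv w)"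
    unfolding Inv_def inv using up by auto
qed

abbreviation len :: "('v \<Rightarrow> 'v) \<Rightarrow> nat" where "len \<equiv> weyl_length R"

lemma foldr_word:
  "set ws \<subseteq> Ix \<Longrightarrow> foldr (\<lambda>i v. simple_reflection R i \<otimes>\<^bsub>weyl R\<^esub> v) ws \<one>\<^bsub>weyl R\<^esub> = word ws"
proof (induction ws)
  case (Cons i ws)
  then have "word ws \<in> W" using W_word by auto
  moreover have "s (a i) \<in> W" using Cons by (simp add: W_s a_root)
  ultimately have "foldr (\<lambda>i v. simple_reflection R i \<otimes>\<^bsub>weyl R\<^esub> v) (i # ws) \<one>\<^bsub>weyl R\<^esub> = word (i # ws)"
    using Cons by (simp add: simple_reflection_def W_mult word_Cons)
  then show ?case .
qed (simp add: one_weyl)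

lemma weyl_length_word:
  "len w = (LEAST k. \<exists>ws. length ws = k \<and> set ws \<subseteq> Ix \<and> w = word ws)"
  unfolding weyl_length_def Ix_def[symmetric]
  by (rule arg_cong[where f=Least]) (metis foldr_word)

lemma reduced_word:
  assumes "w \<in> W"
  obtains ws where "set ws \<subseteq> Ix" "w = word ws" "length ws = len w"
proof -
  obtain ws where "set ws \<subseteq> Ix" "w = word ws" using assms W_word by auto
  then have "\<exists>us. length us = length ws \<and> set us \<subseteq> Ix \<and> w = word us" by auto
  then have "\<exists>us. length us = len w \<and> set us \<subseteq> Ix \<and> w = word us"
    unfolding weyl_length_word by (rule LeastI)
  then show ?thesis using that by auto
qed

lemma len_le: "set ws \<subseteq> Ix \<Longrightarrow> len (word ws) \<le> length ws"
  unfolding weyl_length_word by (rule Least_le) auto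

lemma card_Inv_left:
  assumes w: "w \<in> W" and i: "i \<in> Ix" and up: "inv' w (a i) \<in> pos"
  shows "card (Inv (s (a i) \<circ> w)) = Suc (card (Inv w))"
proof -
  have "inj_on (s (a i)) (Inv w)"
    using bij_s[OF a_root[OF i]] by (meson bij_is_inj inj_on_subset subset_UNIV)
  then show ?thesis using Inv_left[OF assms] by (simp add: card_image)
qed

lemma left_flip:
  assumes w: "w \<in> W" and i: "i \<in> Ix"
  shows "inv' (s (a i) \<circ> w) (a i) \<in> pos \<longleftrightarrow> inv' w (a i) \<notin> pos"
    "s (a i) \<circ> (s (a i) \<circ> w) = w" "s (a i) \<circ> w \<in> W"
proof -
  have ai: "a i \<in> roots R" using i a_root by simp
  show "inv' (s (a i) \<circ> w) (a i) \<in> pos \<longleftrightarrow> inv' w (a i) \<notin> pos"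
    unfolding inv_s_comp[OF w ai] using W_neg[OF W_inv[OF w] ai] by (simp add: s_self ai)
qed (auto simp: s_invol a_root i W_s w intro!: W_comp)

lemma right_flip:
  assumes w: "w \<in> W" and i: "i \<in> Ix"
  shows "(w \<circ> s (a i)) (a i) \<in> pos \<longleftrightarrow> w (a i) \<notin> pos"
    "w \<circ> s (a i) \<circ> s (a i) = w" "w \<circ> s (a i) \<in> W"
proof -
  have ai: "a i \<in> roots R" using i a_root by simp
  show "(w \<circ> s (a i)) (a i) \<in> pos \<longleftrightarrow> w (a i) \<notin> pos"
    using W_neg[OF w ai] by (simp add: s_self ai)
qed (auto simp: s_invol a_root i W_s w intro!: W_comp)

lemma card_Inv_word: "set ws \<subseteq> Ix \<Longrightarrow> card (Inv (word ws)) \<le> length ws"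
proof (induction ws)
  case (Cons i ws)
  then have w: "word ws \<in> W" "i \<in> Ix" using W_word by auto
  have "card (Inv (word (i # ws))) \<le> length (i # ws)"
  proof (cases "inv' (word ws) (a i) \<in> pos")
    case True
    then show ?thesis using card_Inv_left[OF w] Cons by (simp add: word_Cons)
  next
    case False
    then have "card (Inv (word ws)) = Suc (card (Inv (s (a i) \<circ> word ws)))"
      using card_Inv_left[of "s (a i) \<circ> word ws" i] left_flip[OF w] w by simp
    then show ?thesis using Cons by (simp add: word_Cons)
  qed
  then show ?case .
qed simp

text \<open>Stripping a left descent removes exactly one inversion, so repeating it produces a word
  with one letter per inversion. The opposite bound is \<open>card_Inv_word\<close>.\<close>

lemma len_le_card_Inv: "w \<in> W \<Longrightarrow> len w \<le> card (Inv w)"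
proof (induction "card (Inv w)" arbitrary: w rule: less_induct)
  case less
  show ?case
  proof (cases "w = id")
    case True
    then show ?thesis using len_le[of "[]"] by simp
  next
    case False
    obtain ws where "set ws \<subseteq> Ix" "w = word ws" using less.prems W_word by auto
    then obtain i where i: "i \<in> Ix" "inv' w (a i) \<notin> pos"
      using simple_left_descent[of Ix ws] False by auto
    let ?v = "s (a i) \<circ> w"
    have c: "card (Inv w) = Suc (card (Inv ?v))"
      using card_Inv_left[of ?v i] left_flip[OF less.prems i(1)] i by simp
    then have "len ?v \<le> card (Inv ?v)"
      using less.hyps left_flip[OF less.prems i(1)] by simp
    moreover obtain vs where vs: "set vs \<subseteq> Ix" "?v = word vs" "length vs = len ?v"
      using reduced_word[of ?v] left_flip[OF less.prems i(1)] by blast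
    have "w = word (i # vs)" unfolding word_Cons using left_flip[OF less.prems i(1)] vs(2) by simp
    then have "len w \<le> Suc (len ?v)" using len_le[of "i # vs"] vs i by simp
    ultimately show ?thesis using c by simp
  qed
qed

lemma len_Inv: "w \<in> W \<Longrightarrow> len w = card (Inv w)"
  using len_le_card_Inv[of w] card_Inv_word by (metis le_antisym reduced_word)

lemma len_id [simp]: "len id = 0"
  by (simp add: len_Inv W_id)

lemma len_0_imp_id: "w \<in> W \<Longrightarrow> len w = 0 \<Longrightarrow> w = id"
  by (metis reduced_word length_0_conv word_Nil)

lemma len_le_card_pos: "w \<in> W \<Longrightarrow> len w \<le> card pos"
  using finite_pos by (simp add: len_Inv) (auto intro!: card_mono simp: Inv_def)

lemma len_left: "w \<in> W \<Longrightarrow> i \<in> Ix \<Longrightarrow> inv' w (a i) \<in> pos \<Longrightarrow> len (s (a i) \<circ> w) = Suc (len w)"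
  using left_flip(3)[of w i] by (simp add: len_Inv card_Inv_left)

lemma len_left_neg:
  "w \<in> W \<Longrightarrow> i \<in> Ix \<Longrightarrow> inv' w (a i) \<notin> pos \<Longrightarrow> len w = Suc (len (s (a i) \<circ> w))"
  using left_flip[of w i] len_left[of "s (a i) \<circ> w" i] by simp

lemma len_right: "w \<in> W \<Longrightarrow> i \<in> Ix \<Longrightarrow> w (a i) \<in> pos \<Longrightarrow> len (w \<circ> s (a i)) = Suc (len w)"
  using right_flip(3)[of w i] Inv_right[of w i] by (simp add: len_Inv)

lemma len_right_neg:
  "w \<in> W \<Longrightarrow> i \<in> Ix \<Longrightarrow> w (a i) \<notin> pos \<Longrightarrow> len w = Suc (len (w \<circ> s (a i)))"
  using right_flip[of w i] len_right[of "w \<circ> s (a i)" i] by simp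

lemma len_inv: assumes "w \<in> W" shows "len (inv' w) = len w"
proof -
  have le: "len (inv' w) \<le> len w" if "w \<in> W" for w
  proof -
    obtain ws where "set ws \<subseteq> Ix" "w = word ws" "length ws = len w"
      using reduced_word[OF \<open>w \<in> W\<close>] by metis
    then show ?thesis using len_le[of "rev ws"] by (simp add: inv_word)
  qed
  show ?thesis using le[OF assms] le[OF W_inv[OF assms]] W_inv_inv[OF assms] by simp
qed

lemma len_reflect_less:
  assumes w: "w \<in> W" and \<beta>: "\<beta> \<in> pos" and "inv' w \<beta> \<notin> pos"
  shows "len (s \<beta> \<circ> w) < len w"
proof -
  obtain ws where ws: "set ws \<subseteq> Ix" "w = word ws" "length ws = len w"
    using reduced_word[OF w] by blast
  then obtain vs where "set vs \<subseteq> Ix" "length vs < length ws" "s \<beta> \<circ> word ws = word vs"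
    using exchange[of Ix ws \<beta>] assms by auto
  then show ?thesis using len_le[of vs] ws by simp
qed

lemma len_reflect_greater:
  assumes w: "w \<in> W" and \<beta>: "\<beta> \<in> pos" and "inv' w \<beta> \<in> pos"
  shows "len w < len (s \<beta> \<circ> w)"
proof -
  have r: "\<beta> \<in> roots R" using \<beta> pos_roots_subset by simp
  have "inv' (s \<beta> \<circ> w) \<beta> \<notin> pos"
    unfolding inv_s_comp[OF w r] using W_neg[OF W_inv[OF w] r] assms(3) by (simp add: s_self r)
  then have "len (s \<beta> \<circ> (s \<beta> \<circ> w)) < len (s \<beta> \<circ> w)"
    using W_comp[OF W_s[OF r] w] \<beta> by (intro len_reflect_less)
  moreover have "s \<beta> \<circ> (s \<beta> \<circ> w) = w" using s_invol[OF r] by auto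
  ultimately show ?thesis by simp
qed

lemma right_descent:
  assumes "w \<in> W" "w \<noteq> id"
  obtains i where "i \<in> Ix" "w (a i) \<notin> pos"
proof -
  obtain ws where ws: "set ws \<subseteq> Ix" "inv' w = word ws" using W_inv[OF assms(1)] W_word by auto
  have "inv' w \<noteq> id" using assms W_inv_inv[OF assms(1)] inv_id by metis
  then show ?thesis
    using simple_left_descent[of Ix ws] ws W_inv_inv[OF assms(1)] that by auto
qed

subsection \<open>Parabolic cosets\<close>

lemma W_s_simple: "i \<in> Ix \<Longrightarrow> s (a i) \<in> W"
  by (simp add: W_s a_root)

lemma parabolic_word: "J \<subseteq> Ix \<Longrightarrow> w \<in> parabolic R J \<longleftrightarrow> (\<exists>ws. set ws \<subseteq> J \<and> w = word ws)"
proof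
  assume J: "J \<subseteq> Ix" and "w \<in> parabolic R J"
  then have "w \<in> generate (weyl R) ((\<lambda>i. s (a i)) ` J)"
    by (simp add: parabolic_def simple_reflection_def[abs_def])
  then show "\<exists>ws. set ws \<subseteq> J \<and> w = word ws"
  proof (induction rule: generate.induct)
    case one
    show ?case by (intro exI[of _ "[]"]) (auto simp: one_weyl)
  next
    case (incl h)
    then obtain j where "j \<in> J" "h = s (a j)" by auto
    then show ?case by (intro exI[of _ "[j]"]) (auto simp: word_Cons)
  next
    case (inv h)
    then obtain j where "j \<in> J" "h = s (a j)" by auto
    then show ?case using J by (intro exI[of _ "[j]"]) (auto simp: weyl_inv W_s_simple inv_s a_root word_Cons)
  next
    case (eng h1 h2)
    then obtain us vs where "set us \<subseteq> J" "h1 = word us" "set vs \<subseteq> J" "h2 = word vs" by auto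
    moreover from this have "h1 \<in> W" "h2 \<in> W" using J W_word by blast+
    ultimately have "set (us @ vs) \<subseteq> J \<and> h1 \<otimes>\<^bsub>weyl R\<^esub> h2 = word (us @ vs)"
      by (simp add: W_mult word_append)
    then show ?case by blast
  qed
next
  assume J: "J \<subseteq> Ix" and "\<exists>ws. set ws \<subseteq> J \<and> w = word ws"
  then obtain ws where ws: "set ws \<subseteq> J" "w = word ws" by auto
  have "word ws \<in> generate (weyl R) ((\<lambda>i. s (a i)) ` J)"
    using ws(1)
  proof (induction ws)
    case Nil
    have "word [] \<in> generate (weyl R) ((\<lambda>i. s (a i)) ` J)"
      using generate.one[of "weyl R"] by (simp add: one_weyl)
    then show ?case .
  next
    case (Cons i ws)
    then have "s (a i) \<otimes>\<^bsub>weyl R\<^esub> word ws \<in> generate (weyl R) ((\<lambda>i. s (a i)) ` J)"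
      by (intro generate.eng) (auto intro: generate.incl)
    moreover have "word ws \<in> W" "i \<in> Ix" using Cons.prems J by (auto intro!: word_W)
    ultimately have "word (i # ws) \<in> generate (weyl R) ((\<lambda>i. s (a i)) ` J)"
      by (simp add: W_mult W_s_simple word_Cons)
    then show ?case .
  qed
  then show "w \<in> parabolic R J" using ws(2) by (simp add: parabolic_def simple_reflection_def[abs_def])
qed

lemma maps_span_pos:
  assumes A: "lmap A" "A \<gamma> \<in> roots R" "\<And>j. j \<in> Ix \<Longrightarrow> coef j \<gamma> \<noteq> 0 \<Longrightarrow> A (a j) \<in> pos"
    and \<gamma>: "\<gamma> \<in> pos"
  shows "A \<gamma> \<in> pos"
proof (rule root_ge_0_imp_pos[OF A(2)])
  fix k assume k: "k \<in> Ix"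
  have "A \<gamma> = (\<Sum>i\<in>Ix. coef i \<gamma> \<cdot> A (a i))"
    by (subst sum_coef[of \<gamma>, symmetric]) (simp add: lmap_sum[OF A(1)] lmap_scale[OF A(1)])
  then have "Re (coef k (A \<gamma>)) = (\<Sum>i\<in>Ix. Re (coef i \<gamma> * coef k (A (a i))))"
    by (simp add: coef_sum coef_scale)
  also have "\<dots> \<ge> 0"
  proof (rule sum_nonneg)
    fix i assume i: "i \<in> Ix"
    show "0 \<le> Re (coef i \<gamma> * coef k (A (a i)))"
    proof (cases "coef i \<gamma> = 0")
      case False
      then obtain m n :: nat where "coef i \<gamma> = of_nat m" "coef k (A (a i)) = of_nat n"
        using \<gamma> A(3)[OF i] i k unfolding pos_iff Nats_def by blast
      then show ?thesis by simp
    qed simp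
  qed
  finally show "Re (coef k (A \<gamma>)) \<ge> 0" .
qed

context
  fixes J :: "nat set" assumes J: "J \<subseteq> Ix"
begin

lemma parabolic_W: "x \<in> parabolic R J \<Longrightarrow> x \<in> W"
  using J by (auto simp: parabolic_word W_word)

lemma parabolic_id: "id \<in> parabolic R J"
  using J by (auto simp: parabolic_word intro!: exI[of _ "[]"])

lemma parabolic_comp: "x \<in> parabolic R J \<Longrightarrow> y \<in> parabolic R J \<Longrightarrow> x \<circ> y \<in> parabolic R J"
  using J by (metis parabolic_word word_append set_append Un_subset_iff)

lemma parabolic_inv: "x \<in> parabolic R J \<Longrightarrow> inv' x \<in> parabolic R J"
  using J by (metis parabolic_word inv_word set_rev order_trans)

lemma parabolic_s: "j \<in> J \<Longrightarrow> s (a j) \<in> parabolic R J"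
  using J by (auto simp: parabolic_word word_Cons intro!: exI[of _ "[j]"])

lemma wcoset_image: "w \<in> W \<Longrightarrow> wcoset R J w = (\<lambda>x. w \<circ> x) ` parabolic R J"
  using parabolic_W by (auto simp: wcoset_def l_coset_def W_mult)

lemma wcoset_self: "w \<in> W \<Longrightarrow> w \<in> wcoset R J w"
  using imageI[OF parabolic_id, of "\<lambda>x. w \<circ> x"] by (simp add: wcoset_image)

lemma wcoset_comp: "w \<in> W \<Longrightarrow> x \<in> parabolic R J \<Longrightarrow> wcoset R J (w \<circ> x) = wcoset R J w"
proof -
  assume w: "w \<in> W" and x: "x \<in> parabolic R J"
  have "w \<circ> y = (w \<circ> x) \<circ> (inv' x \<circ> y)" if "y \<in> parabolic R J" for y
    using parabolic_W[OF x] by auto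
  moreover have "inv' x \<circ> y \<in> parabolic R J" if "y \<in> parabolic R J" for y
    using that x parabolic_inv parabolic_comp by blast
  ultimately have "wcoset R J w \<subseteq> wcoset R J (w \<circ> x)"
    using W_comp[OF w parabolic_W[OF x]] by (auto simp: wcoset_image w)
  moreover have "wcoset R J (w \<circ> x) \<subseteq> wcoset R J w"
    using W_comp[OF w parabolic_W[OF x]] parabolic_comp[OF x] by (auto simp: wcoset_image w o_assoc[symmetric])
  ultimately show ?thesis by blast
qed

lemma wcoset_memD:
  assumes "w \<in> W" "v \<in> wcoset R J w"
  shows "v \<in> W" "wcoset R J v = wcoset R J w" "\<exists>x\<in>parabolic R J. v = w \<circ> x"
  using assms wcoset_comp parabolic_W W_comp by (auto simp: wcoset_image)

lemma wcoset_eq_iff: "v \<in> W \<Longrightarrow> w \<in> W \<Longrightarrow> wcoset R J v = wcoset R J w \<longleftrightarrow> (\<exists>x\<in>parabolic R J. v = w \<circ> x)"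
  using wcoset_self wcoset_memD(3) wcoset_comp by metis

lemma parabolic_coef: "x \<in> parabolic R J \<Longrightarrow> i \<in> Ix - J \<Longrightarrow> coef i (x v) = coef i v"
proof -
  assume "x \<in> parabolic R J" and i: "i \<in> Ix - J"
  then obtain ws where ws: "set ws \<subseteq> J" "x = word ws" using J parabolic_word by auto
  have "coef i (word ws v) = coef i v" using ws(1)
    by (induction ws) (use i J in \<open>auto simp: coef_s_simple subset_iff word_Cons\<close>)
  then show ?thesis using ws by simp
qed

text \<open>For \<open>x \<noteq> id\<close> some \<open>j\<close> in \<open>J\<close> gives
  \<open>x (a j)\<close> negative. Then \<open>x (- a j)\<close> is a positive root in the span of
  the simple roots of \<open>J\<close>, and \<open>u\<close> keeps such roots positive, against the
  assumption on \<open>u \<circ> x\<close>.\<close>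

lemma minimal_unique:
  assumes u: "u \<in> W" "\<And>j. j \<in> J \<Longrightarrow> u (a j) \<in> pos"
    and x: "x \<in> parabolic R J" and ux: "\<And>j. j \<in> J \<Longrightarrow> (u \<circ> x) (a j) \<in> pos"
  shows "x = id"
proof (rule ccontr)
  assume "x \<noteq> id"
  have xW: "x \<in> W" using x parabolic_W by simp
  obtain ws where ws: "set ws \<subseteq> J" "inv' x = word ws" using parabolic_inv[OF x] J parabolic_word by auto
  have "word ws \<noteq> id" using \<open>x \<noteq> id\<close> W_inv_inv[OF xW] inv_id ws by metis
  then obtain j where j: "j \<in> J" "x (a j) \<notin> pos"
    using simple_left_descent[OF J ws(1)] ws W_inv_inv[OF xW] by auto
  then have ji: "j \<in> Ix" using J by auto
  have "x (- a j) \<in> pos" using W_neg[OF xW a_root[OF ji]] j by simp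
  moreover have "coef i (x (- a j)) = 0" if "i \<in> Ix - J" for i
    using that ji j by (auto simp: parabolic_coef[OF x] coef_uminus coef_simple)
  ultimately have "u (x (- a j)) \<in> pos"
    using maps_span_pos[OF W_lmap[OF u(1)] W_roots[OF u(1)]] u(2) pos_roots_subset by blast
  moreover have "u (x (- a j)) = - (u \<circ> x) (a j)"
    using lmap_uminus[OF W_lmap[OF xW]] lmap_uminus[OF W_lmap[OF u(1)]] by simp
  ultimately show False using ux[OF j(1)] uminus_notin_pos by simp
qed

lemma shortest_pos:
  assumes u: "u \<in> W" "\<And>v. v \<in> wcoset R J u \<Longrightarrow> len u \<le> len v" and j: "j \<in> J"
  shows "u (a j) \<in> pos"
proof (rule ccontr)
  assume n: "u (a j) \<notin> pos"
  have ji: "j \<in> Ix" using j J by auto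
  have "u \<circ> s (a j) \<in> wcoset R J u"
    using u(1) parabolic_s[OF j] by (auto simp: wcoset_image)
  then show False using u(2) len_right_neg[OF u(1) ji n] by fastforce
qed

lemma shortest_unique:
  assumes "u \<in> W" "v \<in> wcoset R J u" "\<And>j. j \<in> J \<Longrightarrow> u (a j) \<in> pos"
    "\<And>j. j \<in> J \<Longrightarrow> v (a j) \<in> pos"
  shows "v = u"
proof -
  obtain x where x: "x \<in> parabolic R J" "v = u \<circ> x" using wcoset_memD[OF assms(1,2)] by blast
  then have "x = id" using minimal_unique[OF assms(1,3) x(1)] assms(4) by simp
  then show ?thesis using x by simp
qed

lemma min_rep_wcoset:
  assumes w: "w \<in> W"
  shows "min_rep R (wcoset R J w) \<in> wcoset R J w"
    "\<And>v. v \<in> wcoset R J w \<Longrightarrow> len (min_rep R (wcoset R J w)) \<le> len v"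
  using arg_min_nat_lemma[of "\<lambda>v. v \<in> wcoset R J w" w len] wcoset_self[OF w]
  by (auto simp: min_rep_def)

text \<open>This local description of the minimal representatives is the one used from here on. For
  the converse direction, a shortest element of the coset satisfies the sign conditions as well, and
  \<open>shortest_unique\<close> identifies it with \<open>w\<close>.\<close>

lemma min_reps_iff: "w \<in> min_reps R J \<longleftrightarrow> w \<in> W \<and> (\<forall>j\<in>J. w (a j) \<in> pos)"
proof
  assume w: "w \<in> min_reps R J"
  then have "len w \<le> len v" if "v \<in> wcoset R J w" for v
    using that by (cases "v = w") (auto simp: min_reps_def)
  then show "w \<in> W \<and> (\<forall>j\<in>J. w (a j) \<in> pos)"
    using w shortest_pos by (auto simp: min_reps_def)
next
  assume w: "w \<in> W \<and> (\<forall>j\<in>J. w (a j) \<in> pos)"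
  let ?u = "min_rep R (wcoset R J w)"
  have u: "?u \<in> wcoset R J w" "?u \<in> W" "wcoset R J ?u = wcoset R J w"
    and min: "\<And>v. v \<in> wcoset R J w \<Longrightarrow> len ?u \<le> len v"
    using min_rep_wcoset w wcoset_memD by blast+
  have upos: "?u (a j) \<in> pos" if "j \<in> J" for j using shortest_pos[OF u(2) _ that] min u(3) by simp
  have "w = ?u" using shortest_unique[OF u(2), of w] wcoset_self w upos u(3) by auto
  moreover have "len ?u < len v" if v: "v \<in> wcoset R J w" "v \<noteq> ?u" for v
  proof (rule ccontr)
    assume "\<not> len ?u < len v"
    then have "\<And>x. x \<in> wcoset R J v \<Longrightarrow> len v \<le> len x"
      using min v wcoset_memD(2)[of w v] w by fastforce
    then have "v (a j) \<in> pos" if "j \<in> J" for j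
      using shortest_pos that v(1) wcoset_memD(1) w by blast
    then have "v = ?u" using shortest_unique[OF u(2), of v] upos u(3) v by auto
    then show False using v by simp
  qed
  ultimately show "w \<in> min_reps R J" using w by (simp add: min_reps_def)
qed

lemma min_rep_in_min_reps: "w \<in> W \<Longrightarrow> min_rep R (wcoset R J w) \<in> min_reps R J"
  using min_rep_wcoset shortest_pos wcoset_memD by (metis min_reps_iff)

lemma min_rep_of_min_reps: "w \<in> min_reps R J \<Longrightarrow> min_rep R (wcoset R J w) = w"
  using min_rep_in_min_reps min_rep_wcoset(1) shortest_unique by (metis min_reps_iff)

lemma min_rep_len_eq:
  assumes w: "w \<in> W" "len w \<le> len (min_rep R (wcoset R J w))"
  shows "min_rep R (wcoset R J w) = w"
proof -
  have "w \<in> min_reps R J"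
    unfolding min_reps_iff using w min_rep_wcoset(2)[OF w(1)] shortest_pos[OF w(1)] by fastforce
  then show ?thesis by (rule min_rep_of_min_reps)
qed

lemma min_reps_W: "w \<in> min_reps R J \<Longrightarrow> w \<in> W"
  by (simp add: min_reps_iff)

lemma finite_min_reps: "finite (min_reps R J)"
  by (rule finite_subset[OF _ finite_W]) (auto simp: min_reps_W)

end

lemma min_reps_empty: "min_reps R {} = W"
  by (auto simp: min_reps_iff)

subsection \<open>Bruhat order\<close>

lemma bruhat_refl: "bruhat_le R x x"
  by (simp add: bruhat_le_def)

lemma bruhat_trans: "bruhat_le R x y \<Longrightarrow> bruhat_le R y z \<Longrightarrow> bruhat_le R x z"
  unfolding bruhat_le_def by (rule rtrancl_trans)

abbreviation bedge :: "('v \<Rightarrow> 'v) \<Rightarrow> ('v \<Rightarrow> 'v) \<Rightarrow> bool" where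
  "bedge x y \<equiv> \<exists>\<alpha>\<in>pos. x \<in> W \<and> y = s \<alpha> \<circ> x \<and> len x < len y"

lemma bruhat_set:
  "{(x, y). \<exists>\<alpha>\<in>pos. x \<in> W \<and> y = s \<alpha> \<otimes>\<^bsub>weyl R\<^esub> x \<and> len x < len y} = {(x, y). bedge x y}"
  using W_s pos_roots_subset by (auto simp: W_mult)

lemma bruhat_le_rtrancl: "bruhat_le R u w \<longleftrightarrow> (u, w) \<in> {(x, y). bedge x y}\<^sup>*"
  by (simp only: bruhat_le_def bruhat_set)

lemma bedge_le: "bedge x y \<Longrightarrow> bruhat_le R x y"
  unfolding bruhat_le_rtrancl by (intro r_into_rtrancl) simp

lemma bruhat_len: "bruhat_le R u w \<Longrightarrow> u = w \<or> len u < len w"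
  unfolding bruhat_le_rtrancl by (induction rule: rtrancl_induct) auto

text \<open>Right multiplication by \<open>s (a i)\<close> changes the sign of
  \<open>inv' x \<alpha>\<close> only if this root is \<open>a i\<close>; in that exceptional case
  the edge joins \<open>x\<close> and \<open>x \<circ> s (a i)\<close> itself.\<close>

lemma bedge_right:
  assumes "bedge x y" "i \<in> Ix"
  shows "x \<circ> s (a i) = y \<or> bedge (x \<circ> s (a i)) (y \<circ> s (a i))"
proof -
  obtain \<alpha> where \<alpha>: "\<alpha> \<in> pos" "x \<in> W" "y = s \<alpha> \<circ> x" "len x < len y" using assms by blast
  have r: "\<alpha> \<in> roots R" and ai: "a i \<in> roots R" using \<alpha> assms pos_roots_subset a_root by auto
  have xp: "inv' x \<alpha> \<in> pos" using len_reflect_less \<alpha> by fastforce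
  show ?thesis
  proof (cases "inv' x \<alpha> = a i")
    case True
    then have "\<alpha> = x (a i)" using \<alpha>(2) W_inv_right by metis
    then show ?thesis using W_conj[OF \<alpha>(2) ai] \<alpha>(3) by simp
  next
    case False
    have xs: "x \<circ> s (a i) \<in> W" using \<alpha>(2) W_s[OF ai] W_comp by blast
    have "inv' (x \<circ> s (a i)) \<alpha> \<in> pos"
      unfolding inv_comp_s[OF \<alpha>(2) ai] by (rule simple_permutes_pos[OF assms(2) xp False])
    then have "len (x \<circ> s (a i)) < len (s \<alpha> \<circ> (x \<circ> s (a i)))"
      using len_reflect_greater xs \<alpha>(1) by blast
    then show ?thesis using xs \<alpha> by (intro disjI2 bexI[of _ \<alpha>]) (auto simp: o_assoc)
  qed
qed

lemma bruhat_right1: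
  assumes "bruhat_le R x y" "i \<in> Ix"
  shows "bruhat_le R (x \<circ> s (a i)) (y \<circ> s (a i)) \<or> bruhat_le R (x \<circ> s (a i)) y"
  using assms(1) unfolding bruhat_le_rtrancl[of x y]
proof (induction rule: rtrancl_induct)
  case base
  show ?case using bruhat_refl by blast
next
  case (step y z)
  then have e: "bedge y z" by simp
  have d: "y \<circ> s (a i) = z \<or> bruhat_le R (y \<circ> s (a i)) (z \<circ> s (a i))"
    using bedge_right[OF e assms(2)] bedge_le[of "y \<circ> s (a i)" "z \<circ> s (a i)"] by blast
  from step.IH show ?case
  proof
    assume "bruhat_le R (x \<circ> s (a i)) (y \<circ> s (a i))"
    then show ?thesis using d bruhat_trans by blast
  next
    assume "bruhat_le R (x \<circ> s (a i)) y"
    then show ?thesis using bedge_le[OF e] bruhat_trans by blast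
  qed
qed

lemma bruhat_right2:
  assumes "bruhat_le R x y" "i \<in> Ix"
  shows "bruhat_le R (x \<circ> s (a i)) (y \<circ> s (a i)) \<or> bruhat_le R x (y \<circ> s (a i))"
  using assms(1) unfolding bruhat_le_rtrancl[of x y]
proof (induction rule: converse_rtrancl_induct)
  case base
  show ?case using bruhat_refl by blast
next
  case (step x z)
  then have e: "bedge x z" by simp
  have xW: "x \<in> W" using e by blast
  have d: "x \<circ> s (a i) = z \<or> bruhat_le R (x \<circ> s (a i)) (z \<circ> s (a i))"
    using bedge_right[OF e assms(2)] bedge_le[of "x \<circ> s (a i)" "z \<circ> s (a i)"] by blast
  from step.IH show ?case
  proof
    assume le: "bruhat_le R (z \<circ> s (a i)) (y \<circ> s (a i))"
    show ?thesis
    proof (cases "x \<circ> s (a i) = z")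
      case True
      then have "z \<circ> s (a i) = x" using right_flip(2)[OF xW assms(2)] by simp
      then have "bruhat_le R x (y \<circ> s (a i))" using le by simp
      then show ?thesis by blast
    next
      case False
      then show ?thesis using d le bruhat_trans by blast
    qed
  next
    assume "bruhat_le R z (y \<circ> s (a i))"
    then show ?thesis using bedge_le[OF e] bruhat_trans by blast
  qed
qed

lemma bedge_simple:
  assumes "v \<in> W" "i \<in> Ix" "v (a i) \<in> pos"
  shows "bedge v (v \<circ> s (a i))"
  using assms W_conj[OF assms(1) a_root[OF assms(2)]] len_right[OF assms] by (intro bexI[of _ "v (a i)"]) auto

text \<open>The lifting property, in the form of a recursion for lower sets. Its shape matches the
  recursion for the values \<open>P w v\<close> along a right descent of \<open>v\<close>, to which
  \<open>P_nonneg_support\<close> applies it.\<close>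

lemma bruhat_lifting:
  assumes v: "v \<in> W" and i: "i \<in> Ix" and up: "v (a i) \<in> pos" and w: "w \<in> W"
  shows "bruhat_le R w (v \<circ> s (a i)) \<longleftrightarrow>
    bruhat_le R w v \<or> (w (a i) \<notin> pos \<and> bruhat_le R (w \<circ> s (a i)) v)"
proof
  have vs: "bruhat_le R v (v \<circ> s (a i))" using bedge_le[OF bedge_simple[OF v i up]] .
  assume "bruhat_le R w v \<or> (w (a i) \<notin> pos \<and> bruhat_le R (w \<circ> s (a i)) v)"
  then show "bruhat_le R w (v \<circ> s (a i))"
    using vs bruhat_trans bruhat_right1[of "w \<circ> s (a i)" v i] right_flip[OF w i] i by metis
next
  assume "bruhat_le R w (v \<circ> s (a i))"
  then have "bruhat_le R (w \<circ> s (a i)) v \<or> bruhat_le R w v"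
    using bruhat_right2[of w "v \<circ> s (a i)" i] right_flip[OF v i] i by metis
  then show "bruhat_le R w v \<or> (w (a i) \<notin> pos \<and> bruhat_le R (w \<circ> s (a i)) v)"
    using bedge_le[OF bedge_simple[OF w i]] bruhat_trans by blast
qed

lemma bruhat_id_right: "w \<in> W \<Longrightarrow> bruhat_le R w id \<longleftrightarrow> w = id"
  using bruhat_len[of w id] bruhat_refl by auto

end

section \<open>Linear forms and divided differences\<close>

context based_root_system
begin

abbreviation S :: "cpoly set" where "S \<equiv> polys_in Ix"
abbreviation lf :: "'v \<Rightarrow> cpoly" where "lf \<equiv> lin_form R"
abbreviation act :: "('v \<Rightarrow> 'v) \<Rightarrow> cpoly \<Rightarrow> cpoly" where "act \<equiv> weyl_act R"

lemma carrier_S: "carrier (sym_alg R) = S"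
  by (simp add: carrier_sym_alg Ix_def)

lemma lf_coef: "lf v = (\<Sum>i\<in>Ix. const_poly (coef i v) * var_poly i)"
  by (simp add: lin_form_def coef_def Ix_def)

lemma lf_in: "lf v \<in> S"
  unfolding lf_coef by (intro polys_in_sum polys_in_mult polys_in_var) auto

lemma lf_add: "lf (x + y) = lf x + lf y"
  and lf_scale: "lf (c \<cdot> x) = const_poly c * lf x"
  and lf_uminus: "lf (- x) = - lf x"
  and lf_diff: "lf (x - y) = lf x - lf y"
  and lf_0 [simp]: "lf 0 = 0"
  by (simp_all add: lf_coef coef_add coef_scale coef_uminus coef_diff coef_0 const_poly_add
      const_poly_mult const_poly_uminus const_poly_diff sum.distrib sum_distrib_left sum_negf
      sum_subtractf algebra_simps)

lemma lf_sum: "lf (sum f A) = (\<Sum>x\<in>A. lf (f x))"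
  by (induction A rule: infinite_finite_induct) (auto simp: lf_add)

lemma lf_simple: "i \<in> Ix \<Longrightarrow> lf (a i) = var_poly i"
proof -
  assume "i \<in> Ix"
  then have "lf (a i) = (\<Sum>j\<in>Ix. if j = i then var_poly j else 0)"
    unfolding lf_coef by (intro sum.cong) (auto simp: coef_simple)
  then show ?thesis using \<open>i \<in> Ix\<close> by simp
qed

lemma lookup_lf:
  assumes "i \<in> Ix"
  shows "lookup (lf v) (Poly_Mapping.single i 1) = coef i v"
proof -
  have "Poly_Mapping.single j (1::nat) = Poly_Mapping.single i 1 \<longleftrightarrow> j = i" for j
    by (metis lookup_single_eq lookup_single_not_eq zero_neq_one)
  then have "lookup (lf v) (Poly_Mapping.single i 1) = (\<Sum>j\<in>Ix. if j = i then coef j v else 0)"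
    unfolding lf_coef lookup_sum by (intro sum.cong) (auto simp: var_poly_def lookup_single when_def)
  then show ?thesis using assms by simp
qed

lemma lf_eq_0_iff [simp]: "lf v = 0 \<longleftrightarrow> v = 0"
proof
  assume "lf v = 0"
  then have "coef i v = coef i 0" if "i \<in> Ix" for i using lookup_lf[OF that, of v] by (simp add: coef_0)
  then show "v = 0" by (rule coef_eqI)
qed simp

lemma lf_root_nonzero: "\<beta> \<in> roots R \<Longrightarrow> lf \<beta> \<noteq> 0"
  using zero_notin_roots by auto

lemma homogeneous_lf: "homogeneous 1 (lf v)"
  unfolding lf_coef using homogeneous_mult[OF homogeneous_const homogeneous_var]
  by (intro homogeneous_sum) simp

lemma eval0_lf [simp]: "eval0 (lf v) = 0"
  by (simp add: lf_coef eval0_sum eval0_mult)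

lemma nonneg_poly_lf: "\<beta> \<in> pos \<Longrightarrow> nonneg_poly (lf \<beta>)"
  unfolding lf_coef
  by (intro nonneg_poly_sum nonneg_poly_mult nonneg_poly_const nonneg_poly_var)
    (auto simp: pos_iff Nats_def)

section \<open>The Weyl group action and divisibility by roots\<close>

lemma act_subst: "act A f = subst (\<lambda>i. lf (A (a i))) f"
  by (simp add: weyl_act_def subst_def mon_subst_def)

lemma act_add: "act A (f + g) = act A f + act A g"
  and act_diff: "act A (f - g) = act A f - act A g"
  and act_mult: "act A (f * g) = act A f * act A g"
  and act_const [simp]: "act A (const_poly c) = const_poly c"
  and act_0 [simp]: "act A 0 = 0"
  and act_1 [simp]: "act A 1 = 1"
  and act_sum: "act A (sum h T) = (\<Sum>x\<in>T. act A (h x))"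
  and act_prod: "act A (prod h T) = (\<Prod>x\<in>T. act A (h x))"
  by (simp_all add: act_subst subst_add subst_diff subst_uminus subst_mult subst_sum subst_prod)

lemma act_lf: "lmap A \<Longrightarrow> act A (lf v) = lf (A v)"
proof -
  assume A: "lmap A"
  have "act A (lf v) = (\<Sum>i\<in>Ix. lf (coef i v \<cdot> A (a i)))"
    by (simp add: act_subst lf_coef[of v] subst_sum subst_mult lf_scale)
  also have "\<dots> = lf (A v)"
    by (subst sum_coef[of v, symmetric]) (simp add: lmap_sum A lmap_scale lf_sum)
  finally show ?thesis .
qed

lemma act_in: "act A f \<in> S"
  unfolding act_subst by (rule subst_in[of _ UNIV]) (auto simp: polys_in_def[of UNIV] lf_in)

lemma act_act: "lmap A \<Longrightarrow> act A (act B f) = act (A \<circ> B) f"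
  using act_lf by (simp add: act_subst subst_subst)

lemma act_id: "f \<in> S \<Longrightarrow> act id f = f"
  using subst_cong[of f Ix "\<lambda>i. lf (a i)" var_poly] by (simp add: act_subst lf_simple subst_id)

lemma act_cong_dvd:
  assumes "f \<in> S" "\<And>i. i \<in> Ix \<Longrightarrow> l dvd lf (A (a i) - B (a i))"
  shows "l dvd act A f - act B f"
  unfolding act_subst using assms by (intro dvd_subst_diff) (auto simp: lf_diff)

lemma act_dvd: "l dvd f \<Longrightarrow> act A l dvd act A f"
  by (auto simp: act_mult elim!: dvdE)

lemma eval0_act: "eval0 (act A f) = eval0 f"
  unfolding act_subst by (rule eval0_subst_fixed[of _ UNIV]) (auto simp: polys_in_def)

lemma homogeneous_act:
  assumes "homogeneous d f" shows "homogeneous d (act A f)"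
proof -
  have "dbl (lf v) = const_poly 2 * lf v" for v
    using homogeneous_lf[of v] by (simp add: homogeneous_iff_dbl)
  then have "dbl (act A f) = act A (dbl f)"
    by (simp add: act_subst dbl_def subst_subst subst_mult)
  then show ?thesis using assms by (simp add: homogeneous_iff_dbl act_mult)
qed

text \<open>The endomorphism below extends the projection of \<open>t\<^sup>*\<close> along \<open>\<beta>\<close>.\<close>

lemma lf_dvd_iff:
  assumes "\<beta> \<in> roots R" "f \<in> S"
  shows "lf \<beta> dvd f \<longleftrightarrow> act (\<lambda>x. x - (coroot R \<beta> x / 2) \<cdot> \<beta>) f = 0"
proof -
  define A where "A x = x - (coroot R \<beta> x / 2) \<cdot> \<beta>" for x
  have A: "lmap A"
    using assms(1) by (simp add: lmap_def A_def coroot_add coroot_scale scale_right_diff_distrib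
        add_divide_distrib scale_left_distrib)
  have "A \<beta> = 0" using assms(1) by (simp add: A_def coroot_self)
  then have "act A (lf \<beta>) = 0" using act_lf[OF A] by simp
  moreover have "lf \<beta> dvd f - act A f"
  proof -
    have "lf \<beta> dvd act id f - act A f"
      by (rule act_cong_dvd[OF assms(2)]) (simp add: A_def lf_scale)
    then show ?thesis using act_id[OF assms(2)] by simp
  qed
  ultimately have "lf \<beta> dvd f \<longleftrightarrow> act A f = 0"
    using act_dvd[of "lf \<beta>" f A] by auto
  then show ?thesis by (simp add: A_def[abs_def])
qed

text \<open>Divisibility by the root is vanishing under a ring endomorphism, and the target has no
  zero divisors.\<close>

lemma lf_prime:
  assumes "\<beta> \<in> roots R" "f \<in> S" "g \<in> S" "lf \<beta> dvd f * g"
  shows "lf \<beta> dvd f \<or> lf \<beta> dvd g"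
  using assms(4) by (simp add: lf_dvd_iff[OF assms(1)] assms(1-3) polys_in_mult act_mult)

lemma lf_dvd_lf:
  assumes "\<beta> \<in> roots R" "\<gamma> \<in> roots R" "lf \<beta> dvd lf \<gamma>"
  shows "\<gamma> = \<beta> \<or> \<gamma> = - \<beta>"
proof -
  have "lmap (\<lambda>x. x - (coroot R \<beta> x / 2) \<cdot> \<beta>)"
    using assms(1) by (simp add: lmap_def coroot_add coroot_scale scale_right_diff_distrib
        add_divide_distrib scale_left_distrib)
  then have g: "\<gamma> = (coroot R \<beta> \<gamma> / 2) \<cdot> \<beta>"
    using assms lf_dvd_iff[OF assms(1) lf_in, of \<gamma>] by (simp add: act_lf)
  then show ?thesis using reduced[OF assms(1), of "coroot R \<beta> \<gamma> / 2"] assms(2) by auto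
qed

lemma prod_lf_in: "(\<Prod>\<beta>\<in>A. lf \<beta>) \<in> S"
  by (intro polys_in_prod lf_in)

text \<open>Distinct positive roots are primes that do not divide each other, so they can be split
  off one at a time.\<close>

lemma prod_lf_dvd:
  assumes "finite A" "A \<subseteq> pos" "f \<in> S" "\<And>\<beta>. \<beta> \<in> A \<Longrightarrow> lf \<beta> dvd f"
  shows "(\<Prod>\<beta>\<in>A. lf \<beta>) dvd f"
  using assms
proof (induction A rule: finite_induct)
  case (insert \<beta> A)
  have \<beta>: "\<beta> \<in> roots R" "\<beta> \<in> pos" and A: "A \<subseteq> pos" using insert.prems pos_roots_subset by auto
  have nz: "(\<Prod>\<gamma>\<in>A. lf \<gamma>) \<noteq> 0"
    using A pos_roots_subset lf_root_nonzero insert.hyps by (auto simp: zero_notin_roots)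
  obtain k where k: "k \<in> S" "f = (\<Prod>\<gamma>\<in>A. lf \<gamma>) * k"
    using polys_in_dvdE[OF _ prod_lf_in nz, of f] insert by auto
  have "\<not> lf \<beta> dvd (\<Prod>\<gamma>\<in>B. lf \<gamma>)" if "finite B" "B \<subseteq> A" for B
    using that
  proof (induction B rule: finite_induct)
    case empty
    have "eval0 (lf \<beta> * g) = 0" for g by (simp add: eval0_mult)
    then show ?case by (metis dvdE eval0_1 prod.empty zero_neq_one)
  next
    case (insert \<gamma> B)
    have \<gamma>: "\<gamma> \<in> pos" "\<gamma> \<in> roots R" "\<gamma> \<noteq> \<beta>"
      using insert.prems A \<open>\<beta> \<notin> A\<close> pos_roots_subset by auto
    then have "\<not> lf \<beta> dvd lf \<gamma>"
      using lf_dvd_lf[OF \<beta>(1) \<gamma>(2)] \<beta>(2) uminus_notin_pos by auto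
    then show ?case using insert lf_prime[OF \<beta>(1) lf_in prod_lf_in] by auto
  qed
  then have "\<not> lf \<beta> dvd (\<Prod>\<gamma>\<in>A. lf \<gamma>)" using insert.hyps by blast
  then have "lf \<beta> dvd k"
    using insert.prems(3)[of \<beta>] k lf_prime[OF \<beta>(1) prod_lf_in k(1)] by auto
  then have "lf \<beta> * (\<Prod>\<gamma>\<in>A. lf \<gamma>) dvd f" unfolding k(2) by (subst mult.commute) (intro mult_dvd_mono, auto)
  then show ?case using insert.hyps by simp
qed simp

subsection \<open>GKM functions on the Weyl group\<close>

text \<open>Where \<beta> does not move a coset, a pulled-back class satisfies the condition
  trivially, so this one notion serves every \<open>J\<close>.\<close>

definition gkm :: "(('v \<Rightarrow> 'v) \<Rightarrow> cpoly) \<Rightarrow> bool" where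
  "gkm q \<longleftrightarrow> (\<forall>v\<in>W. q v \<in> S) \<and> (\<forall>v\<in>W. \<forall>\<beta>\<in>pos. lf \<beta> dvd q (s \<beta> \<circ> v) - q v)"

lemma gkm_in: "gkm q \<Longrightarrow> v \<in> W \<Longrightarrow> q v \<in> S"
  by (simp add: gkm_def)

lemma gkm_dvd:
  assumes "gkm q" "v \<in> W" "\<beta> \<in> roots R"
  shows "lf \<beta> dvd q (s \<beta> \<circ> v) - q v"
proof (cases "\<beta> \<in> pos")
  case False
  then have "- \<beta> \<in> pos" using assms(3) pos_or_neg by blast
  then have "lf (- \<beta>) dvd q (s (- \<beta>) \<circ> v) - q v" using assms unfolding gkm_def by blast
  then show ?thesis using assms(3) by (simp add: s_uminus lf_uminus)
qed (use assms gkm_def in auto)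

lemma gkm_cong: "gkm q \<Longrightarrow> (\<And>v. v \<in> W \<Longrightarrow> q v = q' v) \<Longrightarrow> gkm q'"
  unfolding gkm_def using W_comp W_s pos_roots_subset by (metis (no_types, lifting))

lemma gkm_add: "gkm q \<Longrightarrow> gkm q' \<Longrightarrow> gkm (\<lambda>v. q v + q' v)"
  unfolding gkm_def
  using dvd_add[of "lf _" "q (s _ \<circ> _) - q _" "q' (s _ \<circ> _) - q' _"]
  by (auto simp: polys_in_add algebra_simps)

lemma gkm_mult:
  assumes "gkm q" "gkm q'" shows "gkm (\<lambda>v. q v * q' v)"
  unfolding gkm_def
proof (intro conjI ballI)
  fix v \<beta> assume v: "v \<in> W" "\<beta> \<in> pos"
  have "q (s \<beta> \<circ> v) * q' (s \<beta> \<circ> v) - q v * q' v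
      = (q (s \<beta> \<circ> v) - q v) * q' (s \<beta> \<circ> v) + q v * (q' (s \<beta> \<circ> v) - q' v)"
    by (simp add: algebra_simps)
  then show "lf \<beta> dvd q (s \<beta> \<circ> v) * q' (s \<beta> \<circ> v) - q v * q' v"
    using assms v by (auto simp: gkm_def intro!: dvd_add)
qed (use assms in \<open>auto simp: gkm_def polys_in_mult\<close>)

lemma gkm_const: "f \<in> S \<Longrightarrow> gkm (\<lambda>v. f)"
  by (simp add: gkm_def)

lemma gkm_diff:
  assumes "gkm q" "gkm q'" shows "gkm (\<lambda>v. q v - q' v)"
proof -
  have "gkm (\<lambda>v. - 1 * q' v)"
    by (rule gkm_mult[OF gkm_const assms(2)]) (simp add: polys_in_uminus)
  from gkm_add[OF assms(1) this] show ?thesis by simp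
qed

lemma gkm_sum: "(\<And>x. x \<in> A \<Longrightarrow> gkm (q x)) \<Longrightarrow> gkm (\<lambda>v. \<Sum>x\<in>A. q x v)"
  by (induction A rule: infinite_finite_induct) (auto simp: gkm_const gkm_add)

definition inv_prod :: "('v \<Rightarrow> 'v) \<Rightarrow> cpoly" where
  "inv_prod w = (\<Prod>\<beta>\<in>Inv w. lf \<beta>)"

lemma Inv_pos: "\<beta> \<in> Inv w \<Longrightarrow> \<beta> \<in> pos" by (simp add: Inv_def)

lemma inv_prod_nonzero: "inv_prod w \<noteq> 0"
  unfolding inv_prod_def using lf_root_nonzero pos_roots_subset Inv_pos by (auto simp: zero_notin_roots)

lemma inv_prod_in: "inv_prod w \<in> S"
  unfolding inv_prod_def by (rule prod_lf_in)

lemma homogeneous_inv_prod: "w \<in> W \<Longrightarrow> homogeneous (len w) (inv_prod w)"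
  unfolding inv_prod_def using homogeneous_prod[OF finite_Inv homogeneous_lf] by (simp add: len_Inv)

text \<open>Each inversion of \<open>v\<close> labels an edge to a shorter vertex, where
  \<open>q\<close> vanishes, and hence divides the value at \<open>v\<close>.\<close>

lemma inv_prod_dvd:
  assumes "gkm q" "v \<in> W" "\<And>u. u \<in> W \<Longrightarrow> len u < len v \<Longrightarrow> q u = 0"
  shows "inv_prod v dvd q v"
  unfolding inv_prod_def
proof (rule prod_lf_dvd)
  fix \<beta> assume b: "\<beta> \<in> Inv v"
  then have \<beta>: "\<beta> \<in> pos" "inv' v \<beta> \<notin> pos" "\<beta> \<in> roots R" by (auto simp: Inv_def pos_roots_subset)
  have "q (s \<beta> \<circ> v) = 0"
    using assms(3) len_reflect_less[OF assms(2) \<beta>(1,2)] W_comp[OF W_s[OF \<beta>(3)] assms(2)] by blast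
  then show "lf \<beta> dvd q v" using gkm_dvd[OF assms(1,2) \<beta>(3)] by simp
qed (use Inv_pos gkm_in assms in auto)

text \<open>At a vertex of length greater than \<open>d\<close>, with zeros at all shorter vertices,
  the value has degree \<open>d\<close> but is divisible by more than \<open>d\<close> linear forms.
  Uniqueness of Schubert classes and the vanishing of divided differences rest on this.\<close>

lemma gkm_vanish:
  assumes "gkm q" "\<And>v. v \<in> W \<Longrightarrow> homogeneous d (q v)" "\<And>v. v \<in> W \<Longrightarrow> len v \<le> d \<Longrightarrow> q v = 0"
    and "v \<in> W"
  shows "q v = 0"
  using assms(4)
proof (induction "len v" arbitrary: v rule: less_induct)
  case less
  show ?case
  proof (cases "len v \<le> d")
    case False
    obtain k where k: "q v = inv_prod v * k" using inv_prod_dvd[OF assms(1) less.prems] less.hyps by (auto elim: dvdE)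
    then have "k = 0"
      using homogeneous_dvd_zero[of d "inv_prod v" k "len v"] assms(2)[OF less.prems]
        homogeneous_inv_prod[OF less.prems] inv_prod_nonzero False by simp
    then show ?thesis using k by simp
  qed (use assms(3) less.prems in auto)
qed

subsection \<open>Right and left divided differences\<close>

text \<open>By \<open>W_conj\<close>, the root \<open>v (a i)\<close> labels, up to sign, the edge
  between \<open>v\<close> and \<open>v \<circ> s (a i)\<close>. Dividing by this root itself, be it
  positive or negative, gives both ends of the edge the same quotient.\<close>

definition rdd :: "nat \<Rightarrow> (('v \<Rightarrow> 'v) \<Rightarrow> cpoly) \<Rightarrow> ('v \<Rightarrow> 'v) \<Rightarrow> cpoly" where
  "rdd i q v = quot (q (v \<circ> s (a i)) - q v) (lf (v (a i)))"

text \<open>The subtracted term is the left action of \<open>s (a i)\<close> on GKM functions. Left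
  multiplication permutes the edge labels, so the action must move the values along, hence
  \<open>act\<close>.\<close>

definition ldd :: "nat \<Rightarrow> (('v \<Rightarrow> 'v) \<Rightarrow> cpoly) \<Rightarrow> ('v \<Rightarrow> 'v) \<Rightarrow> cpoly" where
  "ldd i q v = quot (q v - act (s (a i)) (q (s (a i) \<circ> v))) (lf (a i))"

lemma Wa_root: "v \<in> W \<Longrightarrow> i \<in> Ix \<Longrightarrow> v (a i) \<in> roots R"
  by (simp add: W_roots a_root)

lemma rdd_mult:
  assumes "gkm q" "v \<in> W" "i \<in> Ix"
  shows "lf (v (a i)) * rdd i q v = q (v \<circ> s (a i)) - q v"
  unfolding rdd_def
proof (rule mult_quot)
  show "lf (v (a i)) \<noteq> 0" by (rule lf_root_nonzero[OF Wa_root[OF assms(2,3)]])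
  show "lf (v (a i)) dvd q (v \<circ> s (a i)) - q v"
    using gkm_dvd[OF assms(1,2) Wa_root[OF assms(2,3)]] W_conj[OF assms(2) a_root[OF assms(3)]]
    by metis
qed

lemma rdd_eqI:
  assumes "gkm q" "v \<in> W" "i \<in> Ix" "lf (v (a i)) * k = q (v \<circ> s (a i)) - q v"
  shows "rdd i q v = k"
  using rdd_mult[OF assms(1-3)] assms(4) lf_root_nonzero[OF Wa_root[OF assms(2,3)]]
  by (metis mult_cancel_left)

lemma rdd_in:
  assumes "gkm q" "v \<in> W" "i \<in> Ix"
  shows "rdd i q v \<in> S"
proof -
  have "v \<circ> s (a i) \<in> W" using assms right_flip(3) by blast
  then have "lf (v (a i)) * rdd i q v \<in> S"
    unfolding rdd_mult[OF assms] using polys_in_diff gkm_in[OF assms(1)] assms(2) by blast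
  then show ?thesis
    using polys_in_cofactor[OF lf_in lf_root_nonzero[OF Wa_root[OF assms(2,3)]]] by blast
qed

text \<open>If \<beta> labels the edge used in the division, the two values coincide. Otherwise
  \<beta> is prime to the denominator, and it suffices to test divisibility after multiplying by
  it.\<close>

lemma rdd_gkm:
  assumes q: "gkm q" and i: "i \<in> Ix"
  shows "gkm (rdd i q)"
  unfolding gkm_def
proof (intro conjI ballI)
  fix v assume v: "v \<in> W"
  show "rdd i q v \<in> S" by (rule rdd_in[OF q v i])
  fix \<beta> assume b: "\<beta> \<in> pos"
  then have \<beta>: "\<beta> \<in> roots R" by (rule pos_roots_subset)
  have sv: "s \<beta> \<circ> v \<in> W" using W_comp W_s \<beta> v by blast
  have vi: "v \<circ> s (a i) \<in> W" using W_comp W_s_simple i v by blast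
  define \<gamma> where "\<gamma> = v (a i)"
  have \<gamma>: "\<gamma> \<in> roots R" unfolding \<gamma>_def by (rule Wa_root[OF v i])
  show "lf \<beta> dvd rdd i q (s \<beta> \<circ> v) - rdd i q v"
  proof (cases "\<gamma> = \<beta> \<or> \<gamma> = - \<beta>")
    case True
    then have eq: "s \<beta> \<circ> v = v \<circ> s (a i)"
      using W_conj[OF v a_root[OF i]] s_uminus[OF \<beta>] unfolding \<gamma>_def by auto
    have "(v \<circ> s (a i)) (a i) = - v (a i)"
      using i v by (simp add: s_self a_root lmap_uminus[OF W_lmap])
    then have "rdd i q (v \<circ> s (a i)) = rdd i q v"
      using rdd_mult[OF q v i] right_flip(2)[OF v i] vi
      by (intro rdd_eqI[OF q vi i]) (simp add: lf_uminus)
    then show ?thesis by (simp add: eq)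
  next
    case False
    let ?x = "rdd i q v" and ?y = "rdd i q (s \<beta> \<circ> v)"
    \<comment> \<open>The denominators at the two vertices are \<gamma> and \<gamma> - c \<beta>,
      which agree modulo \<beta>.\<close>
    define c where "c = coroot R \<beta> \<gamma>"
    have "(s \<beta> \<circ> v) (a i) = \<gamma> - c \<cdot> \<beta>" by (simp add: \<gamma>_def c_def reflection_def)
    then have y: "(lf \<gamma> - const_poly c * lf \<beta>) * ?y = q (s \<beta> \<circ> (v \<circ> s (a i))) - q (s \<beta> \<circ> v)"
      using rdd_mult[OF q sv i] by (simp add: lf_diff lf_scale o_assoc)
    have x: "lf \<gamma> * ?x = q (v \<circ> s (a i)) - q v"
      using rdd_mult[OF q v i] by (simp add: \<gamma>_def)
    have "lf \<beta> dvd (q (s \<beta> \<circ> (v \<circ> s (a i))) - q (v \<circ> s (a i))) - (q (s \<beta> \<circ> v) - q v)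
        + const_poly c * lf \<beta> * ?y"
      by (rule dvd_add[OF dvd_diff[OF gkm_dvd[OF q vi \<beta>] gkm_dvd[OF q v \<beta>]]]) simp
    also have "\<dots> = lf \<gamma> * (?y - ?x)"
    proof -
      have "lf \<gamma> * ?y = q (s \<beta> \<circ> (v \<circ> s (a i))) - q (s \<beta> \<circ> v) + const_poly c * lf \<beta> * ?y"
        using y by (simp add: left_diff_distrib algebra_simps)
      then have "lf \<gamma> * (?y - ?x) = (q (s \<beta> \<circ> (v \<circ> s (a i))) - q (s \<beta> \<circ> v)
          + const_poly c * lf \<beta> * ?y) - (q (v \<circ> s (a i)) - q v)"
        unfolding right_diff_distrib x by (rule arg_cong)
      then show ?thesis by simp
    qed
    finally have "lf \<beta> dvd lf \<gamma> * (?y - ?x)" .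
    then have "lf \<beta> dvd lf \<gamma> \<or> lf \<beta> dvd ?y - ?x"
      by (rule lf_prime[OF \<beta> lf_in polys_in_diff[OF rdd_in[OF q sv i] rdd_in[OF q v i]]])
    then show ?thesis using lf_dvd_lf[OF \<beta> \<gamma>] False by auto
  qed
qed

lemma act_s_dvd: "f \<in> S \<Longrightarrow> \<beta> \<in> roots R \<Longrightarrow> lf \<beta> dvd f - act (s \<beta>) f"
  using act_cong_dvd[of f "lf \<beta>" id "s \<beta>"] act_id[of f]
  by (simp add: reflection_def lf_scale)

lemma ldd_mult:
  assumes "gkm q" "v \<in> W" "i \<in> Ix"
  shows "lf (a i) * ldd i q v = q v - act (s (a i)) (q (s (a i) \<circ> v))"
  unfolding ldd_def
proof (rule mult_quot)
  have ai: "a i \<in> roots R" by (rule a_root[OF assms(3)])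
  then show "lf (a i) \<noteq> 0" by (rule lf_root_nonzero)
  have sv: "s (a i) \<circ> v \<in> W" using W_comp W_s ai assms(2) by blast
  have "lf (a i) dvd (q (s (a i) \<circ> v) - act (s (a i)) (q (s (a i) \<circ> v))) - (q (s (a i) \<circ> v) - q v)"
    by (rule dvd_diff[OF act_s_dvd[OF gkm_in[OF assms(1) sv] ai] gkm_dvd[OF assms(1,2) ai]])
  then show "lf (a i) dvd q v - act (s (a i)) (q (s (a i) \<circ> v))" by simp
qed

lemma ldd_in:
  assumes "gkm q" "v \<in> W" "i \<in> Ix"
  shows "ldd i q v \<in> S"
proof -
  have "lf (a i) * ldd i q v \<in> S"
    unfolding ldd_mult[OF assms] by (rule polys_in_diff[OF gkm_in[OF assms(1,2)] act_in])
  then show ?thesis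
    using polys_in_cofactor[OF lf_in lf_root_nonzero[OF a_root[OF assms(3)]]] by blast
qed

text \<open>For \<beta> = \<open>a i\<close> the two values are exchanged by the action of
  \<open>s (a i)\<close>, and \<open>act_s_dvd\<close> applies. For another positive \<beta> the
  twisted term belongs to the edge of \<open>s (a i) \<beta>\<close>, whose label the action carries
  back to \<beta>, and \<open>a i\<close> is prime to \<beta>.\<close>

lemma ldd_gkm:
  assumes q: "gkm q" and i: "i \<in> Ix"
  shows "gkm (ldd i q)"
  unfolding gkm_def
proof (intro conjI ballI)
  fix v assume v: "v \<in> W"
  show "ldd i q v \<in> S" by (rule ldd_in[OF q v i])
  fix \<beta> assume b: "\<beta> \<in> pos"
  then have \<beta>: "\<beta> \<in> roots R" by (rule pos_roots_subset)
  have ai: "a i \<in> roots R" by (rule a_root[OF i])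
  let ?s = "s (a i)"
  have sv: "s \<beta> \<circ> v \<in> W" and iv: "?s \<circ> v \<in> W" using W_comp W_s \<beta> ai v by blast+
  show "lf \<beta> dvd ldd i q (s \<beta> \<circ> v) - ldd i q v"
  proof (cases "\<beta> = a i")
    case True
    have "lf (a i) * act ?s (ldd i q v) = - act ?s (lf (a i) * ldd i q v)"
      by (simp add: act_mult act_lf[OF lmap_s[OF ai]] s_self ai lf_uminus)
    also have "\<dots> = q (?s \<circ> v) - act ?s (q v)"
      unfolding ldd_mult[OF q v i]
      using gkm_in[OF q iv] by (simp add: act_diff act_act[OF lmap_s[OF ai]] s_comp_s ai act_id)
    also have "\<dots> = lf (a i) * ldd i q (?s \<circ> v)"
      using ldd_mult[OF q iv i] left_flip(2)[OF v i] by simp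
    finally have "ldd i q (?s \<circ> v) = act ?s (ldd i q v)"
      using lf_root_nonzero[OF ai] by simp
    moreover have "lf (a i) dvd ldd i q v - act ?s (ldd i q v)"
      by (rule act_s_dvd[OF ldd_in[OF q v i] ai])
    ultimately have "lf (a i) dvd ldd i q v - ldd i q (?s \<circ> v)" by metis
    then have "lf (a i) dvd - (ldd i q v - ldd i q (?s \<circ> v))" by (simp only: dvd_minus_iff)
    then show ?thesis using True by simp
  next
    case False
    let ?\<gamma> = "?s \<beta>"
    have \<gamma>: "?\<gamma> \<in> roots R" by (rule reflection_roots[OF ai \<beta>])
    have comm: "?s \<circ> (s \<beta> \<circ> v) = s ?\<gamma> \<circ> (?s \<circ> v)"
      using W_conj[OF W_s[OF ai] \<beta>] by (simp only: o_assoc)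
    have "act ?s (lf ?\<gamma>) dvd act ?s (q (s ?\<gamma> \<circ> (?s \<circ> v)) - q (?s \<circ> v))"
      by (rule act_dvd[OF gkm_dvd[OF q iv \<gamma>]])
    then have "lf \<beta> dvd act ?s (q (?s \<circ> (s \<beta> \<circ> v))) - act ?s (q (?s \<circ> v))"
      by (simp add: act_lf[OF lmap_s[OF ai]] s_invol ai comm act_diff)
    then have "lf \<beta> dvd (q (s \<beta> \<circ> v) - q v)
        - (act ?s (q (?s \<circ> (s \<beta> \<circ> v))) - act ?s (q (?s \<circ> v)))"
      by (rule dvd_diff[OF gkm_dvd[OF q v \<beta>]])
    also have "\<dots> = lf (a i) * (ldd i q (s \<beta> \<circ> v) - ldd i q v)"
      using ldd_mult[OF q sv i] ldd_mult[OF q v i] by (simp only: right_diff_distrib) simp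
    finally have "lf \<beta> dvd lf (a i) \<or> lf \<beta> dvd ldd i q (s \<beta> \<circ> v) - ldd i q v"
      by (rule lf_prime[OF \<beta> lf_in polys_in_diff[OF ldd_in[OF q sv i] ldd_in[OF q v i]]])
    then show ?thesis
      using lf_dvd_lf[OF \<beta> ai] False b uminus_notin_pos a_pos[OF i] by force
  qed
qed

subsection \<open>Equivariant Schubert classes\<close>

lemma gkm_rdd_hom:
  assumes q: "gkm q" and hom: "\<And>v. v \<in> W \<Longrightarrow> homogeneous d (q v)" and v: "v \<in> W" and i: "i \<in> Ix"
  shows "d = 0 \<Longrightarrow> rdd i q v = 0" "d > 0 \<Longrightarrow> homogeneous (d - 1) (rdd i q v)"
proof -
  have "homogeneous d (lf (v (a i)) * rdd i q v)"
    unfolding rdd_mult[OF q v i] using hom right_flip(3)[OF v i] v by (intro homogeneous_diff) auto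
  note * = this homogeneous_lf lf_root_nonzero[OF Wa_root[OF v i]]
  show "d = 0 \<Longrightarrow> rdd i q v = 0" using homogeneous_dvd_zero[OF *] by simp
  show "d > 0 \<Longrightarrow> homogeneous (d - 1) (rdd i q v)" using homogeneous_cofactor[OF *] by simp
qed

lemma gkm_ldd_hom:
  assumes q: "gkm q" and hom: "\<And>v. v \<in> W \<Longrightarrow> homogeneous d (q v)" and v: "v \<in> W" and i: "i \<in> Ix"
  shows "d = 0 \<Longrightarrow> ldd i q v = 0" "d > 0 \<Longrightarrow> homogeneous (d - 1) (ldd i q v)"
proof -
  have "homogeneous d (lf (a i) * ldd i q v)"
    unfolding ldd_mult[OF q v i] using hom left_flip(3)[OF v i] v
    by (intro homogeneous_diff homogeneous_act) auto
  note * = this homogeneous_lf lf_root_nonzero[OF a_root[OF i]]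
  show "d = 0 \<Longrightarrow> ldd i q v = 0" using homogeneous_dvd_zero[OF *] by simp
  show "d > 0 \<Longrightarrow> homogeneous (d - 1) (ldd i q v)" using homogeneous_cofactor[OF *] by simp
qed

lemma len_right_le: "w \<in> W \<Longrightarrow> i \<in> Ix \<Longrightarrow> len (w \<circ> s (a i)) \<le> Suc (len w)"
  using len_right[of w i] len_right_neg[of w i] by linarith

lemma len_left_le: "w \<in> W \<Longrightarrow> i \<in> Ix \<Longrightarrow> len (s (a i) \<circ> w) \<le> Suc (len w)"
  using len_left[of w i] len_left_neg[of w i] by linarith

text \<open>Instead of prescribing the support, it is enough to prescribe the zeros up to the length of
  \<open>w\<close>; this weaker condition is stable under divided differences for trivial reasons.\<close>

definition schubert :: "('v \<Rightarrow> 'v) \<Rightarrow> (('v \<Rightarrow> 'v) \<Rightarrow> cpoly) \<Rightarrow> bool" where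
  "schubert w q \<longleftrightarrow> gkm q \<and> (\<forall>v\<in>W. homogeneous (len w) (q v)) \<and>
     (\<forall>v\<in>W. len v \<le> len w \<longrightarrow> v \<noteq> w \<longrightarrow> q v = 0) \<and> q w = inv_prod w"

lemma schubert_unique:
  assumes "schubert w q" "schubert w q'" "v \<in> W"
  shows "q v = q' v"
proof -
  have "q v - q' v = 0"
  proof (rule gkm_vanish[where d = "len w" and q = "\<lambda>v. q v - q' v"])
    show "gkm (\<lambda>v. q v - q' v)" using assms by (intro gkm_diff) (auto simp: schubert_def)
    show "homogeneous (len w) (q u - q' u)" if "u \<in> W" for u
      using assms that by (auto simp: schubert_def intro: homogeneous_diff)
    show "q u - q' u = 0" if "u \<in> W" "len u \<le> len w" for u
      using assms that by (cases "u = w") (auto simp: schubert_def)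
  qed (rule assms)
  then show ?thesis by simp
qed

lemma all_descents_Inv:
  assumes w: "w \<in> W" "\<And>i. i \<in> Ix \<Longrightarrow> w (a i) \<notin> pos"
  shows "Inv w = pos"
proof -
  have "inv' w \<beta> \<notin> pos" if \<beta>: "\<beta> \<in> pos" for \<beta>
  proof
    assume g: "inv' w \<beta> \<in> pos"
    define \<gamma> where "\<gamma> = inv' w \<beta>"
    have "- w \<gamma> \<in> pos"
    proof (rule maps_span_pos[of "\<lambda>x. - w x"])
      show "lmap (\<lambda>x. - w x)" using W_lmap[OF w(1)] by (simp add: lmap_def)
      show "- w \<gamma> \<in> roots R"
        using g w(1) W_roots uminus_roots pos_roots_subset unfolding \<gamma>_def by blast
      show "- w (a i) \<in> pos" if "i \<in> Ix" for i
        using w(2)[OF that] Wa_root[OF w(1) that] pos_or_neg by blast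
    qed (use g in \<open>simp add: \<gamma>_def\<close>)
    moreover have "w \<gamma> = \<beta>" using w(1) by (simp add: \<gamma>_def)
    ultimately show False using \<beta> uminus_notin_pos by auto
  qed
  then show ?thesis by (auto simp: Inv_def)
qed

text \<open>The class of a point, the seed of the construction: any edge label divides the product
  of all positive roots, so a function supported at one vertex passes the GKM test. Since every
  simple root is a descent of \<open>w\<close>, this product is also
  \<open>inv_prod w\<close>.\<close>

lemma schubert_top:
  assumes w: "w \<in> W" "\<And>i. i \<in> Ix \<Longrightarrow> w (a i) \<notin> pos"
  shows "schubert w (\<lambda>v. if v = w then \<Prod>\<beta>\<in>pos. lf \<beta> else 0)"
proof -
  have Inv: "Inv w = pos" by (rule all_descents_Inv[OF w])
  have "lf \<beta> dvd (\<Prod>\<beta>\<in>pos. lf \<beta>)" if "\<beta> \<in> pos" for \<beta>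
    using dvd_prodI[OF finite_pos that, of lf] .
  then have "gkm (\<lambda>v. if v = w then \<Prod>\<beta>\<in>pos. lf \<beta> else 0)"
    by (auto simp: gkm_def prod_lf_in)
  moreover have "homogeneous (len w) (\<Prod>\<beta>\<in>pos. lf \<beta>)"
    using homogeneous_inv_prod[OF w(1)] by (simp add: inv_prod_def Inv)
  ultimately show ?thesis by (auto simp: schubert_def inv_prod_def Inv)
qed

lemma schubert_dd_zero:
  assumes "schubert w q" "u \<in> W" "len u \<le> Suc (len v)" "u \<noteq> w" "v \<in> W" "len v < len w"
    and "q v = 0 \<Longrightarrow> q u = 0 \<Longrightarrow> x = (0::cpoly)"
  shows "x = 0"
  using assms by (auto simp: schubert_def)

text \<open>Here \<open>t\<close> stands for the left or right multiplication by a simple reflection, and \<open>q'\<close> for the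
  corresponding divided difference.\<close>

lemma schubert_dd_up:
  assumes q: "schubert w q" and q': "gkm q'"
    and hom: "\<And>v. v \<in> W \<Longrightarrow> len w = 0 \<Longrightarrow> q' v = 0"
      "\<And>v. v \<in> W \<Longrightarrow> len w > 0 \<Longrightarrow> homogeneous (len w - 1) (q' v)"
    and t: "\<And>v. v \<in> W \<Longrightarrow> t v \<in> W" "\<And>v. v \<in> W \<Longrightarrow> len (t v) \<le> Suc (len v)"
      "\<And>v. v \<in> W \<Longrightarrow> t (t v) = v" "len w < len (t w)"
    and zero: "\<And>v. v \<in> W \<Longrightarrow> q v = 0 \<Longrightarrow> q (t v) = 0 \<Longrightarrow> q' v = 0"
    and v: "v \<in> W"
  shows "q' v = 0"
proof (cases "len w = 0")
  case False
  have "q' u = 0" if u: "u \<in> W" "len u \<le> len w - 1" for u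
  proof (rule schubert_dd_zero[OF q t(1,2)[OF u(1)]])
    show "t u \<noteq> w" using t(3)[OF u(1)] t(4) u(2) False by auto
  qed (use u False zero in auto)
  then show ?thesis using gkm_vanish[OF q' hom(2) _ v] False by blast
qed (use hom v in simp)

text \<open>At the new vertex \<open>?u\<close> the old class vanishes, and dividing its value
  \<open>inv_prod w\<close> at \<open>w\<close> by the one inversion that \<open>w\<close> has in
  addition leaves \<open>inv_prod ?u\<close>.\<close>

lemma schubert_rdd_down:
  assumes q: "schubert w q" and w: "w \<in> W" and i: "i \<in> Ix" and down: "w (a i) \<notin> pos"
  shows "schubert (w \<circ> s (a i)) (rdd i q)"
proof -
  have g: "gkm q" and hom: "\<And>v. v \<in> W \<Longrightarrow> homogeneous (len w) (q v)" using q by (auto simp: schubert_def)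
  let ?u = "w \<circ> s (a i)"
  have l: "len w = Suc (len ?u)" by (rule len_right_neg[OF w i down])
  have u: "?u \<in> W" "?u (a i) \<in> pos" "?u \<circ> s (a i) = w" using right_flip[OF w i] down by auto
  have zero: "rdd i q v = 0" if v: "v \<in> W" "len v \<le> len ?u" "v \<noteq> ?u" for v
  proof (rule schubert_dd_zero[OF q right_flip(3)[OF v(1) i] len_right_le[OF v(1) i]])
    show "v \<circ> s (a i) \<noteq> w" using right_flip(2)[OF v(1) i] v(3) by auto
    show "rdd i q v = 0" if "q v = 0" "q (v \<circ> s (a i)) = 0"
      using that by (intro rdd_eqI[OF g v(1) i]) simp
  qed (use v l in auto)
  have "q ?u = 0" using q u(1) l by (auto simp: schubert_def)
  moreover have "Inv w = insert (?u (a i)) (Inv ?u)" "?u (a i) \<notin> Inv ?u"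
    using Inv_right[of ?u i, OF u(1) i u(2)] unfolding u(3) .
  ultimately have "rdd i q ?u = inv_prod ?u"
    using q by (intro rdd_eqI[OF g u(1) i]) (simp add: u(3) schubert_def inv_prod_def)
  then show ?thesis
    using zero rdd_gkm[OF g i] gkm_rdd_hom(2)[OF g hom _ i] l by (simp add: schubert_def)
qed

lemma schubert_rdd_up:
  assumes q: "schubert w q" and w: "w \<in> W" and i: "i \<in> Ix" and up: "w (a i) \<in> pos" and v: "v \<in> W"
  shows "rdd i q v = 0"
proof -
  have g: "gkm q" and hom: "\<And>v. v \<in> W \<Longrightarrow> homogeneous (len w) (q v)" using q by (auto simp: schubert_def)
  show ?thesis
  proof (rule schubert_dd_up[where t = "\<lambda>v. v \<circ> s (a i)", OF q rdd_gkm[OF g i] _ _ _ _ _ _ _ v])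
    show "rdd i q u = 0" if "u \<in> W" "len w = 0" for u
      using gkm_rdd_hom(1)[OF g hom that(1) i that(2)] by simp
    show "homogeneous (len w - 1) (rdd i q u)" if "u \<in> W" "len w > 0" for u
      using gkm_rdd_hom(2)[OF g hom that(1) i that(2)] by simp
    show "rdd i q u = 0" if "u \<in> W" "q u = 0" "q (u \<circ> s (a i)) = 0" for u
      using that by (intro rdd_eqI[OF g that(1) i]) simp
    show "len w < len (w \<circ> s (a i))" using len_right[OF w i up] by simp
  qed (use right_flip(2,3)[OF _ i] len_right_le[OF _ i] in blast)+
qed

lemma ldd_eqI:
  assumes "gkm q" "v \<in> W" "i \<in> Ix" "lf (a i) * k = q v - act (s (a i)) (q (s (a i) \<circ> v))"
  shows "ldd i q v = k"
  using ldd_mult[OF assms(1-3)] assms(4) lf_root_nonzero[OF a_root[OF assms(3)]]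
  by (metis mult_cancel_left)

lemma schubert_ldd_down:
  assumes q: "schubert w q" and w: "w \<in> W" and i: "i \<in> Ix" and down: "inv' w (a i) \<notin> pos"
  shows "schubert (s (a i) \<circ> w) (ldd i q)"
proof -
  have g: "gkm q" and hom: "\<And>v. v \<in> W \<Longrightarrow> homogeneous (len w) (q v)" using q by (auto simp: schubert_def)
  let ?u = "s (a i) \<circ> w"
  have ai: "a i \<in> roots R" by (rule a_root[OF i])
  have l: "len w = Suc (len ?u)" by (rule len_left_neg[OF w i down])
  have u: "?u \<in> W" "inv' ?u (a i) \<in> pos" "s (a i) \<circ> ?u = w" using left_flip[OF w i] down by auto
  have zero: "ldd i q v = 0" if v: "v \<in> W" "len v \<le> len ?u" "v \<noteq> ?u" for v
  proof (rule schubert_dd_zero[OF q left_flip(3)[OF v(1) i] len_left_le[OF v(1) i]])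
    show "s (a i) \<circ> v \<noteq> w" using left_flip(2)[OF v(1) i] v(3) by auto
    show "ldd i q v = 0" if "q v = 0" "q (s (a i) \<circ> v) = 0"
      using that by (intro ldd_eqI[OF g v(1) i]) simp
  qed (use v l in auto)
  have "q ?u = 0" using q u(1) l by (auto simp: schubert_def)
  \<comment> \<open>\<open>s (a i)\<close> moves the inversions of \<open>w\<close> other than
    \<open>a i\<close> back to those of \<open>?u\<close> and negates \<open>a i\<close>; this sign
    cancels the minus sign in \<open>ldd\<close>.\<close>
  moreover have "act (s (a i)) (inv_prod w) = - (lf (a i) * inv_prod ?u)"
  proof -
    have I: "Inv w = insert (a i) (s (a i) ` Inv ?u)" "a i \<notin> s (a i) ` Inv ?u"
      using Inv_left[OF u(1) i u(2)] u(3) by auto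
    have inj: "inj_on (s (a i)) (Inv ?u)"
      using bij_s[OF ai] by (meson bij_is_inj inj_on_subset subset_UNIV)
    show ?thesis
      using I(2) by (simp add: inv_prod_def I(1) prod.reindex[OF inj] act_mult act_prod
          act_lf[OF lmap_s[OF ai]] s_self s_invol ai lf_uminus)
  qed
  ultimately have "ldd i q ?u = inv_prod ?u"
    using q by (intro ldd_eqI[OF g u(1) i]) (simp add: u(3) schubert_def)
  then show ?thesis
    using zero ldd_gkm[OF g i] gkm_ldd_hom(2)[OF g hom _ i] l by (simp add: schubert_def)
qed

lemma schubert_ldd_up:
  assumes q: "schubert w q" and w: "w \<in> W" and i: "i \<in> Ix" and up: "inv' w (a i) \<in> pos" and v: "v \<in> W"
  shows "ldd i q v = 0"
proof -
  have g: "gkm q" and hom: "\<And>v. v \<in> W \<Longrightarrow> homogeneous (len w) (q v)" using q by (auto simp: schubert_def)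
  show ?thesis
  proof (rule schubert_dd_up[where t = "\<lambda>v. s (a i) \<circ> v", OF q ldd_gkm[OF g i] _ _ _ _ _ _ _ v])
    show "ldd i q u = 0" if "u \<in> W" "len w = 0" for u
      using gkm_ldd_hom(1)[OF g hom that(1) i that(2)] by simp
    show "homogeneous (len w - 1) (ldd i q u)" if "u \<in> W" "len w > 0" for u
      using gkm_ldd_hom(2)[OF g hom that(1) i that(2)] by simp
    show "ldd i q u = 0" if "u \<in> W" "q u = 0" "q (s (a i) \<circ> u) = 0" for u
      using that by (intro ldd_eqI[OF g that(1) i]) simp
    show "len w < len (s (a i) \<circ> w)" using len_left[OF w i up] by simp
  qed (use left_flip(2,3)[OF _ i] len_left_le[OF _ i] in blast)+
qed

text \<open>Descends in length: if \<open>w\<close> has an ascent \<open>i\<close>, a class for the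
  longer \<open>w \<circ> s (a i)\<close> yields one for \<open>w\<close>; an element without
  ascents is covered by \<open>schubert_top\<close>.\<close>

lemma schubert_exists: "w \<in> W \<Longrightarrow> \<exists>q. schubert w q"
proof (induction "card pos - len w" arbitrary: w rule: less_induct)
  case less
  show ?case
  proof (cases "\<exists>i\<in>Ix. w (a i) \<in> pos")
    case True
    then obtain i where i: "i \<in> Ix" "w (a i) \<in> pos" by blast
    let ?v = "w \<circ> s (a i)"
    have v: "?v \<in> W" "?v \<circ> s (a i) = w" "?v (a i) \<notin> pos" using right_flip[OF less.prems i(1)] i(2) by auto
    have "card pos - len ?v < card pos - len w"
      using len_right[OF less.prems i] len_le_card_pos[OF v(1)] by linarith
    then obtain q where "schubert ?v q" using less.hyps v(1) by blast
    then show ?thesis using schubert_rdd_down[of ?v q i] v i(1) by metis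
  next
    case False
    then show ?thesis using schubert_top[OF less.prems] by blast
  qed
qed

text \<open>\<open>schubert_unique\<close> determines the values on \<open>W\<close> only.
  Statements about \<open>P\<close> therefore restrict the argument to \<open>W\<close>, and
  \<open>cf_cong\<close> makes coefficients insensitive to all other values.\<close>

definition P :: "('v \<Rightarrow> 'v) \<Rightarrow> ('v \<Rightarrow> 'v) \<Rightarrow> cpoly" where
  "P w = (SOME q. schubert w q)"

lemma P_schubert: "w \<in> W \<Longrightarrow> schubert w (P w)"
  unfolding P_def by (rule someI_ex[OF schubert_exists])

lemma P_gkm: "w \<in> W \<Longrightarrow> gkm (P w)"
  and P_hom: "w \<in> W \<Longrightarrow> v \<in> W \<Longrightarrow> homogeneous (len w) (P w v)"
  and P_zero: "w \<in> W \<Longrightarrow> v \<in> W \<Longrightarrow> len v \<le> len w \<Longrightarrow> v \<noteq> w \<Longrightarrow> P w v = 0"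
  and P_self: "w \<in> W \<Longrightarrow> P w w = inv_prod w"
  using P_schubert by (auto simp: schubert_def)

lemma P_eqI: "schubert w q \<Longrightarrow> w \<in> W \<Longrightarrow> v \<in> W \<Longrightarrow> q v = P w v"
  using schubert_unique P_schubert by blast

lemma P_id: "v \<in> W \<Longrightarrow> P id v = 1"
proof -
  assume v: "v \<in> W"
  have "schubert id (\<lambda>v. 1)"
    using len_0_imp_id by (auto simp: schubert_def gkm_const inv_prod_def)
  then show ?thesis using P_eqI[OF _ W_id v] by metis
qed

lemma rdd_P:
  assumes "w \<in> W" "i \<in> Ix" "v \<in> W"
  shows "rdd i (P w) v = (if w (a i) \<in> pos then 0 else P (w \<circ> s (a i)) v)"
proof (cases "w (a i) \<in> pos")
  case True
  then show ?thesis using schubert_rdd_up[OF P_schubert] assms by simp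
next
  case False
  then have "schubert (w \<circ> s (a i)) (rdd i (P w))"
    using schubert_rdd_down[OF P_schubert] assms by blast
  then show ?thesis using P_eqI right_flip(3)[OF assms(1,2)] assms(3) False by simp
qed

lemma ldd_P:
  assumes "w \<in> W" "i \<in> Ix" "v \<in> W"
  shows "ldd i (P w) v = (if inv' w (a i) \<in> pos then 0 else P (s (a i) \<circ> w) v)"
proof (cases "inv' w (a i) \<in> pos")
  case True
  then show ?thesis using schubert_ldd_up[OF P_schubert] assms by simp
next
  case False
  then have "schubert (s (a i) \<circ> w) (ldd i (P w))"
    using schubert_ldd_down[OF P_schubert] assms by blast
  then show ?thesis using P_eqI left_flip(3)[OF assms(1,2)] assms(3) False by simp
qed

text \<open>For a right descent \<open>i\<close> of \<open>v\<close>, with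
  \<open>?u = v \<circ> s (a i)\<close>, the value at \<open>v\<close> is \<open>P w ?u\<close> plus
  the positive root \<open>?u (a i)\<close> times 0 or a value of another class at
  \<open>?u\<close>. So values stay nonnegative, nothing cancels, and the support follows the
  recursion of \<open>bruhat_lifting\<close>.\<close>

lemma P_nonneg_support:
  assumes "w \<in> W" "v \<in> W"
  shows "nonneg_poly (P w v) \<and> (P w v \<noteq> 0 \<longleftrightarrow> bruhat_le R w v)"
  using assms(2,1)
proof (induction "len v" arbitrary: v w rule: less_induct)
  case less
  show ?case
  proof (cases "v = id")
    case True
    have "P w id = (if w = id then 1 else 0)"
      using P_zero[OF less.prems(2) W_id] P_id[OF W_id] by auto
    then show ?thesis
      using True bruhat_id_right[OF less.prems(2)] by (simp add: nonneg_poly_0 nonneg_poly_1)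
  next
    case False
    obtain i where i: "i \<in> Ix" "v (a i) \<notin> pos" using right_descent[OF less.prems(1) False] by blast
    let ?u = "v \<circ> s (a i)"
    have u: "?u \<in> W" "?u (a i) \<in> pos" "?u \<circ> s (a i) = v" using right_flip[OF less.prems(1) i(1)] i(2) by auto
    have lu: "len ?u < len v" using len_right_neg[OF less.prems(1) i] by simp
    have IH: "nonneg_poly (P x ?u) \<and> (P x ?u \<noteq> 0 \<longleftrightarrow> bruhat_le R x ?u)" if "x \<in> W" for x
      using less.hyps[OF lu u(1) that] .
    let ?D = "if w (a i) \<in> pos then 0 else P (w \<circ> s (a i)) ?u"
    have ws: "w \<circ> s (a i) \<in> W" by (rule right_flip(3)[OF less.prems(2) i(1)])
    have eq: "P w v = P w ?u + lf (?u (a i)) * ?D"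
      using rdd_mult[OF P_gkm[OF less.prems(2)] u(1) i(1)] rdd_P[OF less.prems(2) i(1) u(1)] u(3)
      by (simp add: algebra_simps)
    have nn: "nonneg_poly (P w ?u)" "nonneg_poly (lf (?u (a i)) * ?D)"
      using IH[OF less.prems(2)] IH[OF ws] nonneg_poly_lf[OF u(2)] nonneg_poly_0
      by (auto intro: nonneg_poly_mult)
    have "P w v = 0 \<longleftrightarrow> P w ?u = 0 \<and> ?D = 0"
      unfolding eq nonneg_poly_add_eq_0_iff[OF nn]
      using lf_root_nonzero[OF Wa_root[OF u(1) i(1)]] by auto
    moreover have "P w ?u = 0 \<longleftrightarrow> \<not> bruhat_le R w ?u" using IH[OF less.prems(2)] by blast
    moreover have "?D = 0 \<longleftrightarrow> w (a i) \<in> pos \<or> \<not> bruhat_le R (w \<circ> s (a i)) ?u" using IH[OF ws] by auto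
    moreover have "bruhat_le R w v \<longleftrightarrow>
        bruhat_le R w ?u \<or> (w (a i) \<notin> pos \<and> bruhat_le R (w \<circ> s (a i)) ?u)"
      using bruhat_lifting[of ?u i w, OF u(1) i(1) u(2) less.prems(2)] unfolding u(3) .
    ultimately have "P w v \<noteq> 0 \<longleftrightarrow> bruhat_le R w v" by blast
    moreover have "nonneg_poly (P w v)" unfolding eq by (rule nonneg_poly_add[OF nn])
    ultimately show ?thesis by blast
  qed
qed

subsection \<open>Expansion in Schubert classes\<close>

lemma P_independent:
  assumes c: "\<And>v. v \<in> W \<Longrightarrow> (\<Sum>w\<in>W. c w * P w v) = 0" and w: "w \<in> W"
  shows "c w = 0"
  using w
proof (induction "len w" arbitrary: w rule: less_induct)
  case less
  have "(\<Sum>u\<in>W. c u * P u w) = (\<Sum>u\<in>W. if u = w then c w * inv_prod w else 0)"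
  proof (rule sum.cong)
    fix u assume u: "u \<in> W"
    show "c u * P u w = (if u = w then c w * inv_prod w else 0)"
    proof (cases "u = w")
      case True
      then show ?thesis by (simp add: P_self less.prems)
    next
      case False
      then show ?thesis
        using less.hyps[OF _ u] P_zero[OF u less.prems] by (cases "len u < len w") auto
    qed
  qed simp
  then show ?case using c[OF less.prems] less.prems finite_W inv_prod_nonzero by simp
qed

text \<open>If \<open>q\<close> vanishes below length \<open>k\<close>, its values at length
  \<open>k\<close> are multiples of \<open>inv_prod\<close>, that is, of the leading values of the
  \<open>P w\<close>. Subtracting these multiples raises \<open>k\<close>, and lengths are bounded
  by the number of positive roots.\<close>

lemma P_expansion:
  assumes "gkm q"
  shows "\<exists>c. (\<forall>w\<in>W. c w \<in> S) \<and> (\<forall>v\<in>W. q v = (\<Sum>w\<in>W. c w * P w v))"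
proof -
  have "\<exists>c. (\<forall>w\<in>W. c w \<in> S) \<and> (\<forall>v\<in>W. q v = (\<Sum>w\<in>W. c w * P w v))"
    if "gkm q" "\<And>v. v \<in> W \<Longrightarrow> len v < k \<Longrightarrow> q v = 0" for k q
    using that
  proof (induction "Suc (card pos) - k" arbitrary: k q rule: less_induct)
    case less
    show ?case
    proof (cases "card pos < k")
      case True
      have "q v = 0" if v: "v \<in> W" for v
        using less.prems(2)[OF v] len_le_card_pos[OF v] True by simp
      then show ?thesis by (intro exI[of _ "\<lambda>_. 0"]) auto
    next
      case False
      define L where "L = {w \<in> W. len w = k}"
      have L: "finite L" "L \<subseteq> W" using finite_W by (auto simp: L_def)
      have "\<exists>c\<in>S. q w = inv_prod w * c" if "w \<in> L" for w
      proof -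
        have w: "w \<in> W" "len w = k" using that by (auto simp: L_def)
        have "inv_prod w dvd q w" using inv_prod_dvd[OF less.prems(1) w(1)] less.prems(2) w(2) by simp
        then show ?thesis
          using polys_in_dvdE[OF _ inv_prod_in inv_prod_nonzero gkm_in[OF less.prems(1) w(1)]] by metis
      qed
      then obtain b where b: "\<And>w. w \<in> L \<Longrightarrow> b w \<in> S" "\<And>w. w \<in> L \<Longrightarrow> q w = inv_prod w * b w"
        by metis
      have lt: "Suc (card pos) - Suc k < Suc (card pos) - k" using False by linarith
      define q' where "q' v = q v - (\<Sum>w\<in>L. b w * P w v)" for v
      have "gkm q'"
        unfolding q'_def using b L P_gkm less.prems(1)
        by (intro gkm_diff gkm_sum gkm_mult gkm_const) auto
      moreover have "q' v = 0" if v: "v \<in> W" "len v < Suc k" for v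
      proof (cases "v \<in> L")
        case True
        have "(\<Sum>w\<in>L. b w * P w v) = (\<Sum>w\<in>L. if w = v then b v * inv_prod v else 0)"
          using v L by (intro sum.cong refl) (auto simp: P_self L_def intro!: P_zero)
        then show ?thesis using True L b(2) by (simp add: q'_def)
      next
        case False
        then have "len v < k" using v by (auto simp: L_def)
        then have "(\<Sum>w\<in>L. b w * P w v) = 0"
          using v L by (intro sum.neutral) (auto simp: L_def intro!: P_zero)
        then show ?thesis using less.prems(2)[OF v(1) \<open>len v < k\<close>] by (simp add: q'_def)
      qed
      ultimately obtain c where c: "\<forall>w\<in>W. c w \<in> S" "\<forall>v\<in>W. q' v = (\<Sum>w\<in>W. c w * P w v)"
        using less.hyps[OF lt, of q'] by blast
      define d where "d w = c w + (if w \<in> L then b w else 0)" for w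
      have "q v = (\<Sum>w\<in>W. d w * P w v)" if "v \<in> W" for v
      proof -
        have "(\<Sum>w\<in>L. b w * P w v) = (\<Sum>w\<in>W. (if w \<in> L then b w else 0) * P w v)"
          using L finite_W by (intro sum.mono_neutral_cong_left) auto
        then show ?thesis
          using c(2) that unfolding q'_def d_def by (simp add: distrib_right sum.distrib diff_eq_eq)
      qed
      moreover have "d w \<in> S" if "w \<in> W" for w
        using that c(1) b(1) by (auto simp: d_def intro!: polys_in_add)
      ultimately show ?thesis by blast
    qed
  qed
  from this[of q 0] show ?thesis using assms by simp
qed

definition cf :: "(('v \<Rightarrow> 'v) \<Rightarrow> cpoly) \<Rightarrow> ('v \<Rightarrow> 'v) \<Rightarrow> cpoly" where
  "cf q = (SOME c. (\<forall>w\<in>W. c w \<in> S) \<and> (\<forall>v\<in>W. q v = (\<Sum>w\<in>W. c w * P w v)))"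

lemma cf:
  assumes "gkm q"
  shows "w \<in> W \<Longrightarrow> cf q w \<in> S" "v \<in> W \<Longrightarrow> q v = (\<Sum>w\<in>W. cf q w * P w v)"
  using someI_ex[OF P_expansion[OF assms]] by (auto simp: cf_def)

lemma cf_eqI:
  assumes "gkm q" "\<And>v. v \<in> W \<Longrightarrow> q v = (\<Sum>w\<in>W. c w * P w v)" "w \<in> W"
  shows "cf q w = c w"
proof -
  have "cf q w - c w = 0"
  proof (rule P_independent[OF _ assms(3)])
    fix v assume v: "v \<in> W"
    show "(\<Sum>w\<in>W. (cf q w - c w) * P w v) = 0"
      using cf(2)[OF assms(1) v] assms(2)[OF v] by (simp add: left_diff_distrib sum_subtractf)
  qed
  then show ?thesis by simp
qed

lemma cf_cong: "gkm q \<Longrightarrow> (\<And>v. v \<in> W \<Longrightarrow> q' v = q v) \<Longrightarrow> w \<in> W \<Longrightarrow> cf q' w = cf q w"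
  using cf_eqI[of q' "cf q" w] gkm_cong[of q q'] cf(2)[of q] by simp

lemma cf_add: "gkm q \<Longrightarrow> gkm q' \<Longrightarrow> w \<in> W \<Longrightarrow> cf (\<lambda>v. q v + q' v) w = cf q w + cf q' w"
  by (rule cf_eqI) (auto simp: gkm_add cf(2)[of q] cf(2)[of q'] distrib_right sum.distrib)

lemma cf_diff: "gkm q \<Longrightarrow> gkm q' \<Longrightarrow> w \<in> W \<Longrightarrow> cf (\<lambda>v. q v - q' v) w = cf q w - cf q' w"
  by (rule cf_eqI) (auto simp: gkm_diff cf(2)[of q] cf(2)[of q'] left_diff_distrib sum_subtractf)

lemma cf_mult: "gkm q \<Longrightarrow> f \<in> S \<Longrightarrow> w \<in> W \<Longrightarrow> cf (\<lambda>v. f * q v) w = f * cf q w"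
  by (rule cf_eqI) (auto simp: gkm_mult gkm_const cf(2)[of q] sum_distrib_left mult.assoc)

lemma cf_0: "w \<in> W \<Longrightarrow> cf (\<lambda>v. 0) w = 0"
  by (rule cf_eqI) (auto simp: gkm_const)

lemma cf_sum:
  assumes "\<And>x. x \<in> A \<Longrightarrow> gkm (q x)" "w \<in> W"
  shows "cf (\<lambda>v. \<Sum>x\<in>A. q x v) w = (\<Sum>x\<in>A. cf (q x) w)"
  using assms
  by (induction A rule: infinite_finite_induct) (auto simp: cf_0 cf_add gkm_sum)

lemma cf_P: "u \<in> W \<Longrightarrow> w \<in> W \<Longrightarrow> cf (P u) w = (if w = u then 1 else 0)"
  by (rule cf_eqI) (auto simp: P_gkm finite_W if_distrib[of "\<lambda>x. x * _"] cong: if_cong)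

lemma cf_id: "gkm q \<Longrightarrow> cf q id = q id"
proof -
  assume q: "gkm q"
  have "q id = (\<Sum>w\<in>W. if w = id then cf q id else 0)"
    unfolding cf(2)[OF q W_id]
    by (intro sum.cong) (auto simp: P_id W_id intro!: P_zero)
  then show ?thesis using finite_W W_id by simp
qed

text \<open>Only \<open>q\<close> is expanded: linearity over \<open>S\<close> leaves its
  coefficients as factors, and their constant terms vanish. So the functions whose coefficients have
  no constant terms form an ideal.\<close>

lemma eval0_cf_mult_null:
  assumes "gkm q" "gkm r" "\<And>w. w \<in> W \<Longrightarrow> eval0 (cf q w) = 0" "x \<in> W"
  shows "eval0 (cf (\<lambda>v. q v * r v) x) = 0"
proof -
  have *: "gkm (\<lambda>v. cf q w * (P w v * r v))" "gkm (\<lambda>v. P w v * r v)" if "w \<in> W" for w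
    using that cf(1)[OF assms(1)] assms(2) P_gkm by (auto intro!: gkm_mult gkm_const)
  have "cf (\<lambda>v. q v * r v) x = cf (\<lambda>v. \<Sum>w\<in>W. cf q w * (P w v * r v)) x"
    using cf(2)[OF assms(1)] assms(4)
    by (intro cf_cong gkm_sum *) (auto simp: sum_distrib_right mult.assoc)
  also have "\<dots> = (\<Sum>w\<in>W. cf q w * cf (\<lambda>v. P w v * r v) x)"
    unfolding cf_sum[of W "\<lambda>w v. cf q w * (P w v * r v)", OF *(1) assms(4), simplified]
    by (intro sum.cong refl cf_mult *(2) cf(1)[OF assms(1)] assms(4))
  finally show ?thesis using assms(3) by (simp add: eval0_sum eval0_mult)
qed

lemma rdd_add_mult:
  assumes "\<And>w. w \<in> A \<Longrightarrow> gkm (q w)" "\<And>w. w \<in> A \<Longrightarrow> c w \<in> S" "v \<in> W" "i \<in> Ix"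
  shows "rdd i (\<lambda>v. \<Sum>w\<in>A. c w * q w v) v = (\<Sum>w\<in>A. c w * rdd i (q w) v)"
proof (rule rdd_eqI)
  show "gkm (\<lambda>v. \<Sum>w\<in>A. c w * q w v)" using assms by (intro gkm_sum gkm_mult gkm_const) auto
  have "lf (v (a i)) * (c w * rdd i (q w) v) = c w * q w (v \<circ> s (a i)) - c w * q w v" if "w \<in> A" for w
    using rdd_mult[OF assms(1)[OF that] assms(3,4)] by (metis mult.left_commute right_diff_distrib)
  then show "lf (v (a i)) * (\<Sum>w\<in>A. c w * rdd i (q w) v)
      = (\<Sum>w\<in>A. c w * q w (v \<circ> s (a i))) - (\<Sum>w\<in>A. c w * q w v)"
    by (simp add: sum_distrib_left sum_subtractf)
qed (rule assms)+

lemma rdd_cong: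
  "(\<And>v. v \<in> W \<Longrightarrow> q v = q' v) \<Longrightarrow> i \<in> Ix \<Longrightarrow> v \<in> W \<Longrightarrow> rdd i q v = rdd i q' v"
  using right_flip(3)[of v i] by (simp add: rdd_def)

text \<open>\<open>rdd i\<close> is linear over \<open>S\<close> and lowers the index of each
  \<open>P w\<close> at a descent. On coefficients this reads as a shift in the opposite
  direction.\<close>

lemma cf_rdd:
  assumes q: "gkm q" and i: "i \<in> Ix" and w: "w \<in> W"
  shows "cf (rdd i q) w = (if w (a i) \<in> pos then cf q (w \<circ> s (a i)) else 0)"
proof (rule cf_eqI[OF rdd_gkm[OF q i] _ w])
  fix v assume v: "v \<in> W"
  have "rdd i q v = rdd i (\<lambda>v. \<Sum>w\<in>W. cf q w * P w v) v"
    using cf(2)[OF q] i v by (intro rdd_cong) auto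
  also have "\<dots> = (\<Sum>w\<in>W. cf q w * rdd i (P w) v)"
    using cf(1)[OF q] P_gkm v i by (intro rdd_add_mult) auto
  also have "\<dots> = (\<Sum>w\<in>W. if w (a i) \<in> pos then 0 else cf q w * P (w \<circ> s (a i)) v)"
    by (intro sum.cong) (auto simp: rdd_P i v)
  also have "\<dots> = (\<Sum>w\<in>W. if w (a i) \<in> pos then cf q (w \<circ> s (a i)) * P w v else 0)"
    by (rule sum.reindex_bij_witness[of _ "\<lambda>w. w \<circ> s (a i)" "\<lambda>w. w \<circ> s (a i)"])
      (use right_flip[OF _ i] in \<open>simp_all del: o_apply\<close>)
  also have "\<dots> = (\<Sum>w\<in>W. (if w (a i) \<in> pos then cf q (w \<circ> s (a i)) else 0) * P w v)"
    by (intro sum.cong) auto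
  finally show "rdd i q v = (\<Sum>w\<in>W. (if w (a i) \<in> pos then cf q (w \<circ> s (a i)) else 0) * P w v)" .
qed

end

section \<open>The characteristic map and the averaging map\<close>

context based_root_system
begin

text \<open>The sign makes the characteristic map send Schubert polynomials to Schubert classes without
  a factor \<open>(-1)\<close> to the power of the length.\<close>

definition char_map :: "cpoly \<Rightarrow> ('v \<Rightarrow> 'v) \<Rightarrow> cpoly" where
  "char_map f v = act (\<lambda>x. - v x) f"

text \<open>The divided difference operator of Bernstein-Gelfand-Gelfand and Demazure.\<close>

definition ddx :: "nat \<Rightarrow> cpoly \<Rightarrow> cpoly" where
  "ddx i f = quot (f - act (s (a i)) f) (lf (a i))"

lemma lmap_neg: "lmap A \<Longrightarrow> lmap (\<lambda>x. - A x)"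
  by (simp add: lmap_def)

lemma char_map_gkm: "f \<in> S \<Longrightarrow> gkm (char_map f)"
  unfolding gkm_def char_map_def
proof (intro conjI ballI act_in)
  fix v \<beta> assume "f \<in> S"
  then show "lf \<beta> dvd act (\<lambda>x. - (s \<beta> \<circ> v) x) f - act (\<lambda>x. - v x) f"
    by (rule act_cong_dvd) (simp add: reflection_def lf_scale)
qed

lemma char_map_diff: "char_map (f - g) v = char_map f v - char_map g v"
  and char_map_mult: "char_map (f * g) v = char_map f v * char_map g v"
  and char_map_const [simp]: "char_map (const_poly c) v = const_poly c"
  and char_map_0 [simp]: "char_map 0 v = 0"
  and char_map_1 [simp]: "char_map 1 v = 1"
  and char_map_sum: "char_map (sum h T) v = (\<Sum>x\<in>T. char_map (h x) v)"
  by (simp_all add: char_map_def act_add act_diff act_mult act_sum)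

lemma char_map_in: "char_map f v \<in> S"
  by (simp add: char_map_def act_in)

lemma eval0_char_map: "eval0 (char_map f v) = eval0 f"
  by (simp add: char_map_def eval0_act)

lemma act_char_map: "lmap A \<Longrightarrow> v \<in> W \<Longrightarrow> act A (char_map f v) = act (\<lambda>x. - A (v x)) f"
  by (simp add: char_map_def act_act o_def lmap_uminus)

lemma char_map_act: "lmap A \<Longrightarrow> v \<in> W \<Longrightarrow> char_map (act A f) v = act (\<lambda>x. - v (A x)) f"
  by (simp add: char_map_def act_act lmap_neg W_lmap o_def)

lemma char_map_char_map_id: "f \<in> S \<Longrightarrow> v \<in> W \<Longrightarrow> char_map (char_map f id) v = act v f"
  using act_act[OF lmap_neg[OF W_lmap], of v "\<lambda>x. - x" f] by (simp add: char_map_def o_def lmap_uminus W_lmap)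

lemma ddx_mult: "f \<in> S \<Longrightarrow> i \<in> Ix \<Longrightarrow> lf (a i) * ddx i f = f - act (s (a i)) f"
  unfolding ddx_def
  by (intro mult_quot act_s_dvd a_root lf_root_nonzero)

lemma ddx_in: assumes "f \<in> S" "i \<in> Ix" shows "ddx i f \<in> S"
proof -
  have "lf (a i) * ddx i f \<in> S"
    unfolding ddx_mult[OF assms] by (rule polys_in_diff[OF assms(1) act_in])
  then show ?thesis using polys_in_cofactor[OF lf_in lf_root_nonzero[OF a_root[OF assms(2)]]] by blast
qed

lemma rdd_char_map:
  assumes f: "f \<in> S" and i: "i \<in> Ix" and v: "v \<in> W"
  shows "rdd i (char_map f) v = char_map (ddx i f) v"
proof (rule rdd_eqI[OF char_map_gkm[OF f] v i])
  \<comment> \<open>The characteristic map sends \<open>a i\<close> to the negative of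
    \<open>v (a i)\<close>. This sign reconciles the order of subtraction in \<open>ddx\<close> with
    the opposite order in \<open>rdd\<close>.\<close>
  have "lf (v (a i)) * char_map (ddx i f) v = - char_map (lf (a i) * ddx i f) v"
    using act_lf[OF lmap_neg[OF W_lmap[OF v]]] by (simp add: char_map_mult) (simp add: char_map_def lf_uminus)
  also have "\<dots> = char_map (act (s (a i)) f) v - char_map f v"
    unfolding ddx_mult[OF f i] by (simp add: char_map_diff)
  also have "char_map (act (s (a i)) f) v = char_map f (v \<circ> s (a i))"
    unfolding char_map_act[OF lmap_s[OF a_root[OF i]] v] by (simp add: char_map_def)
  finally show "lf (v (a i)) * char_map (ddx i f) v = char_map f (v \<circ> s (a i)) - char_map f v" .
qed

lemma cf_char_map_ddx:
  assumes "f \<in> S" "i \<in> Ix" "w \<in> W"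
  shows "cf (char_map (ddx i f)) w = (if w (a i) \<in> pos then cf (char_map f) (w \<circ> s (a i)) else 0)"
proof -
  have "cf (char_map (ddx i f)) w = cf (rdd i (char_map f)) w"
    using assms rdd_char_map by (intro cf_cong rdd_gkm char_map_gkm) auto
  then show ?thesis using cf_rdd[OF char_map_gkm[OF assms(1)] assms(2,3)] by simp
qed

subsection \<open>Schubert polynomials\<close>

definition average :: "(('v \<Rightarrow> 'v) \<Rightarrow> cpoly) \<Rightarrow> cpoly" where
  "average q = const_poly (1 / of_nat (card W)) * (\<Sum>v\<in>W. q v)"

definition Sch :: "('v \<Rightarrow> 'v) \<Rightarrow> cpoly" where
  "Sch w = average (P (inv' w))"

lemma card_W_pos: "card W > 0"
  using finite_W W_id card_gt_0_iff by blast

text \<open>Left translation permutes \<open>W\<close>, so after summation only the action on values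
  remains of the twisted term in \<open>ldd\<close>, and it passes outside the sum.\<close>

lemma ddx_average:
  assumes q: "gkm q" and i: "i \<in> Ix"
  shows "ddx i (average q) = average (ldd i q)"
  unfolding ddx_def
proof (rule quot_eq)
  show "lf (a i) \<noteq> 0" by (rule lf_root_nonzero[OF a_root[OF i]])
  have "(\<Sum>v\<in>W. q (s (a i) \<circ> v)) = (\<Sum>v\<in>W. q v)"
    by (rule sum.reindex_bij_witness[of _ "\<lambda>v. s (a i) \<circ> v" "\<lambda>v. s (a i) \<circ> v"])
      (use left_flip[OF _ i] in \<open>simp_all del: o_apply\<close>)
  then have "(\<Sum>v\<in>W. act (s (a i)) (q (s (a i) \<circ> v))) = act (s (a i)) (\<Sum>v\<in>W. q v)"
    by (simp flip: act_sum)
  then have "(\<Sum>v\<in>W. lf (a i) * ldd i q v) = (\<Sum>v\<in>W. q v) - act (s (a i)) (\<Sum>v\<in>W. q v)"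
    using ldd_mult[OF q _ i] by (simp add: sum_subtractf)
  then have "lf (a i) * (\<Sum>v\<in>W. ldd i q v) = (\<Sum>v\<in>W. q v) - act (s (a i)) (\<Sum>v\<in>W. q v)"
    by (simp add: sum_distrib_left)
  then show "average q - act (s (a i)) (average q) = lf (a i) * average (ldd i q)"
    unfolding average_def by (simp add: act_mult flip: right_diff_distrib)
qed

lemma average_cong: "(\<And>v. v \<in> W \<Longrightarrow> q v = q' v) \<Longrightarrow> average q = average q'"
  by (simp add: average_def cong: sum.cong)

lemma ddx_Sch:
  assumes w: "w \<in> W" and i: "i \<in> Ix"
  shows "ddx i (Sch w) = (if w (a i) \<in> pos then 0 else Sch (w \<circ> s (a i)))"
proof -
  have iw: "inv' w \<in> W" by (rule W_inv[OF w])
  have "ddx i (Sch w) = average (\<lambda>v. if w (a i) \<in> pos then 0 else P (s (a i) \<circ> inv' w) v)"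
    unfolding Sch_def ddx_average[OF P_gkm[OF iw] i]
    by (intro average_cong) (simp add: ldd_P[OF iw i] W_inv_inv[OF w])
  moreover have "inv' (w \<circ> s (a i)) = s (a i) \<circ> inv' w"
    using W_inv_comp[OF w W_s_simple[OF i]] by (simp only: inv_s a_root i)
  ultimately show ?thesis by (simp add: Sch_def average_def)
qed

lemma Sch_in: "w \<in> W \<Longrightarrow> Sch w \<in> S"
  unfolding Sch_def average_def using gkm_in[OF P_gkm[OF W_inv]]
  by (intro polys_in_mult polys_in_sum) auto

lemma Sch_hom: "w \<in> W \<Longrightarrow> homogeneous (len w) (Sch w)"
proof -
  assume w: "w \<in> W"
  have "homogeneous (len w) (\<Sum>v\<in>W. P (inv' w) v)"
    using P_hom[OF W_inv[OF w]] len_inv[OF w] by (intro homogeneous_sum) simp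
  from homogeneous_mult[OF homogeneous_const this] show ?thesis by (simp add: Sch_def average_def)
qed

lemma Sch_nonneg: "w \<in> W \<Longrightarrow> nonneg_poly (Sch w)"
  unfolding Sch_def average_def using P_nonneg_support[OF W_inv]
  by (intro nonneg_poly_mult nonneg_poly_sum nonneg_poly_const) (auto simp: complex_nonneg_Reals_iff)

text \<open>The summands are nonnegative and cannot cancel, and the one at \<open>inv' w\<close> is
  nonzero.\<close>

lemma Sch_nonzero: "w \<in> W \<Longrightarrow> Sch w \<noteq> 0"
proof -
  assume w: "w \<in> W"
  have "(\<Sum>v\<in>W. P (inv' w) v) \<noteq> 0"
    using nonneg_poly_sum_eq_0_iff[OF finite_W, of "P (inv' w)"] P_nonneg_support[OF W_inv[OF w]]
      W_inv[OF w] bruhat_refl by blast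
  then show ?thesis using card_W_pos by (simp add: Sch_def average_def)
qed

lemma Sch_id: "Sch id = 1"
proof -
  have "(\<Sum>v\<in>W. P id v) = of_nat (card W)" by (simp add: P_id)
  moreover have "of_nat n = const_poly (of_nat n)" for n
    by (induction n) (auto simp: const_poly_add)
  ultimately show ?thesis
    using card_W_pos by (simp add: Sch_def average_def inv_id flip: const_poly_mult)
qed

text \<open>Both evaluations of the coefficients of \<open>char_map (Sch w)\<close> follow from one recursion.\<close>

lemma char_map_Sch_recursion:
  assumes base: "\<And>w. w \<in> W \<Longrightarrow> Q w id \<Longrightarrow> e (cf (char_map (Sch w)) id) = (if id = w then 1 else 0)"
    and step: "\<And>x w i. Q w x \<Longrightarrow> i \<in> Ix \<Longrightarrow> x \<in> W \<Longrightarrow> w \<in> W \<Longrightarrow> x (a i) \<notin> pos \<Longrightarrow> w (a i) \<notin> pos \<Longrightarrow>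
      Q (w \<circ> s (a i)) (x \<circ> s (a i))"
    and e0: "e 0 = (0::'b::zero_neq_one)"
    and xw: "x \<in> W" "w \<in> W" "Q w x"
  shows "e (cf (char_map (Sch w)) x) = (if x = w then 1 else 0)"
  using xw
proof (induction "len x" arbitrary: x w rule: less_induct)
  case less
  show ?case
  proof (cases "x = id")
    case True
    then show ?thesis using base less.prems by simp
  next
    case False
    obtain i where i: "i \<in> Ix" "x (a i) \<notin> pos" using right_descent[OF less.prems(1) False] by blast
    define y where "y = x \<circ> s (a i)"
    have y: "y \<in> W" "y (a i) \<in> pos" "y \<circ> s (a i) = x"
      using right_flip[OF less.prems(1) i(1)] i(2) unfolding y_def by auto
    have ly: "len y < len x" using len_right_neg[OF less.prems(1) i] by (simp add: y_def)
    have eq: "cf (char_map (Sch w)) x = cf (char_map (ddx i (Sch w))) y"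
      using cf_char_map_ddx[OF Sch_in[OF less.prems(2)] i(1) y(1)] y by simp
    show ?thesis
    proof (cases "w (a i) \<in> pos")
      case True
      then have "ddx i (Sch w) = 0" using ddx_Sch[OF less.prems(2) i(1)] by simp
      moreover have "cf (char_map 0) y = 0"
        using cf_cong[OF gkm_const[OF polys_in_0], of "char_map 0" y] cf_0 y(1) by simp
      ultimately show ?thesis unfolding eq using True i(2) e0 by auto
    next
      case False
      let ?u = "w \<circ> s (a i)"
      have u: "?u \<in> W" "?u \<circ> s (a i) = w" using right_flip[OF less.prems(2) i(1)] by auto
      have "Q ?u y" unfolding y_def using step less.prems i False by blast
      then have "e (cf (char_map (Sch ?u)) y) = (if y = ?u then 1 else 0)"
        using less.hyps[OF ly y(1) u(1)] by simp
      moreover have "y = ?u \<longleftrightarrow> x = w" using y(3) u(2) unfolding y_def by metis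
      ultimately show ?thesis unfolding eq using ddx_Sch[OF less.prems(2) i(1)] False by simp
    qed
  qed
qed

text \<open>The recursion with whole coefficients instead of constant terms. The length bound
  reduces its base to \<open>w = id\<close>, where the polynomial is 1. This exact triangularity
  makes the peeling in \<open>in_CI\<close> work.\<close>

lemma cf_char_map_Sch:
  assumes "x \<in> W" "w \<in> W" "len w \<le> len x"
  shows "cf (char_map (Sch w)) x = (if x = w then 1 else 0)"
proof (rule char_map_Sch_recursion[where e = "\<lambda>f. f" and Q = "\<lambda>w x. len w \<le> len x"])
  fix w assume "w \<in> W" "len w \<le> len id"
  then have "w = id" using len_0_imp_id by simp
  then show "cf (char_map (Sch w)) id = (if id = w then 1 else 0)"
    using cf_id[OF char_map_gkm[of 1]] by (simp add: Sch_id)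
next
  fix x w i assume "len w \<le> len x" "i \<in> Ix" "x \<in> W" "w \<in> W" "x (a i) \<notin> pos" "w (a i) \<notin> pos"
  then show "len (w \<circ> s (a i)) \<le> len (x \<circ> s (a i))"
    using len_right_neg[of w i] len_right_neg[of x i] by simp
qed (use assms in auto)

lemma eval0_cf_char_map_Sch:
  assumes "x \<in> W" "w \<in> W"
  shows "eval0 (cf (char_map (Sch w)) x) = (if x = w then 1 else 0)"
proof (rule char_map_Sch_recursion[where e = eval0 and Q = "\<lambda>w x. True"])
  fix w assume w: "w \<in> W"
  have "eval0 (Sch w) = (if id = w then 1 else 0)"
  proof (cases "w = id")
    case False
    then have "len w > 0" using len_0_imp_id[OF w] by auto
    then show ?thesis using homogeneous_eval0[OF Sch_hom[OF w]] False by simp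
  qed (simp add: Sch_id)
  then show "eval0 (cf (char_map (Sch w)) id) = (if id = w then 1 else 0)"
    by (simp add: cf_id[OF char_map_gkm[OF Sch_in[OF w]]] eval0_char_map)
qed (use assms in auto)

text \<open>Divided differences along a reduced word carry the coefficient at \<open>w\<close> to
  one at \<open>id\<close> and keep all longer coefficients zero. In the end
  \<open>char_map f\<close> is constant on \<open>W\<close>, and its value at \<open>u\<close> is
  \<open>u\<close> applied to its value at \<open>id\<close>.\<close>

lemma cf_char_map_top_invariant:
  assumes "f \<in> S" "w \<in> W" "\<And>x. x \<in> W \<Longrightarrow> len w < len x \<Longrightarrow> cf (char_map f) x = 0" "u \<in> W"
  shows "act u (cf (char_map f) w) = cf (char_map f) w"
  using assms
proof (induction "len w" arbitrary: w f rule: less_induct)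
  case less
  show ?case
  proof (cases "w = id")
    case True
    have const: "char_map f v = cf (char_map f) id" if v: "v \<in> W" for v
    proof -
      have "char_map f v = (\<Sum>x\<in>W. if x = id then cf (char_map f) id else 0)"
        unfolding cf(2)[OF char_map_gkm[OF less.prems(1)] v]
        using less.prems(3) len_0_imp_id True by (intro sum.cong) (auto simp: P_id v intro: gr0I)
      then show ?thesis using finite_W W_id by simp
    qed
    have "act u (char_map f id) = char_map f u"
      using act_char_map[OF W_lmap[OF less.prems(4)] W_id] by (simp add: char_map_def)
    then show ?thesis using const[OF W_id] const[OF less.prems(4)] True by simp
  next
    case False
    obtain i where i: "i \<in> Ix" "w (a i) \<notin> pos" using right_descent[OF less.prems(2) False] by blast
    define y where "y = w \<circ> s (a i)"
    have y: "y \<in> W" "y (a i) \<in> pos" "y \<circ> s (a i) = w"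
      using right_flip[OF less.prems(2) i(1)] i(2) unfolding y_def by auto
    have ly: "len w = Suc (len y)" using len_right_neg[OF less.prems(2) i] by (simp add: y_def)
    have "cf (char_map (ddx i f)) x = 0" if x: "x \<in> W" "len y < len x" for x
      unfolding cf_char_map_ddx[OF less.prems(1) i(1) x(1)]
      using less.prems(3)[of "x \<circ> s (a i)"] right_flip(3)[OF x(1) i(1)] len_right[OF x(1) i(1)] x(2) ly
      by simp
    then have "act u (cf (char_map (ddx i f)) y) = cf (char_map (ddx i f)) y"
      using less.hyps[of y "ddx i f"] ly ddx_in[OF less.prems(1) i(1)] y(1) less.prems(4) by simp
    moreover have "cf (char_map (ddx i f)) y = cf (char_map f) w"
      using cf_char_map_ddx[OF less.prems(1) i(1) y(1)] y by simp
    ultimately show ?thesis by simp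
  qed
qed

end

section \<open>The coinvariant ring\<close>

text \<open>Meant for the sets cut out by vanishing constant terms, which are then compared with
  ideals given by generators.\<close>

lemma idealI_minus:
  assumes "cring A" "K \<subseteq> carrier A" "\<zero>\<^bsub>A\<^esub> \<in> K"
    and minus: "\<And>x y. x \<in> K \<Longrightarrow> y \<in> K \<Longrightarrow> x \<ominus>\<^bsub>A\<^esub> y \<in> K"
    and mult: "\<And>x y. x \<in> K \<Longrightarrow> y \<in> carrier A \<Longrightarrow> y \<otimes>\<^bsub>A\<^esub> x \<in> K"
  shows "ideal K A"
proof -
  interpret A: cring A by (rule assms)
  have neg: "\<ominus>\<^bsub>A\<^esub> x \<in> K" if "x \<in> K" for x
    using minus[OF assms(3) that] that assms(2) by (auto simp: A.minus_eq)
  have add: "x \<oplus>\<^bsub>A\<^esub> y \<in> K" if "x \<in> K" "y \<in> K" for x y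
    using minus[OF that(1) neg[OF that(2)]] that assms(2) by (auto simp: A.minus_eq)
  show ?thesis
  proof (rule idealI)
    show "ring A" by (rule A.ring_axioms)
    show "subgroup K (add_monoid A)"
      using assms(2,3) neg add by (intro A.add.subgroupI) (auto simp: a_inv_def)
    show "\<And>x y. x \<in> K \<Longrightarrow> y \<in> carrier A \<Longrightarrow> y \<otimes>\<^bsub>A\<^esub> x \<in> K" by (rule mult)
    show "\<And>x y. x \<in> K \<Longrightarrow> y \<in> carrier A \<Longrightarrow> x \<otimes>\<^bsub>A\<^esub> y \<in> K"
      using mult assms(2) A.m_comm by (metis subsetD)
  qed
qed

context based_root_system
begin

lemma sym_alg_simps [simp]:
  "monoid.mult (sym_alg R) = (*)" "monoid.one (sym_alg R) = 1" "ring.zero (sym_alg R) = 0" "ring.add (sym_alg R) = (+)"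
  by (auto simp: sym_alg_def)

lemma cring_sym_alg: "cring (sym_alg R)"
proof (rule cringI)
  show "abelian_group (sym_alg R)"
  proof (rule abelian_groupI)
    fix x assume "x \<in> carrier (sym_alg R)"
    then show "\<exists>y\<in>carrier (sym_alg R). y \<oplus>\<^bsub>sym_alg R\<^esub> x = \<zero>\<^bsub>sym_alg R\<^esub>"
      by (intro bexI[of _ "- x"]) (auto simp: carrier_S polys_in_uminus)
  qed (auto simp: carrier_S polys_in_add algebra_simps)
  show "comm_monoid (sym_alg R)"
    by (rule comm_monoidI) (auto simp: carrier_S polys_in_mult algebra_simps)
qed (auto simp: algebra_simps)

interpretation SA: cring "sym_alg R" by (rule cring_sym_alg)

lemma sym_alg_uminus: "f \<in> S \<Longrightarrow> \<ominus>\<^bsub>sym_alg R\<^esub> f = - f"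
  by (rule SA.minus_equality) (auto simp: carrier_S polys_in_uminus)

lemma sym_alg_minus: "f \<in> S \<Longrightarrow> g \<in> S \<Longrightarrow> f \<ominus>\<^bsub>sym_alg R\<^esub> g = f - g"
  by (simp add: SA.minus_eq sym_alg_uminus)

abbreviation CI :: "cpoly set" where "CI \<equiv> coinv_ideal R"

lemma coinv_gens:
  "{f \<in> carrier (sym_alg R). (\<forall>w \<in> W. act w f = f) \<and> lookup f 0 = 0}
    = {f \<in> S. (\<forall>w\<in>W. act w f = f) \<and> eval0 f = 0}"
  by (simp add: carrier_S eval0_def)

lemma CI_ideal: "ideal CI (sym_alg R)"
  unfolding coinv_ideal_def by (rule SA.genideal_ideal) auto

lemma CI_gen: "f \<in> S \<Longrightarrow> (\<And>w. w \<in> W \<Longrightarrow> act w f = f) \<Longrightarrow> eval0 f = 0 \<Longrightarrow> f \<in> CI"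
  unfolding coinv_ideal_def coinv_gens
  by (rule subsetD[OF SA.genideal_self]) (auto simp: carrier_S)

lemma CI_0: "0 \<in> CI"
  using additive_subgroup.zero_closed[OF ideal.axioms(1)[OF CI_ideal]] by simp

lemma CI_add: "f \<in> CI \<Longrightarrow> g \<in> CI \<Longrightarrow> f + g \<in> CI"
  using additive_subgroup.a_closed[OF ideal.axioms(1)[OF CI_ideal]] by simp

lemma CI_mult: "f \<in> CI \<Longrightarrow> g \<in> S \<Longrightarrow> f * g \<in> CI"
  using ideal.I_r_closed[OF CI_ideal] by (simp add: carrier_S)

lemma CI_sum: "(\<And>x. x \<in> A \<Longrightarrow> f x \<in> CI) \<Longrightarrow> sum f A \<in> CI"
  by (induction A rule: infinite_finite_induct) (auto simp: CI_0 CI_add)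

text \<open>Vanishing of all constant terms defines an ideal by \<open>eval0_cf_mult_null\<close>.
  An invariant generator has a constant characteristic map, hence only a coefficient at
  \<open>id\<close>, whose constant term is that of the generator.\<close>

lemma eval0_cf_char_map_CI:
  assumes "f \<in> CI" "w \<in> W"
  shows "eval0 (cf (char_map f) w) = 0"
proof -
  define K where "K = {f \<in> S. \<forall>w\<in>W. eval0 (cf (char_map f) w) = 0}"
  have "ideal K (sym_alg R)"
  proof (rule idealI_minus[OF cring_sym_alg])
    show "\<zero>\<^bsub>sym_alg R\<^esub> \<in> K"
      using cf_cong[OF gkm_const[OF polys_in_0], of "char_map 0"] by (simp add: K_def cf_0)
    show "x \<ominus>\<^bsub>sym_alg R\<^esub> y \<in> K" if "x \<in> K" "y \<in> K" for x y
    proof -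
      have xy: "x \<in> S" "y \<in> S" using that by (auto simp: K_def)
      have "cf (char_map (x - y)) w = cf (char_map x) w - cf (char_map y) w" if "w \<in> W" for w
        using cf_diff[OF char_map_gkm[OF xy(1)] char_map_gkm[OF xy(2)] that] by (simp add: char_map_diff[abs_def])
      then show ?thesis using that xy by (simp add: K_def sym_alg_minus polys_in_diff eval0_diff)
    qed
    show "y \<otimes>\<^bsub>sym_alg R\<^esub> x \<in> K" if "x \<in> K" "y \<in> carrier (sym_alg R)" for x y
    proof -
      have xy: "x \<in> S" "y \<in> S" using that by (auto simp: K_def carrier_S)
      have "eval0 (cf (\<lambda>v. char_map x v * char_map y v) w) = 0" if "w \<in> W" for w
        using eval0_cf_mult_null[OF char_map_gkm[OF xy(1)] char_map_gkm[OF xy(2)] _ that] \<open>x \<in> K\<close>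
        by (simp add: K_def)
      then show ?thesis using xy by (simp add: K_def polys_in_mult char_map_mult[abs_def] mult.commute)
    qed
  qed (auto simp: K_def carrier_S)
  moreover have "{f \<in> S. (\<forall>w\<in>W. act w f = f) \<and> eval0 f = 0} \<subseteq> K"
  proof
    fix f assume f: "f \<in> {f \<in> S. (\<forall>w\<in>W. act w f = f) \<and> eval0 f = 0}"
    have const: "char_map f v = char_map f id * P id v" if v: "v \<in> W" for v
    proof -
      have "char_map (act v f) id = char_map f v"
        unfolding char_map_act[OF W_lmap[OF v] W_id] by (simp add: char_map_def)
      then show ?thesis using f v by (simp add: P_id)
    qed
    have "eval0 (cf (char_map f) w) = 0" if w: "w \<in> W" for w
    proof -
      have "cf (char_map f) w = cf (\<lambda>v. char_map f id * P id v) w"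
        using gkm_mult[OF gkm_const[OF char_map_in] P_gkm[OF W_id]] const w by (intro cf_cong) auto
      also have "\<dots> = char_map f id * cf (P id) w" by (rule cf_mult[OF P_gkm[OF W_id] char_map_in w])
      finally show ?thesis using f by (simp add: eval0_mult eval0_char_map)
    qed
    then show "f \<in> K" using f by (simp add: K_def)
  qed
  ultimately have "CI \<subseteq> K"
    unfolding coinv_ideal_def coinv_gens by (rule SA.genideal_minimal)
  then show ?thesis using assms by (auto simp: K_def)
qed

text \<open>The coefficients of \<open>char_map f\<close> of top length are invariant, so that subtracting the
  corresponding combination of Schubert polynomials lowers the top length.\<close>

lemma in_CI:
  assumes "f \<in> S" "\<And>x. x \<in> W \<Longrightarrow> eval0 (cf (char_map f) x) = 0"
  shows "f \<in> CI"
proof -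
  have main: "f \<in> CI" if "f \<in> S" "\<And>x. x \<in> W \<Longrightarrow> eval0 (cf (char_map f) x) = 0"
    "\<And>x. x \<in> W \<Longrightarrow> k \<le> len x \<Longrightarrow> cf (char_map f) x = 0" for f k
    using that
  proof (induction k arbitrary: f)
    case 0
    \<comment> \<open>No coefficient is left, and \<open>char_map\<close> at \<open>id\<close>, the
      substitution of -x for x, is an involution; so \<open>f\<close> itself is 0.\<close>
    have "char_map f id = 0" using cf(2)[OF char_map_gkm[OF 0(1)] W_id] 0(3) by simp
    moreover have "char_map (char_map f id) id = f"
      using char_map_char_map_id[OF 0(1) W_id] act_id[OF 0(1)] by simp
    ultimately show ?case using CI_0 by simp
  next
    case (Suc k)
    define L where "L = {w \<in> W. len w = k}"
    have L: "finite L" "L \<subseteq> W" using finite_W by (auto simp: L_def)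
    let ?c = "cf (char_map f)"
    have c: "?c w \<in> S" if "w \<in> W" for w by (rule cf(1)[OF char_map_gkm[OF Suc.prems(1)] that])
    have inv: "act u (?c w) = ?c w" if "w \<in> L" "u \<in> W" for w u
      using that Suc.prems(3) by (intro cf_char_map_top_invariant[OF Suc.prems(1)]) (auto simp: L_def)
    \<comment> \<open>The substitution of -x for x undoes the sign in the characteristic map, so
      that the invariant \<open>?c w\<close> becomes the constant value of
      \<open>char_map (b w)\<close>.\<close>
    define b where "b w = char_map (?c w) id" for w
    have b: "b w \<in> S" for w by (simp add: b_def char_map_in)
    have char_map_b: "char_map (b w) v = ?c w" if "w \<in> L" "v \<in> W" for w v
      using char_map_char_map_id[OF c that(2), of w] inv[OF that] L that(1) by (auto simp: b_def)
    have b_CI: "b w \<in> CI" if w: "w \<in> L" for w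
    proof (rule CI_gen[OF b])
      fix u assume u: "u \<in> W"
      have "act u (b w) = char_map (act u (?c w)) id"
        unfolding b_def act_char_map[OF W_lmap[OF u] W_id] char_map_act[OF W_lmap[OF u] W_id] by simp
      then show "act u (b w) = b w" using inv[OF w u] by (simp add: b_def)
    next
      show "eval0 (b w) = 0" using Suc.prems(2) w L by (auto simp: b_def eval0_char_map)
    qed
    define g where "g = (\<Sum>w\<in>L. b w * Sch w)"
    have g: "g \<in> CI" "g \<in> S"
      unfolding g_def using b_CI b Sch_in L
      by (auto intro!: CI_sum CI_mult polys_in_sum polys_in_mult)
    have cf_g: "cf (char_map (f - g)) x = ?c x - (\<Sum>w\<in>L. ?c w * cf (char_map (Sch w)) x)" if x: "x \<in> W" for x
    proof -
      have tm: "gkm (\<lambda>v. ?c w * char_map (Sch w) v)" if "w \<in> L" for w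
        using that L c Sch_in by (intro gkm_mult gkm_const char_map_gkm) auto
      have "cf (char_map (f - g)) x = cf (\<lambda>v. char_map f v - (\<Sum>w\<in>L. ?c w * char_map (Sch w) v)) x"
        using gkm_diff[OF char_map_gkm[OF Suc.prems(1)] gkm_sum[OF tm]] x char_map_b
        by (intro cf_cong) (auto simp: g_def char_map_diff char_map_sum char_map_mult)
      also have "\<dots> = ?c x - cf (\<lambda>v. \<Sum>w\<in>L. ?c w * char_map (Sch w) v) x"
        by (rule cf_diff[OF char_map_gkm[OF Suc.prems(1)] gkm_sum[OF tm] x])
      also have "cf (\<lambda>v. \<Sum>w\<in>L. ?c w * char_map (Sch w) v) x = (\<Sum>w\<in>L. cf (\<lambda>v. ?c w * char_map (Sch w) v) x)"
        by (rule cf_sum[OF tm x])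
      also have "\<dots> = (\<Sum>w\<in>L. ?c w * cf (char_map (Sch w)) x)"
        using L c Sch_in x by (intro sum.cong refl cf_mult char_map_gkm) auto
      finally show ?thesis .
    qed
    have "f - g \<in> CI"
    proof (rule Suc.IH)
      show "f - g \<in> S" by (rule polys_in_diff[OF Suc.prems(1) g(2)])
      show "eval0 (cf (char_map (f - g)) x) = 0" if "x \<in> W" for x
        using that L Suc.prems(2) by (auto simp: cf_g eval0_diff eval0_sum eval0_mult subset_iff)
      show "cf (char_map (f - g)) x = 0" if x: "x \<in> W" "k \<le> len x" for x
      proof -
        \<comment> \<open>From length \<open>k\<close> on, the coefficients of \<open>Sch w\<close>
          are exactly 0 or 1 and not merely so up to constant terms, so the subtraction clears
          length \<open>k\<close> and creates nothing above it.\<close>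
        have "(\<Sum>w\<in>L. ?c w * cf (char_map (Sch w)) x) = (\<Sum>w\<in>L. if w = x then ?c x else 0)"
          using x L by (intro sum.cong) (auto simp: cf_char_map_Sch L_def)
        also have "\<dots> = ?c x"
          using L x Suc.prems(3)[of x] by (cases "len x = k") (auto simp: L_def)
        finally show ?thesis by (simp add: cf_g[OF x(1)])
      qed
    qed
    then show ?case using CI_add[OF _ g(1)] by fastforce
  qed
  show ?thesis
  proof (rule main[of _ "Suc (card pos)"])
    fix x assume x: "x \<in> W" "Suc (card pos) \<le> len x"
    then show "cf (char_map f) x = 0" using len_le_card_pos[OF x(1)] by simp
  qed (use assms in auto)
qed

lemma CI_iff: "f \<in> S \<Longrightarrow> f \<in> CI \<longleftrightarrow> (\<forall>w\<in>W. eval0 (cf (char_map f) w) = 0)"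
  using in_CI eval0_cf_char_map_CI by blast

end

section \<open>Cohomology of the partial flag variety\<close>

context based_root_system
begin

interpretation SA: cring "sym_alg R" by (rule cring_sym_alg)

abbreviation E :: "(('v \<Rightarrow> 'v) \<Rightarrow> cpoly) \<Rightarrow> ('v \<Rightarrow> 'v) \<Rightarrow> complex" where
  "E q w \<equiv> eval0 (cf q w)"

lemma E_diff_0D:
  assumes "gkm q" "gkm r" "E (\<lambda>v. q v - r v) w = 0" "w \<in> W"
  shows "E q w = E r w"
  using assms by (simp add: cf_diff eval0_diff)

lemma E_mult_cong:
  assumes "gkm q" "gkm q'" "gkm r" "gkm r'" "\<And>w. w \<in> W \<Longrightarrow> E q w = E q' w" "\<And>w. w \<in> W \<Longrightarrow> E r w = E r' w"
    and x: "x \<in> W"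
  shows "E (\<lambda>v. q v * r v) x = E (\<lambda>v. q' v * r' v) x"
proof (rule E_diff_0D[OF _ _ _ x])
  have g: "gkm (\<lambda>v. q v - q' v)" "gkm (\<lambda>v. r v - r' v)" using assms by (auto intro: gkm_diff)
  have 1: "E (\<lambda>v. (q v - q' v) * r v) x = 0"
    using assms by (intro eval0_cf_mult_null[OF g(1) _ _ x]) (auto simp: cf_diff eval0_diff)
  have 2: "E (\<lambda>v. (r v - r' v) * q' v) x = 0"
    using assms by (intro eval0_cf_mult_null[OF g(2) _ _ x]) (auto simp: cf_diff eval0_diff)
  have "cf (\<lambda>v. (q v - q' v) * r v + (r v - r' v) * q' v) x
      = cf (\<lambda>v. (q v - q' v) * r v) x + cf (\<lambda>v. (r v - r' v) * q' v) x"
    using g assms by (intro cf_add gkm_mult) auto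
  moreover have "(\<lambda>v. q v * r v - q' v * r' v) = (\<lambda>v. (q v - q' v) * r v + (r v - r' v) * q' v)"
    by (simp add: algebra_simps)
  ultimately show "E (\<lambda>v. q v * r v - q' v * r' v) x = 0" using 1 2 by (simp add: eval0_add)
qed (use assms in \<open>auto intro: gkm_mult\<close>)

lemma in_PIdl_iff:
  assumes "f \<in> S" "\<beta> \<in> roots R"
  shows "f \<in> PIdl\<^bsub>sym_alg R\<^esub> (lf \<beta>) \<longleftrightarrow> lf \<beta> dvd f"
proof
  assume "f \<in> PIdl\<^bsub>sym_alg R\<^esub> (lf \<beta>)"
  then show "lf \<beta> dvd f" by (auto simp: cgenideal_def)
next
  assume "lf \<beta> dvd f"
  then obtain k where "k \<in> S" "f = lf \<beta> * k"
    using polys_in_dvdE[OF _ lf_in lf_root_nonzero[OF assms(2)] assms(1)] by blast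
  then show "f \<in> PIdl\<^bsub>sym_alg R\<^esub> (lf \<beta>)"
    by (auto simp: cgenideal_def carrier_S mult.commute)
qed

lemma CI_eqI:
  assumes "f \<in> S" "g \<in> S" "\<And>x. x \<in> W \<Longrightarrow> E (char_map f) x = E (char_map g) x"
  shows "f - g \<in> CI"
proof (rule in_CI)
  show "f - g \<in> S" by (rule polys_in_diff[OF assms(1,2)])
  fix x assume x: "x \<in> W"
  have "cf (char_map (f - g)) x = cf (char_map f) x - cf (char_map g) x"
    unfolding cf_diff[OF char_map_gkm[OF assms(1)] char_map_gkm[OF assms(2)] x, symmetric] char_map_diff[abs_def] ..
  then show "E (char_map (f - g)) x = 0" using assms(3)[OF x] by (simp add: eval0_diff)
qed

lemma coinv_class_hom: "coinv_class R \<in> ring_hom (sym_alg R) (coinv_ring R)"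
  using ideal.rcos_ring_hom[OF CI_ideal] by (simp add: coinv_class_def[abs_def] coinv_ring_def)

lemma coinv_class_eq_iff: "f \<in> S \<Longrightarrow> g \<in> S \<Longrightarrow> coinv_class R f = coinv_class R g \<longleftrightarrow> f - g \<in> CI"
  using SA.quotient_eq_iff_same_a_r_cos[OF CI_ideal, of f g]
  by (simp add: coinv_class_def carrier_S sym_alg_minus)

lemma coinv_ring_ring: "ring (coinv_ring R)"
  unfolding coinv_ring_def by (rule ideal.quotient_is_ring[OF CI_ideal])

lemma coinv_class_zero: "\<zero>\<^bsub>coinv_ring R\<^esub> = coinv_class R 0"
  using ring_hom_zero[OF coinv_class_hom SA.ring_axioms coinv_ring_ring] by simp

context
  fixes J :: "nat set"
  assumes J: "J \<subseteq> Ix"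
begin

abbreviation HJ :: "'v gkm set" where "HJ \<equiv> carrier (HT R J)"
abbreviation MJ :: "('v \<Rightarrow> 'v) set" where "MJ \<equiv> min_reps R J"
abbreviation Wc :: "('v \<Rightarrow> 'v) set set" where "Wc \<equiv> wcosets R J"

section \<open>Classes of G/P as right invariant functions on the Weyl group\<close>

definition pull :: "'v gkm \<Rightarrow> ('v \<Rightarrow> 'v) \<Rightarrow> cpoly" where
  "pull p v = p (wcoset R J v)"

definition push :: "(('v \<Rightarrow> 'v) \<Rightarrow> cpoly) \<Rightarrow> 'v gkm" where
  "push q = (\<lambda>C\<in>Wc. q (min_rep R C))"

definition right_inv :: "(('v \<Rightarrow> 'v) \<Rightarrow> cpoly) \<Rightarrow> bool" where
  "right_inv q \<longleftrightarrow> (\<forall>v\<in>W. \<forall>j\<in>J. q (v \<circ> s (a j)) = q v)"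

lemma J_Ix: "j \<in> J \<Longrightarrow> j \<in> Ix" using J by auto

lemma right_inv_parabolic:
  assumes "right_inv q" "v \<in> W" "x \<in> parabolic R J"
  shows "q (v \<circ> x) = q v"
proof -
  obtain ws where ws: "set ws \<subseteq> J" "x = word ws" using assms(3) parabolic_word[OF J] by auto
  have "\<forall>v\<in>W. q (v \<circ> word ws) = q v" using ws(1)
  proof (induction ws)
    case (Cons j ws)
    show ?case
    proof
      fix v assume v: "v \<in> W"
      have j: "j \<in> J" using Cons.prems by simp
      have sub: "set ws \<subseteq> J" using Cons.prems by simp
      have "q (v \<circ> s (a j) \<circ> word ws) = q (v \<circ> s (a j))"
        by (rule bspec[OF Cons.IH[OF sub] right_flip(3)[OF v J_Ix[OF j]]])
      then show "q (v \<circ> word (j # ws)) = q v"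
        using assms(1) v j unfolding word_Cons right_inv_def o_assoc by metis
    qed
  qed simp
  then show ?thesis using ws(2) assms(2) by simp
qed

lemma min_rep_W: "v \<in> W \<Longrightarrow> min_rep R (wcoset R J v) \<in> W"
  using min_rep_in_min_reps[OF J] min_reps_W[OF J] by blast

lemma right_inv_min_rep: "right_inv q \<Longrightarrow> v \<in> W \<Longrightarrow> q (min_rep R (wcoset R J v)) = q v"
  using wcoset_memD(3)[OF J _ min_rep_wcoset(1)[OF J]] right_inv_parabolic by metis

lemma wcoset_min_rep: "v \<in> W \<Longrightarrow> wcoset R J (min_rep R (wcoset R J v)) = wcoset R J v"
  using wcoset_memD(2)[OF J] min_rep_wcoset(1)[OF J] by blast

lemma pull_push: "right_inv q \<Longrightarrow> v \<in> W \<Longrightarrow> pull (push q) v = q v"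
  by (simp add: pull_def push_def wcosets_def right_inv_min_rep)

lemma pull_right_inv: "right_inv (pull p)"
  using wcoset_comp[OF J _ parabolic_s[OF J]] by (simp add: right_inv_def pull_def)

lemma HT_iff: "p \<in> HJ \<longleftrightarrow> p \<in> extensional Wc \<and> gkm (pull p)"
proof
  assume p: "p \<in> HJ"
  then have ext: "p \<in> extensional Wc" and val: "\<And>v. v \<in> W \<Longrightarrow> pull p v \<in> S"
    by (auto simp: HT_def PiE_def Pi_def carrier_S wcosets_def pull_def)
  have "lf \<beta> dvd pull p (s \<beta> \<circ> v) - pull p v" if v: "v \<in> W" "\<beta> \<in> pos" for v \<beta>
  proof (cases "wcoset R J (s \<beta> \<circ> v) = wcoset R J v")
    case False
    have sW: "s \<beta> \<in> W" using v(2) pos_roots_subset W_s by blast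
    have "pull p (s \<beta> \<circ> v) - pull p v \<in> PIdl\<^bsub>sym_alg R\<^esub> (lf \<beta>)"
      using p v False unfolding pull_def W_mult[OF sW v(1), symmetric] by (simp add: HT_def)
    moreover have "pull p (s \<beta> \<circ> v) - pull p v \<in> S"
      by (rule polys_in_diff[OF val[OF W_comp[OF sW v(1)]] val[OF v(1)]])
    ultimately show ?thesis using in_PIdl_iff[OF _ pos_roots_subset[OF v(2)]] by simp
  qed (simp add: pull_def)
  then show "p \<in> extensional Wc \<and> gkm (pull p)" using ext val by (simp add: gkm_def)
next
  assume p: "p \<in> extensional Wc \<and> gkm (pull p)"
  then have "p \<in> Wc \<rightarrow>\<^sub>E carrier (sym_alg R)"
    by (auto simp: PiE_def Pi_def carrier_S wcosets_def gkm_def pull_def)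
  moreover have "p (wcoset R J (s \<beta> \<otimes>\<^bsub>weyl R\<^esub> v)) - p (wcoset R J v) \<in> PIdl\<^bsub>sym_alg R\<^esub> (lf \<beta>)"
    if v: "v \<in> W" "\<beta> \<in> pos" for v \<beta>
  proof -
    have r: "\<beta> \<in> roots R" and sW: "s \<beta> \<in> W" using v(2) pos_roots_subset W_s by blast+
    have "lf \<beta> dvd pull p (s \<beta> \<circ> v) - pull p v" using p v by (simp add: gkm_def)
    moreover have "pull p (s \<beta> \<circ> v) - pull p v \<in> S"
      using p v W_comp[OF sW v(1)] by (simp add: gkm_def polys_in_diff)
    ultimately have "pull p (s \<beta> \<circ> v) - pull p v \<in> PIdl\<^bsub>sym_alg R\<^esub> (lf \<beta>)"
      using in_PIdl_iff r by blast
    then show ?thesis by (simp add: pull_def W_mult[OF sW v(1)])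
  qed
  ultimately show "p \<in> HJ" by (simp add: HT_def)
qed

lemma HT_simps:
  "p \<otimes>\<^bsub>HT R J\<^esub> q = (\<lambda>C\<in>Wc. p C * q C)" "\<one>\<^bsub>HT R J\<^esub> = (\<lambda>C\<in>Wc. 1)"
  "\<zero>\<^bsub>HT R J\<^esub> = (\<lambda>C\<in>Wc. 0)" "p \<oplus>\<^bsub>HT R J\<^esub> q = (\<lambda>C\<in>Wc. p C + q C)"
  by (auto simp: HT_def)

lemma pull_restrict: "v \<in> W \<Longrightarrow> pull (restrict p Wc) v = pull p v"
  by (simp add: pull_def wcosets_def)

lemma HT_I:
  assumes "gkm q" "\<And>v. v \<in> W \<Longrightarrow> p (wcoset R J v) = q v"
  shows "restrict p Wc \<in> HJ"
  unfolding HT_iff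
  using gkm_cong[OF assms(1), of "pull (restrict p Wc)"] pull_restrict assms(2) by (simp add: pull_def)

lemma HT_gkm: "p \<in> HJ \<Longrightarrow> gkm (pull p)"
  by (simp add: HT_iff)

lemma HT_eqI:
  assumes "p \<in> HJ" "q \<in> HJ" "\<And>v. v \<in> W \<Longrightarrow> pull p v = pull q v"
  shows "p = q"
proof (rule extensionalityI[where A = Wc])
  fix C assume "C \<in> Wc"
  then show "p C = q C" using assms(3) by (auto simp: wcosets_def pull_def)
qed (use assms in \<open>auto simp: HT_iff\<close>)

lemma HT_mult_closed: "p \<in> HJ \<Longrightarrow> q \<in> HJ \<Longrightarrow> p \<otimes>\<^bsub>HT R J\<^esub> q \<in> HJ"
  unfolding HT_simps by (rule HT_I[OF gkm_mult[OF HT_gkm HT_gkm]]) (auto simp: pull_def)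

lemma HT_add_closed: "p \<in> HJ \<Longrightarrow> q \<in> HJ \<Longrightarrow> p \<oplus>\<^bsub>HT R J\<^esub> q \<in> HJ"
  unfolding HT_simps by (rule HT_I[OF gkm_add[OF HT_gkm HT_gkm]]) (auto simp: pull_def)

lemma HT_const_closed: "f \<in> S \<Longrightarrow> HT_const R J f \<in> HJ"
  unfolding HT_const_def by (rule HT_I[OF gkm_const]) auto

lemma pull_simps:
  "v \<in> W \<Longrightarrow> pull (p \<otimes>\<^bsub>HT R J\<^esub> q) v = pull p v * pull q v"
  "v \<in> W \<Longrightarrow> pull (p \<oplus>\<^bsub>HT R J\<^esub> q) v = pull p v + pull q v"
  "v \<in> W \<Longrightarrow> pull (HT_const R J f) v = f"
  "v \<in> W \<Longrightarrow> pull \<one>\<^bsub>HT R J\<^esub> v = 1" "v \<in> W \<Longrightarrow> pull \<zero>\<^bsub>HT R J\<^esub> v = 0"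
  by (auto simp: HT_simps HT_const_def pull_def wcosets_def)

lemma HT_one_const: "\<one>\<^bsub>HT R J\<^esub> = HT_const R J 1" and HT_zero_const: "\<zero>\<^bsub>HT R J\<^esub> = HT_const R J 0"
  by (auto simp: HT_simps HT_const_def)

lemma cring_HT: "cring (HT R J)"
proof (rule cringI)
  show "abelian_group (HT R J)"
  proof (rule abelian_groupI)
    fix p assume p: "p \<in> HJ"
    have "HT_const R J (- 1) \<otimes>\<^bsub>HT R J\<^esub> p \<oplus>\<^bsub>HT R J\<^esub> p = \<zero>\<^bsub>HT R J\<^esub>"
      using p by (auto simp: HT_simps HT_const_def)
    then show "\<exists>q\<in>HJ. q \<oplus>\<^bsub>HT R J\<^esub> p = \<zero>\<^bsub>HT R J\<^esub>"
      using HT_mult_closed[OF HT_const_closed p] polys_in_uminus[OF polys_in_1] by blast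
  next
    fix p assume p: "p \<in> HJ"
    show "\<zero>\<^bsub>HT R J\<^esub> \<oplus>\<^bsub>HT R J\<^esub> p = p"
      using p HT_add_closed[OF HT_const_closed p]
      by (intro HT_eqI) (auto simp: HT_zero_const pull_simps)
  qed (auto simp: HT_add_closed HT_zero_const HT_const_closed, auto simp: HT_simps algebra_simps)
  show "comm_monoid (HT R J)"
  proof (rule comm_monoidI)
    fix p assume p: "p \<in> HJ"
    show "\<one>\<^bsub>HT R J\<^esub> \<otimes>\<^bsub>HT R J\<^esub> p = p"
      using p HT_mult_closed[OF HT_const_closed p]
      by (intro HT_eqI) (auto simp: HT_one_const pull_simps)
  qed (auto simp: HT_mult_closed HT_one_const HT_const_closed, auto simp: HT_simps algebra_simps)
qed (auto simp: HT_simps algebra_simps)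

interpretation HT: cring "HT R J" by (rule cring_HT)

lemma HT_minus:
  assumes "p \<in> HJ" "q \<in> HJ" "v \<in> W"
  shows "pull (p \<ominus>\<^bsub>HT R J\<^esub> q) v = pull p v - pull q v"
proof -
  have "p \<ominus>\<^bsub>HT R J\<^esub> q \<oplus>\<^bsub>HT R J\<^esub> q = p" using assms by algebra
  then have "pull (p \<ominus>\<^bsub>HT R J\<^esub> q) v + pull q v = pull p v"
    using pull_simps(2)[OF assms(3)] by metis
  then show ?thesis by (simp add: eq_diff_eq)
qed

lemma HT_finsum:
  assumes "finite A" "\<And>x. x \<in> A \<Longrightarrow> f x \<in> HJ" "v \<in> W"
  shows "pull (\<Oplus>\<^bsub>HT R J\<^esub>x\<in>A. f x) v = (\<Sum>x\<in>A. pull (f x) v)"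
  using assms(1,2)
proof (induction A rule: finite_induct)
  case (insert x A)
  then have "(\<Oplus>\<^bsub>HT R J\<^esub>x\<in>insert x A. f x) = f x \<oplus>\<^bsub>HT R J\<^esub> (\<Oplus>\<^bsub>HT R J\<^esub>x\<in>A. f x)"
    by (intro HT.finsum_insert) auto
  then show ?case using insert assms(3) by (simp add: pull_simps)
qed (simp add: pull_simps assms(3))

subsection \<open>Flow-up classes\<close>

lemma P_right_inv: "w \<in> MJ \<Longrightarrow> right_inv (P w)"
  unfolding right_inv_def
proof (intro ballI)
  fix v j assume w: "w \<in> MJ" and v: "v \<in> W" and j: "j \<in> J"
  have wW: "w \<in> W" "w (a j) \<in> pos" using w j min_reps_iff[OF J] by auto
  show "P w (v \<circ> s (a j)) = P w v"
    using rdd_mult[OF P_gkm[OF wW(1)] v J_Ix[OF j]] rdd_P[OF wW(1) J_Ix[OF j] v] wW(2) by simp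
qed

lemma push_closed: "gkm q \<Longrightarrow> right_inv q \<Longrightarrow> push q \<in> HJ"
  unfolding push_def by (rule HT_I) (auto simp: right_inv_min_rep)

definition pP :: "('v \<Rightarrow> 'v) \<Rightarrow> 'v gkm" where "pP w = push (P w)"

lemma pP_closed: "w \<in> MJ \<Longrightarrow> pP w \<in> HJ"
  unfolding pP_def using push_closed P_gkm P_right_inv min_reps_W[OF J] by blast

lemma pull_pP: "w \<in> MJ \<Longrightarrow> v \<in> W \<Longrightarrow> pull (pP w) v = P w v"
  unfolding pP_def using pull_push P_right_inv by blast

text \<open>Some \<open>j\<close> in \<open>J\<close> is a descent of \<open>w\<close>. Right
  invariance makes \<open>rdd j q\<close> vanish, and its coefficient at
  \<open>w \<circ> s (a j)\<close> is the one of \<open>q\<close> at \<open>w\<close>.\<close>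

lemma cf_outside:
  assumes "gkm q" "right_inv q" "w \<in> W" "w \<notin> MJ"
  shows "cf q w = 0"
proof -
  obtain j where j: "j \<in> J" "w (a j) \<notin> pos" using assms(3,4) min_reps_iff[OF J] by auto
  define u where "u = w \<circ> s (a j)"
  have u: "u \<in> W" "u (a j) \<in> pos" "u \<circ> s (a j) = w"
    using right_flip[OF assms(3) J_Ix[OF j(1)]] j(2) unfolding u_def by auto
  have "rdd j q v = 0" if v: "v \<in> W" for v
    using assms(2) v j(1) by (intro rdd_eqI[OF assms(1) v J_Ix[OF j(1)]]) (simp add: right_inv_def)
  then have "cf (rdd j q) u = cf (\<lambda>v. 0) u"
    using u(1) by (intro cf_cong gkm_const) auto
  then show ?thesis using cf_rdd[OF assms(1) J_Ix[OF j(1)] u(1)] u cf_0 by simp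
qed

text \<open>Among the positive roots, a simple reflection from \<open>J\<close> makes only its own
  root negative, and the reflection in that root lies in the parabolic subgroup. The assumption on
  \<open>s \<gamma>\<close> survives conjugation in this subgroup, so the argument passes along a
  word.\<close>

lemma not_parabolic_neg:
  assumes "x \<in> parabolic R J" "\<gamma> \<in> roots R" "\<gamma> \<notin> pos" "s \<gamma> \<notin> parabolic R J"
  shows "x \<gamma> \<notin> pos"
proof -
  obtain ws where ws: "set ws \<subseteq> J" "x = word ws" using assms(1) parabolic_word[OF J] by auto
  have "word ws \<gamma> \<notin> pos \<and> s (word ws \<gamma>) \<notin> parabolic R J" using ws(1)
  proof (induction ws)
    case (Cons j ws)
    define \<delta> where "\<delta> = word ws \<gamma>"
    have IH: "\<delta> \<notin> pos" "s \<delta> \<notin> parabolic R J" using Cons by (auto simp: \<delta>_def)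
    have j: "j \<in> J" "j \<in> Ix" using Cons.prems J by auto
    have aj: "a j \<in> roots R" by (rule a_root[OF j(2)])
    have \<delta>: "\<delta> \<in> roots R" unfolding \<delta>_def using Cons.prems J by (intro word_roots assms(2)) auto
    have "- \<delta> \<noteq> a j" using IH(2) parabolic_s[OF J j(1)] s_uminus[OF \<delta>] by auto
    moreover have "- \<delta> \<in> pos" using IH(1) neg_pos[OF \<delta>] by simp
    ultimately have "s (a j) (- \<delta>) \<in> pos" using simple_permutes_pos[OF j(2)] by blast
    then have "s (a j) \<delta> \<notin> pos" using uminus_notin_pos lmap_uminus[OF lmap_s[OF aj], of \<delta>] by fastforce
    moreover have "s (s (a j) \<delta>) \<notin> parabolic R J"
    proof
      assume "s (s (a j) \<delta>) \<in> parabolic R J"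
      then have "s (a j) \<circ> (s (s (a j) \<delta>) \<circ> s (a j)) \<in> parabolic R J"
        using parabolic_comp[OF J] parabolic_s[OF J j(1)] by blast
      moreover have "s (a j) \<circ> (s (s (a j) \<delta>) \<circ> s (a j)) = s \<delta>"
        unfolding W_conj[OF W_s[OF aj] \<delta>] using s_invol[OF aj] by (auto simp: fun_eq_iff)
      ultimately show False using IH(2) by simp
    qed
    ultimately show ?case by (simp add: word_Cons \<delta>_def)
  qed (use assms in simp)
  then show ?thesis using ws(2) by simp
qed

text \<open>If the given representative keeps \<alpha> positive, the edge starts at the other end,
  where \<open>s \<alpha> \<circ> v\<close> represents the source and makes \<alpha> negative. Both
  branches of the definition thus take one normal form.\<close>

lemma moment_edgesD:
  assumes "(C, \<alpha>, D) \<in> moment_edges R J"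
  obtains v where "v \<in> W" "\<alpha> \<in> pos" "wcoset R J (s \<alpha> \<circ> v) \<noteq> wcoset R J v" "inv' v \<alpha> \<notin> pos"
    "C = wcoset R J v" "D = wcoset R J (s \<alpha> \<circ> v)"
proof -
  obtain v where v: "\<alpha> \<in> pos" "v \<in> W"
    and ne: "wcoset R J (s \<alpha> \<otimes>\<^bsub>weyl R\<^esub> v) \<noteq> wcoset R J v"
    and ifs: "if - ((inv\<^bsub>weyl R\<^esub> v) \<alpha>) \<in> pos
      then C = wcoset R J v \<and> D = wcoset R J (s \<alpha> \<otimes>\<^bsub>weyl R\<^esub> v)
      else C = wcoset R J (s \<alpha> \<otimes>\<^bsub>weyl R\<^esub> v) \<and> D = wcoset R J v"
    using assms by (auto simp: moment_edges_def)
  have r: "\<alpha> \<in> roots R" using v(1) pos_roots_subset by simp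
  have m: "s \<alpha> \<otimes>\<^bsub>weyl R\<^esub> v = s \<alpha> \<circ> v" by (rule W_mult[OF W_s[OF r] v(2)])
  have n: "- inv' v \<alpha> \<in> pos \<longleftrightarrow> inv' v \<alpha> \<notin> pos" by (rule neg_pos[OF W_roots[OF W_inv[OF v(2)] r]])
  show thesis
  proof (cases "inv' v \<alpha> \<in> pos")
    case False
    then show ?thesis using that[of v] v ne ifs n by (simp add: m weyl_inv)
  next
    case True
    let ?u = "s \<alpha> \<circ> v"
    have u: "?u \<in> W" by (rule W_comp[OF W_s[OF r] v(2)])
    have ssv: "s \<alpha> \<circ> ?u = v" using s_invol[OF r] by (auto simp: fun_eq_iff)
    have "inv' ?u \<alpha> \<notin> pos"
      using True W_neg[OF W_inv[OF v(2)] r] unfolding inv_s_comp[OF v(2) r] by (simp add: s_self r)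
    then show ?thesis
      using that[of ?u] u v ne ifs n True by (simp only: m weyl_inv ssv if_False) auto
  qed
qed

text \<open>An edge leaving the coset may come from another representative
  \<open>w \<circ> x\<close>; \<open>not_parabolic_neg\<close> carries its sign condition over to
  \<open>w\<close>. Conversely, an inversion of \<open>w\<close> leads to a shorter element, which
  cannot lie in the coset of the minimal \<open>w\<close>, so the edge is present.\<close>

lemma moment_edges_source:
  assumes w: "w \<in> MJ"
  shows "{e \<in> moment_edges R J. fst e = wcoset R J w}
    = (\<lambda>\<alpha>. (wcoset R J w, \<alpha>, wcoset R J (s \<alpha> \<circ> w))) ` Inv w"
proof (intro equalityI subsetI)
  have wW: "w \<in> W" by (rule min_reps_W[OF J w])
  fix e assume e: "e \<in> {e \<in> moment_edges R J. fst e = wcoset R J w}"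
  obtain C \<alpha> D where C: "e = (C, \<alpha>, D)" by (cases e)
  obtain v where v: "v \<in> W" "\<alpha> \<in> pos" "wcoset R J (s \<alpha> \<circ> v) \<noteq> wcoset R J v" "inv' v \<alpha> \<notin> pos"
    "C = wcoset R J v" "D = wcoset R J (s \<alpha> \<circ> v)"
    using e moment_edgesD[of C \<alpha> D] unfolding C by blast
  have r: "\<alpha> \<in> roots R" using v(2) pos_roots_subset by simp
  have "wcoset R J v = wcoset R J w" using e v(5) C by simp
  then obtain x where x: "x \<in> parabolic R J" "v = w \<circ> x" using wcoset_eq_iff[OF J v(1) wW] by blast
  have xW: "x \<in> W" by (rule parabolic_W[OF J x(1)])
  define \<gamma> where "\<gamma> = inv' v \<alpha>"
  have \<gamma>: "\<gamma> \<in> roots R" "v \<gamma> = \<alpha>" using W_roots[OF W_inv[OF v(1)] r] v(1) by (auto simp: \<gamma>_def)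
  have "s \<gamma> \<notin> parabolic R J"
  proof
    assume "s \<gamma> \<in> parabolic R J"
    then have "wcoset R J (v \<circ> s \<gamma>) = wcoset R J v" by (rule wcoset_comp[OF J v(1)])
    then show False using v(3) W_conj[OF v(1) \<gamma>(1)] \<gamma>(2) by simp
  qed
  then have "x \<gamma> \<notin> pos" using not_parabolic_neg[OF x(1) \<gamma>(1)] v(4) by (simp add: \<gamma>_def)
  moreover have "inv' w \<alpha> = x \<gamma>"
    using \<gamma>(2) x(2) wW by (metis W_inv_left o_apply)
  ultimately have "\<alpha> \<in> Inv w" using v(2) by (simp add: Inv_def)
  moreover have "D = wcoset R J (s \<alpha> \<circ> w)"
    using v(6) wcoset_comp[OF J W_comp[OF W_s[OF r] wW] x(1)] x(2) by (simp add: o_assoc)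
  ultimately show "e \<in> (\<lambda>\<alpha>. (wcoset R J w, \<alpha>, wcoset R J (s \<alpha> \<circ> w))) ` Inv w"
    using e C by auto
next
  have wW: "w \<in> W" by (rule min_reps_W[OF J w])
  fix e assume "e \<in> (\<lambda>\<alpha>. (wcoset R J w, \<alpha>, wcoset R J (s \<alpha> \<circ> w))) ` Inv w"
  then obtain \<alpha> where \<alpha>: "\<alpha> \<in> pos" "inv' w \<alpha> \<notin> pos" and e: "e = (wcoset R J w, \<alpha>, wcoset R J (s \<alpha> \<circ> w))"
    by (auto simp: Inv_def)
  have r: "\<alpha> \<in> roots R" using \<alpha>(1) pos_roots_subset by simp
  have sw: "s \<alpha> \<circ> w \<in> W" by (rule W_comp[OF W_s[OF r] wW])
  have "wcoset R J (s \<alpha> \<circ> w) \<noteq> wcoset R J w"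
  proof
    assume "wcoset R J (s \<alpha> \<circ> w) = wcoset R J w"
    then have "s \<alpha> \<circ> w \<in> wcoset R J w" using wcoset_self[OF J sw] by simp
    then have "len w \<le> len (s \<alpha> \<circ> w)" using min_rep_wcoset(2)[OF J wW] min_rep_of_min_reps[OF J w] by metis
    then show False using len_reflect_less[OF wW \<alpha>] by simp
  qed
  moreover have "- inv' w \<alpha> \<in> pos" using \<alpha> neg_pos[OF W_roots[OF W_inv[OF wW] r]] by simp
  ultimately show "e \<in> {e \<in> moment_edges R J. fst e = wcoset R J w}"
    using \<alpha>(1) wW W_mult[OF W_s[OF r] wW] weyl_inv[OF wW] unfolding e moment_edges_def
    by (simp, intro bexI[of _ w]) simp_all
qed

lemma edge_product:
  assumes "w \<in> MJ"
  shows "(\<Prod>(C, \<alpha>, D) \<in> {e \<in> moment_edges R J. fst e = wcoset R J w}. lf \<alpha>) = inv_prod w"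
  unfolding moment_edges_source[OF assms] inv_prod_def
  by (subst prod.reindex) (auto simp: inj_on_def)

lemma coset_le_iff: "w \<in> MJ \<Longrightarrow> v \<in> W \<Longrightarrow>
    coset_le R (wcoset R J w) (wcoset R J v) \<longleftrightarrow> bruhat_le R w (min_rep R (wcoset R J v))"
  by (simp add: coset_le_def min_rep_of_min_reps[OF J])

lemma is_flow_up_pP: "w \<in> MJ \<Longrightarrow> is_flow_up R J w (pP w)"
  unfolding is_flow_up_def
proof (intro conjI)
  assume w: "w \<in> MJ"
  have wW: "w \<in> W" by (rule min_reps_W[OF J w])
  show "pP w \<in> HJ" by (rule pP_closed[OF w])
  have val: "pP w (wcoset R J v) = P w v" if "v \<in> W" for v
    using pull_pP[OF w that] by (simp add: pull_def)
  show "\<exists>d. \<forall>C\<in>Wc. homogeneous d (pP w C)"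
    using P_hom[OF wW] by (intro exI[of _ "len w"]) (auto simp: wcosets_def val)
  show "\<forall>C\<in>Wc. pP w C \<noteq> 0 \<longleftrightarrow> coset_le R (wcoset R J w) C"
  proof
    fix C assume "C \<in> Wc"
    then obtain v where v: "v \<in> W" "C = wcoset R J v" by (auto simp: wcosets_def)
    have "pP w C = P w (min_rep R C)"
      using val[OF min_rep_W[OF v(1)]] wcoset_min_rep[OF v(1)] v(2) by simp
    then show "pP w C \<noteq> 0 \<longleftrightarrow> coset_le R (wcoset R J w) C"
      using coset_le_iff[OF w v(1)] P_nonneg_support[OF wW min_rep_W[OF v(1)]] v(2) by simp
  qed
  show "pP w (wcoset R J w) = (\<Prod>(C, \<alpha>, D) \<in> {e \<in> moment_edges R J. fst e = wcoset R J w}. lf \<alpha>)"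
    using val[OF wW] P_self[OF wW] edge_product[OF w] by simp
qed

text \<open>The nonzero value at \<open>w\<close> fixes the degree. A coset in the support has a
  shortest element that is either \<open>w\<close>, so that all its other elements are longer, or
  itself longer than \<open>w\<close>; this yields the required zeros.\<close>

lemma is_flow_up_schubert:
  assumes w: "w \<in> MJ" and p: "is_flow_up R J w p"
  shows "schubert w (pull p)"
proof -
  have wW: "w \<in> W" by (rule min_reps_W[OF J w])
  have pw: "pull p w = inv_prod w" using p edge_product[OF w] by (simp add: is_flow_up_def pull_def)
  obtain d where d: "\<And>v. v \<in> W \<Longrightarrow> homogeneous d (pull p v)"
    using p by (auto simp: is_flow_up_def wcosets_def pull_def)
  have "d = len w"
    using homogeneous_unique[OF d[OF wW]] homogeneous_inv_prod[OF wW] inv_prod_nonzero pw by simp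
  moreover have "pull p v = 0" if v: "v \<in> W" "len v \<le> len w" "v \<noteq> w" for v
  proof (rule ccontr)
    assume "pull p v \<noteq> 0"
    then have "coset_le R (wcoset R J w) (wcoset R J v)"
      using p v(1) by (auto simp: is_flow_up_def wcosets_def pull_def)
    then have "bruhat_le R w (min_rep R (wcoset R J v))" using coset_le_iff[OF w v(1)] by simp
    then have "w = min_rep R (wcoset R J v) \<or> len w < len (min_rep R (wcoset R J v))"
      by (rule bruhat_len)
    then show False
      using min_rep_wcoset(2)[OF J v(1) wcoset_self[OF J v(1)]] v min_rep_len_eq[OF J v(1)]
      by (metis le_trans not_less)
  qed
  moreover have "gkm (pull p)" using p HT_gkm by (simp add: is_flow_up_def)
  ultimately show ?thesis using d pw by (simp add: schubert_def)
qed

lemma flow_up_eq: "w \<in> MJ \<Longrightarrow> flow_up R J w = pP w"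
  unfolding flow_up_def
proof (rule the_equality)
  assume w: "w \<in> MJ"
  show "is_flow_up R J w (pP w)" by (rule is_flow_up_pP[OF w])
  fix p assume p: "is_flow_up R J w p"
  then have pc: "p \<in> HJ" by (simp add: is_flow_up_def)
  show "p = pP w"
    using P_eqI[OF is_flow_up_schubert[OF w p] min_reps_W[OF J w]] pull_pP[OF w]
    by (intro HT_eqI[OF pc pP_closed[OF w]]) simp
qed

subsection \<open>The kernel of the coefficient functionals\<close>

abbreviation NJ :: "'v gkm set" where "NJ \<equiv> simple_root_ideal R J"

lemma NJ_gens:
  "((\<lambda>i. HT_const R J (lf (a i))) ` {1..rank R}) \<subseteq> HJ"
  using HT_const_closed lf_in by auto

lemma NJ_ideal: "ideal NJ (HT R J)"
  unfolding simple_root_ideal_def by (rule HT.genideal_ideal[OF NJ_gens])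

lemma HT_const_hom:
  "HT_const R J f \<oplus>\<^bsub>HT R J\<^esub> HT_const R J g = HT_const R J (f + g)"
  "HT_const R J f \<otimes>\<^bsub>HT R J\<^esub> HT_const R J g = HT_const R J (f * g)"
  by (auto simp: HT_simps HT_const_def)

lemma NJ_add: "p \<in> NJ \<Longrightarrow> q \<in> NJ \<Longrightarrow> p \<oplus>\<^bsub>HT R J\<^esub> q \<in> NJ"
  using additive_subgroup.a_closed[OF ideal.axioms(1)[OF NJ_ideal]] .

lemma NJ_mult: "p \<in> NJ \<Longrightarrow> q \<in> HJ \<Longrightarrow> p \<otimes>\<^bsub>HT R J\<^esub> q \<in> NJ"
  using ideal.I_r_closed[OF NJ_ideal] .

lemma NJ_0: "\<zero>\<^bsub>HT R J\<^esub> \<in> NJ"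
  using additive_subgroup.zero_closed[OF ideal.axioms(1)[OF NJ_ideal]] .

text \<open>The simple roots generate the ideal of all polynomials without constant term, and the
  generators of \<open>NJ\<close> are their images.\<close>

lemma HT_const_NJ:
  assumes "f \<in> S"
  shows "HT_const R J (f - const_poly (eval0 f)) \<in> NJ"
  using assms
proof (induction rule: polys_in_induct)
  case (const c)
  then show ?case using NJ_0 by (simp add: HT_zero_const)
next
  case (var i)
  have "HT_const R J (lf (a i)) \<in> NJ"
    using HT.genideal_self[OF NJ_gens] var unfolding simple_root_ideal_def by (auto simp: Ix_def)
  then show ?case using var by (simp add: lf_simple)
next
  case (add f g)
  from NJ_add[OF add.IH] show ?case
    by (simp add: HT_const_hom eval0_add const_poly_add algebra_simps)
next
  case (mult f g)
  have "HT_const R J (f - const_poly (eval0 f)) \<otimes>\<^bsub>HT R J\<^esub> HT_const R J g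
      \<oplus>\<^bsub>HT R J\<^esub> HT_const R J (g - const_poly (eval0 g)) \<otimes>\<^bsub>HT R J\<^esub> HT_const R J (const_poly (eval0 f)) \<in> NJ"
    using mult by (intro NJ_add NJ_mult HT_const_closed) auto
  then show ?case
    by (simp add: HT_const_hom eval0_mult const_poly_mult algebra_simps)
qed

lemma E_NJ:
  assumes "p \<in> NJ" "w \<in> W"
  shows "E (pull p) w = 0"
proof -
  define K where "K = {p \<in> HJ. \<forall>w\<in>W. E (pull p) w = 0}"
  have "ideal K (HT R J)"
  proof (rule idealI_minus[OF cring_HT])
    have "cf (pull \<zero>\<^bsub>HT R J\<^esub>) w = cf (\<lambda>v. 0) w" if "w \<in> W" for w
      using that by (intro cf_cong gkm_const) (auto simp: pull_simps)
    then show "\<zero>\<^bsub>HT R J\<^esub> \<in> K" by (simp add: K_def cf_0)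
    show "p \<ominus>\<^bsub>HT R J\<^esub> q \<in> K" if pq: "p \<in> K" "q \<in> K" for p q
    proof -
      have c: "p \<in> HJ" "q \<in> HJ" using pq by (auto simp: K_def)
      have "cf (pull (p \<ominus>\<^bsub>HT R J\<^esub> q)) w = cf (pull p) w - cf (pull q) w" if w: "w \<in> W" for w
        unfolding cf_diff[OF HT_gkm[OF c(1)] HT_gkm[OF c(2)] w, symmetric]
        using HT_minus[OF c] w by (intro cf_cong gkm_diff HT_gkm c) auto
      then show ?thesis using pq by (simp add: K_def eval0_diff)
    qed
    show "q \<otimes>\<^bsub>HT R J\<^esub> p \<in> K" if pq: "p \<in> K" "q \<in> HJ" for p q
    proof -
      have c: "p \<in> HJ" using pq by (simp add: K_def)
      have "E (pull (q \<otimes>\<^bsub>HT R J\<^esub> p)) w = 0" if w: "w \<in> W" for w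
      proof -
        have "cf (pull (q \<otimes>\<^bsub>HT R J\<^esub> p)) w = cf (\<lambda>v. pull p v * pull q v) w"
          using w by (intro cf_cong gkm_mult HT_gkm c pq(2)) (auto simp: pull_simps)
        then show ?thesis
          using eval0_cf_mult_null[OF HT_gkm[OF c] HT_gkm[OF pq(2)] _ w] pq(1) by (simp add: K_def)
      qed
      then show ?thesis using HT_mult_closed[OF pq(2) c] by (simp add: K_def)
    qed
  qed (auto simp: K_def)
  moreover have "(\<lambda>i. HT_const R J (lf (a i))) ` {1..rank R} \<subseteq> K"
  proof
    fix p assume "p \<in> (\<lambda>i. HT_const R J (lf (a i))) ` {1..rank R}"
    then obtain i where p: "p = HT_const R J (lf (a i))" by blast
    have "cf (pull p) w = cf (\<lambda>v. lf (a i) * P id v) w" if "w \<in> W" for w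
      using that by (intro cf_cong gkm_mult gkm_const lf_in P_gkm W_id) (auto simp: p pull_simps P_id)
    then have "E (pull p) w = 0" if "w \<in> W" for w
      using that cf_mult[OF P_gkm[OF W_id] lf_in] by (simp add: eval0_mult)
    then show "p \<in> K" using HT_const_closed[OF lf_in] by (simp add: K_def p)
  qed
  ultimately have "NJ \<subseteq> K"
    unfolding simple_root_ideal_def by (rule HT.genideal_minimal)
  then show ?thesis using assms by (auto simp: K_def)
qed

definition pP_comb :: "(('v \<Rightarrow> 'v) \<Rightarrow> cpoly) \<Rightarrow> 'v gkm" where
  "pP_comb c = (\<Oplus>\<^bsub>HT R J\<^esub>w\<in>MJ. HT_const R J (c w) \<otimes>\<^bsub>HT R J\<^esub> pP w)"

lemma pP_comb_term_closed:
  "w \<in> MJ \<Longrightarrow> c w \<in> S \<Longrightarrow> HT_const R J (c w) \<otimes>\<^bsub>HT R J\<^esub> pP w \<in> HJ"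
  by (intro HT_mult_closed HT_const_closed pP_closed)

lemma pP_comb_closed: "(\<And>w. w \<in> MJ \<Longrightarrow> c w \<in> S) \<Longrightarrow> pP_comb c \<in> HJ"
  unfolding pP_comb_def using pP_comb_term_closed by (intro HT.finsum_closed) auto

lemma pull_pP_comb:
  assumes "\<And>w. w \<in> MJ \<Longrightarrow> c w \<in> S" "v \<in> W"
  shows "pull (pP_comb c) v = (\<Sum>w\<in>MJ. c w * P w v)"
  unfolding pP_comb_def
  using HT_finsum[of "MJ" "\<lambda>w. HT_const R J (c w) \<otimes>\<^bsub>HT R J\<^esub> pP w" v]
    finite_min_reps[OF J] pP_comb_term_closed assms
  by (simp add: pull_simps pull_pP)

lemma sum_min_reps:
  assumes "\<And>w. w \<in> W \<Longrightarrow> w \<notin> MJ \<Longrightarrow> c w = 0"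
  shows "(\<Sum>w\<in>W. c w * P w v) = (\<Sum>w\<in>MJ. c w * P w v)"
  using assms min_reps_W[OF J] by (intro sum.mono_neutral_right finite_W) auto

lemma cf_pP_comb:
  assumes "\<And>w. w \<in> MJ \<Longrightarrow> c w \<in> S" "w \<in> W"
  shows "cf (pull (pP_comb c)) w = (if w \<in> MJ then c w else 0)"
proof (rule cf_eqI[OF HT_gkm[OF pP_comb_closed[OF assms(1)]] _ assms(2)])
  fix v assume v: "v \<in> W"
  have "(\<Sum>w\<in>W. (if w \<in> MJ then c w else 0) * P w v)
      = (\<Sum>w\<in>MJ. (if w \<in> MJ then c w else 0) * P w v)"
    by (rule sum_min_reps) auto
  then show "pull (pP_comb c) v = (\<Sum>w\<in>W. (if w \<in> MJ then c w else 0) * P w v)"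
    using pull_pP_comb[OF assms(1) v] by simp
qed

lemma HT_expansion: "p \<in> HJ \<Longrightarrow> p = pP_comb (cf (pull p))"
proof (rule HT_eqI)
  assume p: "p \<in> HJ"
  have c: "\<And>w. w \<in> MJ \<Longrightarrow> cf (pull p) w \<in> S"
    using cf(1)[OF HT_gkm[OF p]] min_reps_W[OF J] by blast
  then show "pP_comb (cf (pull p)) \<in> HJ" by (rule pP_comb_closed)
  fix v assume v: "v \<in> W"
  have "pull p v = (\<Sum>w\<in>W. cf (pull p) w * P w v)" by (rule cf(2)[OF HT_gkm[OF p] v])
  also have "\<dots> = (\<Sum>w\<in>MJ. cf (pull p) w * P w v)"
    by (rule sum_min_reps[OF cf_outside[OF HT_gkm[OF p] pull_right_inv]])
  also have "\<dots> = pull (pP_comb (cf (pull p))) v"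
    by (rule pull_pP_comb[symmetric]) (use c v in auto)
  finally show "pull p v = pull (pP_comb (cf (pull p))) v" .
qed

text \<open>In the expansion in Schubert classes, a coefficient without constant term puts its
  summand into \<open>NJ\<close>. So a class of ordinary cohomology amounts to a family of constant
  terms indexed by \<open>MJ\<close>.\<close>

lemma NJ_iff:
  assumes p: "p \<in> HJ"
  shows "p \<in> NJ \<longleftrightarrow> (\<forall>w\<in>MJ. E (pull p) w = 0)"
proof
  assume "p \<in> NJ"
  then show "\<forall>w\<in>MJ. E (pull p) w = 0" using E_NJ min_reps_W[OF J] by blast
next
  assume z: "\<forall>w\<in>MJ. E (pull p) w = 0"
  have tm: "HT_const R J (cf (pull p) w) \<otimes>\<^bsub>HT R J\<^esub> pP w \<in> NJ" if w: "w \<in> MJ" for w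
    using HT_const_NJ[OF cf(1)[OF HT_gkm[OF p] min_reps_W[OF J w]]] z w pP_closed[OF w]
    by (simp add: NJ_mult)
  have sum: "(\<Oplus>\<^bsub>HT R J\<^esub>w\<in>A. f w) \<in> NJ" if "finite A" "\<And>w. w \<in> A \<Longrightarrow> f w \<in> NJ" for A and f :: "_ \<Rightarrow> 'v gkm"
    using that
  proof (induction A rule: finite_induct)
    case (insert w A)
    then have "(\<Oplus>\<^bsub>HT R J\<^esub>x\<in>insert w A. f x) = f w \<oplus>\<^bsub>HT R J\<^esub> (\<Oplus>\<^bsub>HT R J\<^esub>x\<in>A. f x)"
      using ideal.Icarr[OF NJ_ideal] by (intro HT.finsum_insert) auto
    then show ?case using insert NJ_add by simp
  qed (simp add: NJ_0)
  have "pP_comb (cf (pull p)) \<in> NJ"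
    unfolding pP_comb_def by (rule sum[OF finite_min_reps[OF J] tm])
  then show "p \<in> NJ" using HT_expansion[OF p] by simp
qed

subsection \<open>The homomorphism to the coinvariant ring\<close>

text \<open>A lift to polynomials of the homomorphism sought: it respects sums and scalars exactly,
  but products only modulo \<open>CI\<close>.\<close>

definition sch_image :: "'v gkm \<Rightarrow> cpoly" where
  "sch_image p = (\<Sum>w\<in>MJ. const_poly (E (pull p) w) * Sch w)"

lemma Sch_comb_in: "(\<Sum>w\<in>MJ. const_poly (c w) * Sch w) \<in> S"
  using Sch_in min_reps_W[OF J] by (intro polys_in_sum polys_in_mult) auto

lemma sch_image_in: "sch_image p \<in> S"
  unfolding sch_image_def by (rule Sch_comb_in)

lemma E_char_map_comb:
  assumes "x \<in> W"
  shows "E (char_map (\<Sum>w\<in>MJ. const_poly (c w) * Sch w)) x = (if x \<in> MJ then c x else 0)"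
proof -
  have g: "gkm (\<lambda>v. const_poly (c w) * char_map (Sch w) v)" if "w \<in> MJ" for w
    using Sch_in min_reps_W[OF J that] by (intro gkm_mult gkm_const char_map_gkm) auto
  have "cf (char_map (\<Sum>w\<in>MJ. const_poly (c w) * Sch w)) x
      = cf (\<lambda>v. \<Sum>w\<in>MJ. const_poly (c w) * char_map (Sch w) v) x"
    using assms g by (intro cf_cong gkm_sum) (auto simp: char_map_sum char_map_mult)
  also have "\<dots> = (\<Sum>w\<in>MJ. cf (\<lambda>v. const_poly (c w) * char_map (Sch w) v) x)"
    by (rule cf_sum[OF g assms])
  also have "\<dots> = (\<Sum>w\<in>MJ. const_poly (c w) * cf (char_map (Sch w)) x)"
    using Sch_in min_reps_W[OF J] assms by (intro sum.cong refl cf_mult char_map_gkm) auto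
  also have "eval0 \<dots> = (\<Sum>w\<in>MJ. if w = x then c x else 0)"
    using min_reps_W[OF J] assms
    by (auto simp: eval0_sum eval0_mult eval0_cf_char_map_Sch intro!: sum.cong)
  finally show ?thesis using finite_min_reps[OF J] by simp
qed

lemma E_char_map_sch_image: "p \<in> HJ \<Longrightarrow> x \<in> W \<Longrightarrow> E (char_map (sch_image p)) x = E (pull p) x"
  using cf_outside[OF HT_gkm pull_right_inv] by (auto simp: sch_image_def E_char_map_comb)

text \<open>Under the characteristic map both polynomials have the constant terms of the product of
  the pulled-back classes, and \<open>CI_eqI\<close> shows that these determine a polynomial modulo
  \<open>CI\<close>.\<close>

lemma sch_image_mult:
  assumes "p \<in> HJ" "q \<in> HJ"
  shows "sch_image p * sch_image q - sch_image (p \<otimes>\<^bsub>HT R J\<^esub> q) \<in> CI"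
proof (rule CI_eqI[OF polys_in_mult[OF sch_image_in sch_image_in] sch_image_in])
  fix x assume x: "x \<in> W"
  have "E (char_map (sch_image p * sch_image q)) x = E (\<lambda>v. char_map (sch_image p) v * char_map (sch_image q) v) x"
    by (simp add: char_map_mult[abs_def])
  also have "\<dots> = E (\<lambda>v. pull p v * pull q v) x"
    using assms E_char_map_sch_image x by (intro E_mult_cong char_map_gkm sch_image_in HT_gkm) auto
  also have "cf (\<lambda>v. pull p v * pull q v) x = cf (pull (p \<otimes>\<^bsub>HT R J\<^esub> q)) x"
    using x by (intro cf_cong HT_gkm HT_mult_closed assms) (simp add: pull_simps)
  finally show "E (char_map (sch_image p * sch_image q)) x = E (char_map (sch_image (p \<otimes>\<^bsub>HT R J\<^esub> q))) x"
    using E_char_map_sch_image[OF HT_mult_closed[OF assms] x] by simp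
qed

lemma sch_image_add:
  assumes "p \<in> HJ" "q \<in> HJ"
  shows "sch_image (p \<oplus>\<^bsub>HT R J\<^esub> q) = sch_image p + sch_image q"
proof -
  have "cf (pull (p \<oplus>\<^bsub>HT R J\<^esub> q)) w = cf (pull p) w + cf (pull q) w" if w: "w \<in> MJ" for w
    unfolding cf_add[OF HT_gkm[OF assms(1)] HT_gkm[OF assms(2)] min_reps_W[OF J w], symmetric]
    using min_reps_W[OF J w] by (intro cf_cong gkm_add HT_gkm assms) (auto simp: pull_simps)
  then show ?thesis
    by (simp add: sch_image_def eval0_add const_poly_add distrib_right sum.distrib)
qed

lemma sch_image_scale:
  assumes "p \<in> HJ"
  shows "sch_image (HT_const R J (const_poly c) \<otimes>\<^bsub>HT R J\<^esub> p) = const_poly c * sch_image p"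
proof -
  have "cf (pull (HT_const R J (const_poly c) \<otimes>\<^bsub>HT R J\<^esub> p)) w = const_poly c * cf (pull p) w"
    if w: "w \<in> MJ" for w
    unfolding cf_mult[OF HT_gkm[OF assms] polys_in_const min_reps_W[OF J w], symmetric]
    using min_reps_W[OF J w] by (intro cf_cong gkm_mult gkm_const HT_gkm assms) (auto simp: pull_simps)
  then show ?thesis
    by (simp add: sch_image_def eval0_mult const_poly_mult sum_distrib_left mult_ac)
qed

lemma sch_image_lin: "sch_image (pP_comb (\<lambda>w. const_poly (c w))) = (\<Sum>w\<in>MJ. const_poly (c w) * Sch w)"
  unfolding sch_image_def using min_reps_W[OF J] by (intro sum.cong refl) (simp add: cf_pP_comb)

lemma E_pP: "w \<in> MJ \<Longrightarrow> x \<in> W \<Longrightarrow> E (pull (pP w)) x = (if x = w then 1 else 0)"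
proof -
  assume w: "w \<in> MJ" and x: "x \<in> W"
  have "cf (pull (pP w)) x = cf (P w) x"
    using x pull_pP[OF w] by (intro cf_cong P_gkm min_reps_W[OF J w]) auto
  then show ?thesis using cf_P[OF min_reps_W[OF J w] x] by simp
qed

lemma sch_image_pP: "w \<in> MJ \<Longrightarrow> sch_image (pP w) = Sch w"
proof -
  assume w: "w \<in> MJ"
  have "sch_image (pP w) = (\<Sum>x\<in>MJ. if x = w then Sch w else 0)"
    unfolding sch_image_def using E_pP[OF w] min_reps_W[OF J] by (intro sum.cong) auto
  then show ?thesis using w finite_min_reps[OF J] by simp
qed

lemma min_reps_id: "id \<in> MJ"
  by (simp add: min_reps_iff[OF J] W_id a_pos J_Ix)

lemma sch_image_one: "sch_image \<one>\<^bsub>HT R J\<^esub> = 1"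
proof -
  have "\<one>\<^bsub>HT R J\<^esub> = pP id"
    using pull_pP[OF min_reps_id] P_id
    by (intro HT_eqI HT.one_closed pP_closed[OF min_reps_id]) (simp add: pull_simps)
  then show ?thesis using sch_image_pP[OF min_reps_id] Sch_id by simp
qed

text \<open>Membership in either ideal means that all constant terms vanish, and
  \<open>sch_image\<close> preserves these. This is the injectivity of the map on ordinary
  cohomology.\<close>

lemma sch_image_CI_iff:
  assumes p: "p \<in> HJ"
  shows "sch_image p \<in> CI \<longleftrightarrow> p \<in> NJ"
proof -
  have "sch_image p \<in> CI \<longleftrightarrow> (\<forall>w\<in>W. E (pull p) w = 0)"
    unfolding CI_iff[OF sch_image_in] using E_char_map_sch_image[OF p] by simp
  also have "\<dots> \<longleftrightarrow> (\<forall>w\<in>MJ. E (pull p) w = 0)"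
    using min_reps_W[OF J] cf_outside[OF HT_gkm[OF p] pull_right_inv] eval0_0 by metis
  finally show ?thesis unfolding NJ_iff[OF p] .
qed

definition sch_hom :: "'v gkm \<Rightarrow> cpoly set" where "sch_hom p = coinv_class R (sch_image p)"

lemma sch_hom_hom: "ring_hom_ring (HT R J) (coinv_ring R) sch_hom"
proof (rule ring_hom_ringI[OF HT.ring_axioms coinv_ring_ring])
  fix p q assume pq: "p \<in> HJ" "q \<in> HJ"
  show "sch_hom p \<in> carrier (coinv_ring R)"
    unfolding sch_hom_def using ring_hom_closed[OF coinv_class_hom] sch_image_in by (simp add: carrier_S)
  have "coinv_class R (sch_image p * sch_image q) = coinv_class R (sch_image (p \<otimes>\<^bsub>HT R J\<^esub> q))"
    using coinv_class_eq_iff[OF polys_in_mult[OF sch_image_in sch_image_in] sch_image_in] sch_image_mult[OF pq] by blast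
  then show "sch_hom (p \<otimes>\<^bsub>HT R J\<^esub> q) = sch_hom p \<otimes>\<^bsub>coinv_ring R\<^esub> sch_hom q"
    using ring_hom_mult[OF coinv_class_hom, of "sch_image p" "sch_image q"] sch_image_in
    by (simp add: sch_hom_def carrier_S)
  show "sch_hom (p \<oplus>\<^bsub>HT R J\<^esub> q) = sch_hom p \<oplus>\<^bsub>coinv_ring R\<^esub> sch_hom q"
    using ring_hom_add[OF coinv_class_hom, of "sch_image p" "sch_image q"] sch_image_in
    by (simp add: sch_hom_def sch_image_add[OF pq] carrier_S)
next
  show "sch_hom \<one>\<^bsub>HT R J\<^esub> = \<one>\<^bsub>coinv_ring R\<^esub>"
    using ring_hom_one[OF coinv_class_hom] by (simp add: sch_hom_def sch_image_one)
qed

lemma sch_hom_kernel: "a_kernel (HT R J) (coinv_ring R) sch_hom = NJ"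
proof -
  have "sch_hom p = \<zero>\<^bsub>coinv_ring R\<^esub> \<longleftrightarrow> p \<in> NJ" if "p \<in> HJ" for p
    using coinv_class_eq_iff[OF sch_image_in polys_in_0, of p] sch_image_CI_iff[OF that]
    by (simp add: sch_hom_def coinv_class_zero)
  then show ?thesis
    using ideal.Icarr[OF NJ_ideal] by (auto simp: a_kernel_def')
qed

lemma sch_hom_image: "sch_hom ` HJ
    = {coinv_class R (\<Sum>w\<in>MJ. const_poly (c w) * Sch w) |c. True}"
proof (intro equalityI subsetI)
  fix X' assume "X' \<in> {coinv_class R (\<Sum>w\<in>MJ. const_poly (c w) * Sch w) |c. True}"
  then obtain c where "X' = sch_hom (pP_comb (\<lambda>w. const_poly (c w)))"
    by (auto simp: sch_hom_def sch_image_lin)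
  then show "X' \<in> sch_hom ` HJ" using pP_comb_closed by simp
qed (auto simp: sch_hom_def sch_image_def)

subsection \<open>Structure constants\<close>

lemma cohom_class_hom: "ring_hom_cring (HT R J) (cohom R J) (cohom_class R J)"
  using ideal.rcos_ring_hom_cring[OF NJ_ideal cring_HT]
  by (simp add: cohom_class_def[abs_def] cohom_def)

lemma cohom_class_eq_iff:
  assumes "p \<in> HJ" "q \<in> HJ"
  shows "cohom_class R J p = cohom_class R J q \<longleftrightarrow> (\<forall>w\<in>MJ. E (pull p) w = E (pull q) w)"
proof -
  have "cf (pull (p \<ominus>\<^bsub>HT R J\<^esub> q)) w = cf (pull p) w - cf (pull q) w" if w: "w \<in> MJ" for w
    unfolding cf_diff[OF HT_gkm[OF assms(1)] HT_gkm[OF assms(2)] min_reps_W[OF J w], symmetric]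
    using HT_minus[OF assms] min_reps_W[OF J w] by (intro cf_cong gkm_diff HT_gkm assms) auto
  then have "p \<ominus>\<^bsub>HT R J\<^esub> q \<in> NJ \<longleftrightarrow> (\<forall>w\<in>MJ. E (pull p) w = E (pull q) w)"
    using NJ_iff[OF HT.minus_closed[OF assms]] by (simp add: eval0_diff)
  then show ?thesis
    using HT.quotient_eq_iff_same_a_r_cos[OF NJ_ideal assms] by (simp add: cohom_class_def)
qed

lemma cohom_comb:
  "(\<Oplus>\<^bsub>cohom R J\<^esub>w\<in>MJ. cohom_scale R J (c w) (schubert_class R J w))
    = cohom_class R J (pP_comb (\<lambda>w. const_poly (c w)))"
proof -
  interpret cc: ring_hom_cring "HT R J" "cohom R J" "cohom_class R J" by (rule cohom_class_hom)
  have tm: "cohom_scale R J (c w) (schubert_class R J w)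
      = cohom_class R J (HT_const R J (const_poly (c w)) \<otimes>\<^bsub>HT R J\<^esub> pP w)" if "w \<in> MJ" for w
    using that pP_closed HT_const_closed[OF polys_in_const]
    by (simp add: cohom_scale_def schubert_class_def flow_up_eq)
  have cl: "(\<lambda>w. HT_const R J (const_poly (c w)) \<otimes>\<^bsub>HT R J\<^esub> pP w) \<in> MJ \<rightarrow> HJ"
    using pP_comb_term_closed[OF _ polys_in_const] by simp
  show ?thesis
    unfolding pP_comb_def cc.hom_finsum[OF cl]
    by (rule cc.S.finsum_cong') (use tm cl in \<open>auto simp: Pi_iff\<close>)
qed

lemma struct_const_eq:
  assumes u: "u \<in> MJ" and v: "v \<in> MJ" and w: "w \<in> MJ"
  shows "struct_const R J u v w = E (pull (pP u \<otimes>\<^bsub>HT R J\<^esub> pP v)) w"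
proof -
  interpret cc: ring_hom_cring "HT R J" "cohom R J" "cohom_class R J" by (rule cohom_class_hom)
  let ?r = "pP u \<otimes>\<^bsub>HT R J\<^esub> pP v"
  \<comment> \<open>\<open>struct_const\<close> is described as a function that is 0 outside the
    minimal representatives, so the witness has to be this extension by 0.\<close>
  define d where "d x = (if x \<in> MJ then E (pull ?r) x else 0)" for x
  have r: "?r \<in> HJ" by (rule HT_mult_closed[OF pP_closed[OF u] pP_closed[OF v]])
  have prod: "schubert_class R J u \<otimes>\<^bsub>cohom R J\<^esub> schubert_class R J v = cohom_class R J ?r"
    using pP_closed[OF u] pP_closed[OF v] by (simp add: schubert_class_def flow_up_eq u v)
  have iff: "schubert_class R J u \<otimes>\<^bsub>cohom R J\<^esub> schubert_class R J v =
      (\<Oplus>\<^bsub>cohom R J\<^esub>x\<in>MJ. cohom_scale R J (c x) (schubert_class R J x))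
    \<longleftrightarrow> (\<forall>x\<in>MJ. E (pull ?r) x = c x)" for c
    unfolding prod cohom_comb using cohom_class_eq_iff[OF r pP_comb_closed, of "\<lambda>w. const_poly (c w)"]
    by (simp add: cf_pP_comb min_reps_W[OF J])
  have "struct_const R J u v = d"
    unfolding struct_const_def iff
    by (rule the_equality) (auto simp: d_def fun_eq_iff)
  then show ?thesis using w by (simp add: d_def)
qed

end

section \<open>Comparison with the given definitions, and the isomorphism\<close>

lemma schubert_poly_eq: "w \<in> W \<Longrightarrow> schubert_poly R w = Sch w"
proof -
  assume w: "w \<in> W"
  have iw: "inv' w \<in> min_reps R {}" using W_inv[OF w] by (simp add: min_reps_empty)
  have "flow_up R {} (inv' w) (wcoset R {} v) = P (inv' w) v" if "v \<in> W" for v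
    using flow_up_eq[OF _ iw] pull_pP[OF _ iw that] by (simp add: pull_def)
  then show ?thesis
    by (simp add: schubert_poly_def kappa_def Sch_def average_def weyl_inv[OF w])
qed

lemma schubert_span_eq:
  assumes "J \<subseteq> Ix"
  shows "schubert_span R J = sch_hom J ` carrier (HT R J)"
proof -
  have "(\<Sum>w\<in>min_reps R J. const_poly (c w) * schubert_poly R w)
      = (\<Sum>w\<in>min_reps R J. const_poly (c w) * Sch w)" for c
    using min_reps_W[OF assms] by (intro sum.cong) (auto simp: schubert_poly_eq)
  then show ?thesis by (simp add: schubert_span_def sch_hom_image[OF assms])
qed

lemma schubert_span_subring:
  assumes "J \<subseteq> Ix"
  shows "subring (schubert_span R J) (coinv_ring R)"
proof -
  interpret h: ring_hom_ring "HT R J" "coinv_ring R" "sch_hom J" by (rule sch_hom_hom[OF assms])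
  show ?thesis unfolding schubert_span_eq[OF assms] by (rule h.img_is_subring[OF h.R.carrier_is_subring])
qed

lemma cohom_iso:
  assumes J: "J \<subseteq> Ix"
  shows "\<exists>h \<in> ring_iso (cohom R J) ((coinv_ring R)\<lparr>carrier := schubert_span R J\<rparr>).
    \<forall>c. \<forall>x \<in> carrier (cohom R J). h (cohom_scale R J c x) = coinv_scale R c (h x)"
proof (intro bexI allI ballI)
  interpret h: ring_hom_ring "HT R J" "coinv_ring R" "sch_hom J" by (rule sch_hom_hom[OF J])
  interpret cc: ring_hom_cring "HT R J" "cohom R J" "cohom_class R J" by (rule cohom_class_hom[OF J])
  \<comment> \<open>The map of the first isomorphism theorem: \<open>sch_hom J\<close> is constant
    on each coset of its kernel, so the image of a coset has a single element.\<close>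
  let ?h = "\<lambda>Z. the_elem (sch_hom J ` Z)"
  show "?h \<in> ring_iso (cohom R J) ((coinv_ring R)\<lparr>carrier := schubert_span R J\<rparr>)"
    using h.FactRing_iso_set_aux unfolding sch_hom_kernel[OF J] schubert_span_eq[OF J] cohom_def .
  have h_class: "?h (cohom_class R J p) = sch_hom J p" if "p \<in> carrier (HT R J)" for p
    using h.the_elem_simp[OF that] unfolding sch_hom_kernel[OF J] cohom_class_def .
  fix c x assume "x \<in> carrier (cohom R J)"
  then obtain p where p: "p \<in> carrier (HT R J)" "x = cohom_class R J p"
    by (auto simp: cohom_def FactRing_def A_RCOSETS_def' cohom_class_def)
  have k: "HT_const R J (const_poly c) \<in> carrier (HT R J)" by (rule HT_const_closed[OF J polys_in_const])
  have scale: "cohom_scale R J c x = cohom_class R J (HT_const R J (const_poly c) \<otimes>\<^bsub>HT R J\<^esub> p)"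
    unfolding cohom_scale_def p(2) by (rule cc.hom_mult[OF k p(1), symmetric])
  have "?h (cohom_scale R J c x) = sch_hom J (HT_const R J (const_poly c) \<otimes>\<^bsub>HT R J\<^esub> p)"
    unfolding scale by (rule h_class[OF HT_mult_closed[OF J k p(1)]])
  also have "\<dots> = coinv_class R (const_poly c * sch_image J p)"
    by (simp add: sch_hom_def[OF J] sch_image_scale[OF J p(1)])
  also have "\<dots> = coinv_class R (const_poly c) \<otimes>\<^bsub>coinv_ring R\<^esub> coinv_class R (sch_image J p)"
    using ring_hom_mult[OF coinv_class_hom, of "const_poly c" "sch_image J p"] sch_image_in[OF J] by (simp add: carrier_S)
  finally show "?h (cohom_scale R J c x) = coinv_scale R c (?h x)"
    using h_class[OF p(1)] by (simp add: coinv_scale_def p(2) sch_hom_def[OF J])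
qed

lemma Sch_structure_constants:
  assumes J: "J \<subseteq> Ix" and u: "u \<in> min_reps R J" and v: "v \<in> min_reps R J"
  shows "schubert_poly R u * schubert_poly R v
    - (\<Sum>w \<in> min_reps R J. const_poly (struct_const R J u v w) * schubert_poly R w) \<in> CI"
proof -
  have "(\<Sum>w \<in> min_reps R J. const_poly (struct_const R J u v w) * schubert_poly R w)
      = sch_image J (pP J u \<otimes>\<^bsub>HT R J\<^esub> pP J v)"
    unfolding sch_image_def[OF J] using struct_const_eq[OF J u v] schubert_poly_eq min_reps_W[OF J]
    by (intro sum.cong) auto
  then show ?thesis
    using sch_image_mult[OF J pP_closed[OF J u] pP_closed[OF J v]] sch_image_pP[OF J]
    by (simp add: u v schubert_poly_eq min_reps_W[OF J])
qed

end

theorem theorem8p2: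
  fixes R :: "'v::ab_group_add root_datum" and J :: "nat set"
  assumes "based_root_system R" and "J \<subseteq> {1..rank R}"
  shows "subring (schubert_span R J) (coinv_ring R) \<and>
    (\<exists>h \<in> ring_iso (cohom R J) ((coinv_ring R)\<lparr>carrier := schubert_span R J\<rparr>).
       \<forall>c. \<forall>x \<in> carrier (cohom R J). h (cohom_scale R J c x) = coinv_scale R c (h x)) \<and>
    (\<forall>w \<in> min_reps R J.
       schubert_poly R w \<in> carrier (sym_alg R) \<and>
       schubert_poly R w \<noteq> 0 \<and>
       homogeneous (coset_length R (wcoset R J w)) (schubert_poly R w) \<and>
       (\<forall>m. Poly_Mapping.lookup (schubert_poly R w) m \<in> \<real>\<^sub>\<ge>\<^sub>0)) \<and>
    (\<forall>u \<in> min_reps R J. \<forall>v \<in> min_reps R J.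
       schubert_poly R u * schubert_poly R v
         - (\<Sum>w \<in> min_reps R J. const_poly (struct_const R J u v w) * schubert_poly R w)
       \<in> coinv_ideal R)"
proof -
  interpret based_root_system R by (rule assms(1))
  have J: "J \<subseteq> Ix" using assms(2) by (simp add: Ix_def)
  have "schubert_poly R w \<in> carrier (sym_alg R) \<and> schubert_poly R w \<noteq> 0 \<and>
      homogeneous (coset_length R (wcoset R J w)) (schubert_poly R w) \<and>
      (\<forall>m. Poly_Mapping.lookup (schubert_poly R w) m \<in> \<real>\<^sub>\<ge>\<^sub>0)" if w: "w \<in> min_reps R J" for w
    using min_reps_W[OF J w] Sch_nonneg Sch_nonzero Sch_in Sch_hom
    by (simp add: schubert_poly_eq carrier_S coset_length_def min_rep_of_min_reps[OF J w] nonneg_poly_def)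
  then show ?thesis
    using schubert_span_subring[OF J] cohom_iso[OF J] Sch_structure_constants[OF J] by blast
qed

end
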